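(* Let $E$ be a vector bundle over a manifold $M$. There exists a 1-to-1 correspondence between equivalence classes of homological vector fields $\partial\in\mathrm{Der}_1(\mathsf{D}^\bullet(E),\pitchfork)$, $\partial^2=0$, and Loday algebroid structures on $E$.
   Context: All manifolds, bundles and sections are smooth; $\mathcal{A}=C^\infty(M)$, $\mathrm{Sec}(E)$ is the space of sections of $E$. Loday algebroids. A Loday bracket on a real vector space is an $\mathbb{R}$-bilinear bracket with $[x,[y,z]]=[[x,y],z]+[y,[x,z]]$. A Loday algebroid structure on $E$ is a Loday bracket $[\cdot,\cdot]$ on $\mathrm{Sec}(E)$ which is a bidifferential operator of total order $\le 1$ and such that every $\mathrm{ad}_X=[X,\cdot]$ is a derivative endomorphism, i.e. for every $f\in\mathcal{A}$ there is $\hat f\in\mathcal{A}$ with $[X,fY]-f[X,Y]=\hat f\,Y$ for all $Y$. Multidifferential operators. For an $\mathbb{R}$-multilinear map $D$ in $p$ arguments from $\mathrm{Sec}(E)$ (with values in $\mathrm{Sec}(E)$ or $\mathcal{A}$), put $(\delta_i(f)D)(X_1,\dots,X_p)=D(X_1,\dots,fX_i,\dots,X_p)-fD(X_1,\dots,X_p)$. $D$ is a differential operator of order $\le k$ in the $i$-th variable if $\delta_i(f_1)\cdots\delta_i(f_{k+1})D=0$ for all $f_1,\dots,f_{k+1}\in\mathcal{A}$; it is multidifferential if, for some $k$, it is of order $\le k$ in each variable; it is of total order (degree) $\le k$ if $\delta_{i_1}(f_1)\cdots\delta_{i_{k+1}}(f_{k+1})D=0$ for all $f_j\in\mathcal{A}$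 and all indices $i_1,\dots,i_{k+1}\in\{1,\dots,p\}$. Shuffle algebras. $\mathcal{D}^p(E)$ is the space of $p$-linear multidifferential operators $\mathrm{Sec}(E)^{\times p}\to C^\infty(M)$, $\mathcal{D}^0(E)=C^\infty(M)$, $\mathcal{D}^\bullet(E)=\bigoplus_{p\ge0}\mathcal{D}^p(E)$. For $\ell'\in\mathcal{D}^p(E)$, $\ell''\in\mathcal{D}^q(E)$ the shuffle product is $$(\ell'\pitchfork\ell'')(X_1,\dots,X_{p+q})=\sum_{\sigma\in\mathrm{sh}(p,q)}\mathrm{sign}(\sigma)\,\ell'(X_{\sigma_1},\dots,X_{\sigma_p})\,\ell''(X_{\sigma_{p+1}},\dots,X_{\sigma_{p+q}}),$$ where $\mathrm{sh}(p,q)$ is the set of permutations of $\{1,\dots,p+q\}$ with $\sigma_1<\dots<\sigma_p$ and $\sigma_{p+1}<\dots<\sigma_{p+q}$. This makes $\mathcal{D}^\bullet(E)$ a graded commutative associative unital $\mathbb{R}$-algebra. For $k\ge1$, $\mathsf{D}^k(E)\subset\mathcal{D}^k(E)$ consists of the operators of order $0$ in the last variable and of total order $\le k-1$; $\mathsf{D}^0(E)=C^\infty(M)$. So $\mathsf{D}^1(E)=\mathrm{Sec}(E^* )$. $\mathsf{D}^\bullet(E)=\bigoplus_{k\ge0}\mathsf{D}^k(E)$ is a subalgebra for $\pitchfork$, called the reduced shuffle algebra; the corresponding graded ringed space $(M,\mathsf{D}^\bullet(E))$ is called a supercommutative manifold. Derivations. A degree $1$ graded derivation of $\mathsf{D}^\bullet(E)$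 is an $\mathbb{R}$-linear map $\partial:\mathsf{D}^\bullet(E)\to\mathsf{D}^{\bullet+1}(E)$ with $\partial(\ell'\pitchfork\ell'')=(\partial\ell')\pitchfork\ell''+(-1)^p\ell'\pitchfork(\partial\ell'')$ for $\ell'\in\mathsf{D}^p(E)$. For such $\partial$, a bracket $[\cdot,\cdot]_\partial$ on $\mathrm{Sec}(E)$ is defined by $$\langle\mathfrak{l},[X,Y]_\partial\rangle=\langle X,\partial\langle\mathfrak{l},Y\rangle\rangle-\langle Y,\partial\langle\mathfrak{l},X\rangle\rangle-(\partial\mathfrak{l})(X,Y),\qquad X,Y\in\mathrm{Sec}(E),\ \mathfrak{l}\in\mathrm{Sec}(E^* ).$$ $\mathrm{Der}_1(\mathsf{D}^\bullet(E),\pitchfork)$ is the space of those degree $1$ graded derivations $\partial$ of the reduced shuffle algebra such that, for all $c\in\mathsf{D}^2(E)$ and $X_1,X_2,X_3\in\mathrm{Sec}(E)$, $$(\partial c)(X_1,X_2,X_3)=\sum_{i=1}^3(-1)^{i+1}\langle\partial(c(X_1,\dots\hat{\imath}\dots,X_3)),X_i\rangle+\sum_{i<j}(-1)^i\,c(X_1,\dots\hat{\imath}\dots,[X_i,X_j]_\partial,\dots,X_3),$$ where $\hat{\imath}$ means that $X_i$ is omitted and $[X_i,X_j]_\partial$ replaces $X_j$ in its place. A homological vector field of the supercommutative manifold $(M,\mathsf{D}^\bullet(E))$ is an element $\partial\in\mathrm{Der}_1(\mathsf{D}^\bullet(E),\pitchfork)$ with $\partial^2=0$. Two homological vector fields are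 equivalent if they coincide on $C^\infty(M)$ and on $\mathrm{Sec}(E^* )$. *)

theory Defs
  imports "HOL-Analysis.Analysis" "HOL-Combinatorics.Permutations"
begin

section \<open>Smooth manifolds and vector bundles\<close>

text \<open>Model spaces are finite-dimensional real inner product spaces rather than types of class
  \<^class>\<open>euclidean_space\<close>, because the latter have positive dimension and would exclude
  0-dimensional manifolds and bundles of rank 0.\<close>

definition finite_dim :: "'a::real_vector itself \<Rightarrow> bool" where
  "finite_dim _ \<longleftrightarrow> (\<exists>B::'a set. finite B \<and> span B = UNIV)"

primrec Ck_on :: "nat \<Rightarrow> 'a::real_normed_vector set \<Rightarrow> ('a \<Rightarrow> 'b::real_normed_vector) \<Rightarrow> bool" where
  "Ck_on 0 = (\<lambda>U f. continuous_on U f)"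
| "Ck_on (Suc k) = (\<lambda>U f. \<exists>f'. (\<forall>x\<in>U. (f has_derivative f' x) (at x)) \<and>
                                (\<forall>v. Ck_on k U (\<lambda>x. f' x v)))"

definition Cinf_on :: "'a::real_normed_vector set \<Rightarrow> ('a \<Rightarrow> 'b::real_normed_vector) \<Rightarrow> bool" where
  "Cinf_on U f \<longleftrightarrow> (\<forall>k. Ck_on k U f)"

text \<open>The points of the manifold are the elements of the type \<open>'m\<close>, whose classes provide the
  Hausdorff and second countability axioms.\<close>

definition smooth_atlas ::
    "('m::{t2_space,second_countable_topology} set \<times> ('m \<Rightarrow> 'e::real_inner)) set \<Rightarrow> bool" where
  "smooth_atlas C \<longleftrightarrow>
     finite_dim TYPE('e) \<and>
     \<Union>(fst ` C) = UNIV \<and>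
     (\<forall>(U, \<phi>)\<in>C. open U \<and> open (\<phi> ` U) \<and> homeomorphism U (\<phi> ` U) \<phi> (inv_into U \<phi>)) \<and>
     (\<forall>(U, \<phi>)\<in>C. \<forall>(V, \<psi>)\<in>C. Cinf_on (\<phi> ` (U \<inter> V)) (\<psi> \<circ> inv_into U \<phi>))"

definition smooth_map_on ::
    "('m set \<times> ('m \<Rightarrow> 'e::real_inner)) set \<Rightarrow> 'm set \<Rightarrow> ('m \<Rightarrow> 'b::real_normed_vector) \<Rightarrow> bool" where
  "smooth_map_on C W f \<longleftrightarrow> (\<forall>(U, \<phi>)\<in>C. Cinf_on (\<phi> ` (U \<inter> W)) (f \<circ> inv_into U \<phi>))"

text \<open>A vector bundle is given by an atlas of its base, its fibres and a vector bundle atlas.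
  The fibre over each point is a linear subspace of an auxiliary real vector space \<open>'v\<close> that
  carries no topology: fibres over different points are related only through the local
  trivializations, so this is an arbitrary family of vector spaces and not a subbundle of a
  trivial bundle.  A local trivialization over \<open>U\<close> is a family of linear isomorphisms from the
  fibres over points of \<open>U\<close> to the typical fibre \<open>'f\<close>.\<close>

record ('m, 'e, 'v, 'f) vbundle =
  charts :: "('m set \<times> ('m \<Rightarrow> 'e)) set"
  fibre :: "'m \<Rightarrow> 'v set"
  trivs :: "('m set \<times> ('m \<Rightarrow> 'v \<Rightarrow> 'f)) set"

definition vector_bundle ::
    "('m::{t2_space,second_countable_topology}, 'e::real_inner, 'v::real_vector, 'f::real_inner) vbundle
      \<Rightarrow> bool" where
  "vector_bundle E \<longleftrightarrow>
     smooth_atlas (charts E) \<and>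
     finite_dim TYPE('f) \<and>
     (\<forall>x. subspace (fibre E x)) \<and>
     \<Union>(fst ` trivs E) = UNIV \<and>
     (\<forall>(U, \<Phi>)\<in>trivs E. open U \<and>
        (\<forall>x\<in>U. bij_betw (\<Phi> x) (fibre E x) UNIV \<and>
           (\<forall>u\<in>fibre E x. \<forall>w\<in>fibre E x. \<Phi> x (u + w) = \<Phi> x u + \<Phi> x w) \<and>
           (\<forall>r. \<forall>u\<in>fibre E x. \<Phi> x (r *\<^sub>R u) = r *\<^sub>R \<Phi> x u))) \<and>
     (\<forall>(U, \<Phi>)\<in>trivs E. \<forall>(V, \<Psi>)\<in>trivs E. \<forall>w.
        smooth_map_on (charts E) (U \<inter> V) (\<lambda>x. \<Psi> x (inv_into (fibre E x) (\<Phi> x) w)))"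

definition Cinf :: "('m, 'e::real_inner, 'v, 'f) vbundle \<Rightarrow> ('m \<Rightarrow> real) set" where
  "Cinf E = {f. smooth_map_on (charts E) UNIV f}"

definition Sec :: "('m, 'e::real_inner, 'v, 'f::real_inner) vbundle \<Rightarrow> ('m \<Rightarrow> 'v) set" where
  "Sec E = {X. (\<forall>x. X x \<in> fibre E x) \<and>
               (\<forall>(U, \<Phi>)\<in>trivs E. smooth_map_on (charts E) U (\<lambda>x. \<Phi> x (X x)))}"


section \<open>Multidifferential operators\<close>

text \<open>A map in \<open>p\<close> arguments from \<^const>\<open>Sec\<close> is a function on lists of length \<open>p\<close>; arguments
  are numbered from 0.\<close>

definition fmult :: "('m \<Rightarrow> real) \<Rightarrow> ('m \<Rightarrow> 'w::real_vector) \<Rightarrow> 'm \<Rightarrow> 'w" where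
  "fmult f X = (\<lambda>x. f x *\<^sub>R X x)"

definition args :: "('m, 'e::real_inner, 'v, 'f::real_inner) vbundle \<Rightarrow> nat \<Rightarrow> ('m \<Rightarrow> 'v) list set" where
  "args E p = {Xs. length Xs = p \<and> set Xs \<subseteq> Sec E}"

definition \<delta> :: "nat \<Rightarrow> ('m \<Rightarrow> real) \<Rightarrow> (('m \<Rightarrow> 'v::real_vector) list \<Rightarrow> 'm \<Rightarrow> 'w::real_vector)
    \<Rightarrow> ('m \<Rightarrow> 'v) list \<Rightarrow> 'm \<Rightarrow> 'w" where
  "\<delta> i f D = (\<lambda>Xs x. D (Xs[i := fmult f (Xs ! i)]) x - f x *\<^sub>R D Xs x)"

definition order_le :: "('m, 'e::real_inner, 'v::real_vector, 'f::real_inner) vbundle \<Rightarrow> nat \<Rightarrow> nat \<Rightarrow> nat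
    \<Rightarrow> (('m \<Rightarrow> 'v) list \<Rightarrow> 'm \<Rightarrow> 'w::real_vector) \<Rightarrow> bool" where
  "order_le E p i k D \<longleftrightarrow>
     (\<forall>fs. length fs = k + 1 \<and> set fs \<subseteq> Cinf E \<longrightarrow>
        (\<forall>Xs\<in>args E p. foldr (\<delta> i) fs D Xs = (\<lambda>x. 0)))"

definition total_order_le :: "('m, 'e::real_inner, 'v::real_vector, 'f::real_inner) vbundle \<Rightarrow> nat \<Rightarrow> nat
    \<Rightarrow> (('m \<Rightarrow> 'v) list \<Rightarrow> 'm \<Rightarrow> 'w::real_vector) \<Rightarrow> bool" where
  "total_order_le E p k D \<longleftrightarrow>
     (\<forall>ifs. length ifs = k + 1 \<and> set ifs \<subseteq> {..<p} \<times> Cinf E \<longrightarrow>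
        (\<forall>Xs\<in>args E p. foldr (\<lambda>(i, f). \<delta> i f) ifs D Xs = (\<lambda>x. 0)))"

definition multilinear :: "('m, 'e::real_inner, 'v::real_vector, 'f::real_inner) vbundle \<Rightarrow> nat
    \<Rightarrow> (('m \<Rightarrow> 'v) list \<Rightarrow> 'm \<Rightarrow> 'w::real_vector) \<Rightarrow> bool" where
  "multilinear E p D \<longleftrightarrow>
     (\<forall>Xs\<in>args E p. \<forall>i<p. \<forall>Y\<in>Sec E. \<forall>Z\<in>Sec E. \<forall>r.
        D (Xs[i := (\<lambda>x. Y x + Z x)]) = (\<lambda>x. D (Xs[i := Y]) x + D (Xs[i := Z]) x) \<and>
        D (Xs[i := (\<lambda>x. r *\<^sub>R Y x)]) = (\<lambda>x. r *\<^sub>R D (Xs[i := Y]) x))"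

definition multidifferential :: "('m, 'e::real_inner, 'v::real_vector, 'f::real_inner) vbundle \<Rightarrow> nat
    \<Rightarrow> ('m \<Rightarrow> 'w::real_vector) set \<Rightarrow> (('m \<Rightarrow> 'v) list \<Rightarrow> 'm \<Rightarrow> 'w) \<Rightarrow> bool" where
  "multidifferential E p V D \<longleftrightarrow>
     (\<forall>Xs\<in>args E p. D Xs \<in> V) \<and> multilinear E p D \<and> (\<exists>k. \<forall>i<p. order_le E p i k D)"


section \<open>Loday algebroid structures\<close>

text \<open>Brackets are normalized to vanish outside \<^const>\<open>Sec\<close>, so that two structures are equal
  iff they agree on sections.\<close>

definition loday_algebroids :: "('m, 'e::real_inner, 'v::real_vector, 'f::real_inner) vbundle
    \<Rightarrow> (('m \<Rightarrow> 'v) \<Rightarrow> ('m \<Rightarrow> 'v) \<Rightarrow> 'm \<Rightarrow> 'v) set" where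
  "loday_algebroids E = {B.
     (\<forall>X Y. \<not> (X \<in> Sec E \<and> Y \<in> Sec E) \<longrightarrow> B X Y = (\<lambda>x. 0)) \<and>
     multidifferential E 2 (Sec E) (\<lambda>Xs. B (Xs ! 0) (Xs ! 1)) \<and>
     total_order_le E 2 1 (\<lambda>Xs. B (Xs ! 0) (Xs ! 1)) \<and>
     (\<forall>X\<in>Sec E. \<forall>Y\<in>Sec E. \<forall>Z\<in>Sec E.
        B X (B Y Z) = (\<lambda>x. B (B X Y) Z x + B Y (B X Z) x)) \<and>
     (\<forall>X\<in>Sec E. \<forall>f\<in>Cinf E. \<exists>g\<in>Cinf E. \<forall>Y\<in>Sec E.
        (\<lambda>x. B X (fmult f Y) x - f x *\<^sub>R B X Y x) = fmult g Y)}"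


section \<open>The reduced shuffle algebra\<close>

type_synonym ('m, 'v) cochain = "('m \<Rightarrow> 'v) list \<Rightarrow> 'm \<Rightarrow> real"

text \<open>A homogeneous element of degree \<open>p\<close> is extended by 0 to all other lists.  An element of the
  direct sum over all degrees is then a single function on lists, whose component of degree \<open>p\<close>
  is its restriction to lists of length \<open>p\<close>.\<close>

definition diff_ops :: "('m, 'e::real_inner, 'v::real_vector, 'f::real_inner) vbundle \<Rightarrow> nat
    \<Rightarrow> ('m, 'v) cochain set" where
  "diff_ops E p = {c. (\<forall>Xs. Xs \<notin> args E p \<longrightarrow> c Xs = (\<lambda>x. 0)) \<and> multidifferential E p (Cinf E) c}"

definition reduced_ops :: "('m, 'e::real_inner, 'v::real_vector, 'f::real_inner) vbundle \<Rightarrow> nat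
    \<Rightarrow> ('m, 'v) cochain set" where
  "reduced_ops E k = {c \<in> diff_ops E k.
     k \<ge> 1 \<longrightarrow> order_le E k (k - 1) 0 c \<and> total_order_le E k (k - 1) c}"

definition component :: "nat \<Rightarrow> ('m, 'v) cochain \<Rightarrow> ('m, 'v) cochain" where
  "component p c = (\<lambda>Xs. if length Xs = p then c Xs else (\<lambda>x. 0))"

definition reduced_shuffle :: "('m, 'e::real_inner, 'v::real_vector, 'f::real_inner) vbundle
    \<Rightarrow> ('m, 'v) cochain set" where
  "reduced_shuffle E = {c. (\<forall>p. component p c \<in> reduced_ops E p) \<and>
                           finite {p. component p c \<noteq> (\<lambda>Xs x. 0)}}"

definition sh :: "nat \<Rightarrow> nat \<Rightarrow> (nat \<Rightarrow> nat) set" where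
  "sh p q = {\<sigma>. \<sigma> permutes {..<p + q} \<and> strict_mono_on {..<p} \<sigma> \<and> strict_mono_on {p..<p + q} \<sigma>}"

text \<open>The bilinear extension of the shuffle product to the direct sum: on homogeneous factors of
  degrees \<open>p\<close> and \<open>q\<close> only the summand with that \<open>p\<close> and \<open>length Xs = p + q\<close> can be nonzero.\<close>

definition shuffle :: "('m, 'v) cochain \<Rightarrow> ('m, 'v) cochain \<Rightarrow> ('m, 'v) cochain" (infixl "\<pitchfork>" 70) where
  "c \<pitchfork> d = (\<lambda>Xs x. \<Sum>p\<le>length Xs. \<Sum>\<sigma>\<in>sh p (length Xs - p).
     of_int (sign \<sigma>) * c (map (\<lambda>i. Xs ! \<sigma> i) [0..<p]) x * d (map (\<lambda>i. Xs ! \<sigma> i) [p..<length Xs]) x)"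


section \<open>Homological vector fields\<close>

text \<open>A function as an element of degree 0.\<close>

definition fn :: "('m \<Rightarrow> real) \<Rightarrow> ('m, 'v) cochain" where
  "fn f = (\<lambda>Xs. if Xs = [] then f else (\<lambda>x. 0))"

definition graded_derivations :: "('m, 'e::real_inner, 'v::real_vector, 'f::real_inner) vbundle
    \<Rightarrow> (('m, 'v) cochain \<Rightarrow> ('m, 'v) cochain) set" where
  "graded_derivations E = {d \<in> extensional (reduced_shuffle E).
     (\<forall>k. \<forall>c\<in>reduced_ops E k. d c \<in> reduced_ops E (Suc k)) \<and>
     (\<forall>a\<in>reduced_shuffle E. \<forall>b\<in>reduced_shuffle E.
        d (\<lambda>Xs x. a Xs x + b Xs x) = (\<lambda>Xs x. d a Xs x + d b Xs x)) \<and>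
     (\<forall>r. \<forall>a\<in>reduced_shuffle E. d (\<lambda>Xs x. r * a Xs x) = (\<lambda>Xs x. r * d a Xs x)) \<and>
     (\<forall>p. \<forall>a\<in>reduced_ops E p. \<forall>b\<in>reduced_shuffle E.
        d (a \<pitchfork> b) = (\<lambda>Xs x. (d a \<pitchfork> b) Xs x + (- 1) ^ p * (a \<pitchfork> d b) Xs x))}"

text \<open>Sections of the dual bundle are the elements of \<open>reduced_ops E 1\<close>, with pairing
  \<open>\<langle>l, X\<rangle> = l [X]\<close>.\<close>

definition derived_bracket :: "('m, 'e::real_inner, 'v::real_vector, 'f::real_inner) vbundle
    \<Rightarrow> (('m, 'v) cochain \<Rightarrow> ('m, 'v) cochain) \<Rightarrow> ('m \<Rightarrow> 'v) \<Rightarrow> ('m \<Rightarrow> 'v) \<Rightarrow> 'm \<Rightarrow> 'v" where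
  "derived_bracket E d X Y =
     (if X \<in> Sec E \<and> Y \<in> Sec E
      then THE Z. Z \<in> Sec E \<and> (\<forall>l\<in>reduced_ops E 1.
             l [Z] = (\<lambda>x. d (fn (l [Y])) [X] x - d (fn (l [X])) [Y] x - d l [X, Y] x))
      else (\<lambda>x. 0))"

definition Der1 :: "('m, 'e::real_inner, 'v::real_vector, 'f::real_inner) vbundle
    \<Rightarrow> (('m, 'v) cochain \<Rightarrow> ('m, 'v) cochain) set" where
  "Der1 E = {d \<in> graded_derivations E.
     \<forall>c\<in>reduced_ops E 2. \<forall>X1\<in>Sec E. \<forall>X2\<in>Sec E. \<forall>X3\<in>Sec E.
       d c [X1, X2, X3] = (\<lambda>x.
           d (fn (c [X2, X3])) [X1] x - d (fn (c [X1, X3])) [X2] x + d (fn (c [X1, X2])) [X3] x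
         - c [derived_bracket E d X1 X2, X3] x
         - c [X2, derived_bracket E d X1 X3] x
         + c [X1, derived_bracket E d X2 X3] x)}"

definition homological_fields :: "('m, 'e::real_inner, 'v::real_vector, 'f::real_inner) vbundle
    \<Rightarrow> (('m, 'v) cochain \<Rightarrow> ('m, 'v) cochain) set" where
  "homological_fields E = {d \<in> Der1 E. \<forall>c\<in>reduced_shuffle E. d (d c) = (\<lambda>Xs x. 0)}"

definition field_equiv :: "('m, 'e::real_inner, 'v::real_vector, 'f::real_inner) vbundle
    \<Rightarrow> ((('m, 'v) cochain \<Rightarrow> ('m, 'v) cochain) \<times> (('m, 'v) cochain \<Rightarrow> ('m, 'v) cochain)) set" where
  "field_equiv E = {(d, d'). d \<in> homological_fields E \<and> d' \<in> homological_fields E \<and>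
     (\<forall>c\<in>reduced_ops E 0 \<union> reduced_ops E 1. d c = d' c)}"

end

theory Submission
  imports Defs
begin

text \<open>
  A homological field \<open>\<partial>\<close> has the anchor \<open>\<rho>(X) f = \<langle>X, \<partial> f\<rangle>\<close>.  The right-hand side of the formula
  for \<open>[X, Y]\<close> is function-linear in the covector, so by reflexivity of the module of sections
  (local frames cut off by bump functions) it defines a section.  That \<open>\<partial>\<close> lands in the reduced
  operators gives the order conditions on the bracket, tested on covectors; \<open>\<partial>\<^sup>2 f = 0\<close> makes the
  anchor a homomorphism, and \<open>\<partial>\<^sup>2 l = 0\<close> together with the prescribed form of \<open>\<partial>\<close> on 2-cochains is
  the Jacobi identity.  In positive rank some section does not vanish at a given point, so the
  bracket determines the anchor, and then \<open>\<partial>\<close> on functions and covectors; in rank 0 all sections and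
  covectors vanish.

  Conversely, the Loday differential of a Loday algebroid is defined recursively by Cartan's formula
  \<open>\<iota>\<^sub>X \<partial> = L\<^sub>X - \<partial> \<iota>\<^sub>X\<close>, with \<open>\<iota>\<^sub>X\<close> the insertion of a first argument.  As \<open>\<iota>\<^sub>X\<close> is a graded
  derivation of the shuffle product, the identities \<open>[L\<^sub>X, L\<^sub>Y] = L\<^bsub>[X, Y]\<^esub>\<close>, \<open>[L\<^sub>X, \<partial>] = 0\<close>,
  \<open>\<partial>\<^sup>2 = 0\<close> and the Leibniz rules for \<open>L\<^sub>X\<close> and \<open>\<partial>\<close> all follow by induction on the list of
  arguments.  Orders add up under composition, which bounds the total order of \<open>\<partial>c\<close>; the terms
  spoiling order 0 in the last argument cancel.
\<close>

section \<open>Shuffles\<close>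

definition shift_perm :: "(nat \<Rightarrow> nat) \<Rightarrow> nat \<Rightarrow> nat" where
  "shift_perm \<sigma> = case_nat 0 (\<lambda>i. Suc (\<sigma> i))"

definition front_cycle :: "nat \<Rightarrow> nat \<Rightarrow> nat" where
  "front_cycle p i = (if i < p then Suc i else if i = p then 0 else i)"

lemma shift_perm_simps [simp]:
  "shift_perm \<sigma> 0 = 0" "shift_perm \<sigma> (Suc i) = Suc (\<sigma> i)"
  by (simp_all add: shift_perm_def)

lemma inj_shift_perm: "inj shift_perm"
  by (rule injI) (metis ext nat.inject shift_perm_simps(2))

lemma bij_shift_perm_iff: "bij (shift_perm \<sigma>) \<longleftrightarrow> bij \<sigma>"
proof -
  have UNIV: "(UNIV :: nat set) = insert 0 (range Suc)" by (rule UNIV_nat_eq)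
  have "inj (shift_perm \<sigma>) \<longleftrightarrow> inj \<sigma>"
    by (subst UNIV) (auto simp: inj_on_def)
  moreover have "surj (shift_perm \<sigma>) \<longleftrightarrow> surj \<sigma>"
  proof -
    have "range (shift_perm \<sigma>) = insert 0 (Suc ` range \<sigma>)"
      by (subst UNIV) (simp add: image_image)
    then have "surj (shift_perm \<sigma>) \<longleftrightarrow> insert 0 (Suc ` range \<sigma>) = insert 0 (range Suc)"
      by (simp only: UNIV[symmetric])
    also have "\<dots> \<longleftrightarrow> Suc ` range \<sigma> = range Suc" by (rule insert_ident) auto
    also have "\<dots> \<longleftrightarrow> surj \<sigma>" by (rule inj_image_eq_iff) simp
    finally show ?thesis .
  qed
  ultimately show ?thesis by (simp add: bij_def)
qed

lemma shift_perm_permutes_iff: "shift_perm \<sigma> permutes {..<Suc n} \<longleftrightarrow> \<sigma> permutes {..<n}"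
proof -
  have "(\<forall>i. i \<notin> {..<Suc n} \<longrightarrow> shift_perm \<sigma> i = i) \<longleftrightarrow> (\<forall>i. i \<notin> {..<n} \<longrightarrow> \<sigma> i = i)"
    by (auto simp: shift_perm_def split: nat.splits)
  then show ?thesis
    unfolding permutes_def bij_iff[symmetric] bij_shift_perm_iff by simp
qed

lemma fixes_0_imp_shift_perm:
  assumes "inj \<sigma>" "\<sigma> 0 = 0"
  obtains \<tau> where "\<sigma> = shift_perm \<tau>"
proof
  have "\<sigma> (Suc i) \<noteq> 0" for i using injD[OF assms(1), of "Suc i" 0] assms(2) by auto
  then show "\<sigma> = shift_perm (\<lambda>i. \<sigma> (Suc i) - 1)"
    using assms(2) by (auto simp: shift_perm_def fun_eq_iff split: nat.split)
qed

lemma shift_perm_eq_map_permutation: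
  assumes "\<sigma> permutes {..<n}" shows "shift_perm \<sigma> = map_permutation {..<n} Suc \<sigma>"
proof
  fix i
  show "shift_perm \<sigma> i = map_permutation {..<n} Suc \<sigma> i"
  proof (cases "i \<in> Suc ` {..<n}")
    case True
    then show ?thesis by (auto simp: map_permutation_apply)
  next
    case False
    then show ?thesis
      using permutes_not_in[OF assms, of "i - 1"]
      by (cases i) (auto simp: map_permutation_def restrict_id_def)
  qed
qed

lemma sign_shift_perm: "\<sigma> permutes {..<n} \<Longrightarrow> sign (shift_perm \<sigma>) = sign \<sigma>"
  by (simp add: shift_perm_eq_map_permutation sign_map_permutation)

lemma front_cycle_Suc: "front_cycle (Suc p) = front_cycle p \<circ> Transposition.transpose p (Suc p)"
  by (auto simp: fun_eq_iff front_cycle_def Transposition.transpose_def)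

lemma front_cycle_permutes: "p \<le> n \<Longrightarrow> front_cycle p permutes {..<Suc n}"
proof (induction p)
  case 0
  have "front_cycle 0 = id" by (auto simp: fun_eq_iff front_cycle_def)
  then show ?case using permutes_id by metis
next
  case (Suc p)
  then show ?case
    unfolding front_cycle_Suc by (intro permutes_compose permutes_swap_id) auto
qed

lemma sign_front_cycle: "sign (front_cycle p) = (- 1) ^ p"
proof (induction p)
  case 0
  have "front_cycle 0 = id" by (auto simp: fun_eq_iff front_cycle_def)
  then show ?case by simp
next
  case (Suc p)
  have "permutation (front_cycle p)"
    using front_cycle_permutes permutes_imp_permutation finite_lessThan by blast
  then show ?case
    using Suc by (simp only: front_cycle_Suc sign_compose permutation_swap_id sign_swap_id) simp
qed

lemma sign_shift_perm_front_cycle: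
  assumes "\<sigma> permutes {..<n}"
  shows "sign (shift_perm \<sigma> \<circ> front_cycle p) = (- 1) ^ p * sign \<sigma>"
proof -
  have "permutation (shift_perm \<sigma>)" "permutation (front_cycle p)"
    using shift_perm_permutes_iff assms front_cycle_permutes[OF order_refl]
      permutes_imp_permutation finite_lessThan by blast+
  then show ?thesis by (simp add: sign_compose sign_shift_perm[OF assms] sign_front_cycle)
qed

lemma permute_list_shift_perm: "permute_list (shift_perm \<sigma>) (X # Xs) = X # permute_list \<sigma> Xs"
  by (simp add: permute_list_def upt_conv_Cons map_Suc_upt[symmetric] del: upt_Suc)

lemma permute_list_front_cycle:
  "p \<le> length Xs \<Longrightarrow> permute_list (front_cycle p) (X # Xs) = take p Xs @ X # drop p Xs"
  by (rule nth_equalityI)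
    (auto simp: permute_list_def front_cycle_def nth_append nth_Cons' simp del: upt_Suc)

lemma strict_mono_on_Suc_image: "strict_mono_on (Suc ` A) f \<longleftrightarrow> strict_mono_on A (\<lambda>i. f (Suc i))"
  by (auto simp: strict_mono_on_def)

lemma strict_mono_on_insert_Suc_image:
  assumes "\<And>i. i \<in> A \<Longrightarrow> k \<le> i"
  shows "strict_mono_on (insert k (Suc ` A)) f \<longleftrightarrow>
    strict_mono_on A (\<lambda>i. f (Suc i)) \<and> (\<forall>i\<in>A. f k < f (Suc i))" (is "?L \<longleftrightarrow> ?R")
proof
  assume ?L
  then show ?R using assms unfolding strict_mono_on_def by (simp add: le_imp_less_Suc)
next
  assume ?R
  then show ?L
  proof (intro strict_mono_onI)
    fix r s assume "r \<in> insert k (Suc ` A)" "s \<in> insert k (Suc ` A)" "r < s"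
    moreover from this obtain j where "s = Suc j" "j \<in> A" using assms by fastforce
    ultimately show "f r < f s" using \<open>?R\<close> by (auto simp: strict_mono_on_def)
  qed
qed

lemma shift_perm_in_sh_iff: "shift_perm \<sigma> \<in> sh (Suc p) q \<longleftrightarrow> \<sigma> \<in> sh p q"
proof -
  have "strict_mono_on {Suc p..<Suc p + q} (shift_perm \<sigma>) \<longleftrightarrow> strict_mono_on {p..<p + q} \<sigma>"
    using strict_mono_on_Suc_image[of "{p..<p + q}" "shift_perm \<sigma>"]
    by (simp add: strict_mono_on_def)
  moreover have "strict_mono_on {..<Suc p} (shift_perm \<sigma>) \<longleftrightarrow> strict_mono_on {..<p} \<sigma>"
    unfolding lessThan_Suc_eq_insert_0 strict_mono_on_insert_Suc_image[OF le0]
    by (simp add: strict_mono_on_def)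
  ultimately show ?thesis by (simp add: sh_def shift_perm_permutes_iff del: lessThan_Suc)
qed

lemma shift_perm_front_cycle_in_sh_iff:
  "shift_perm \<sigma> \<circ> front_cycle p \<in> sh p (Suc q) \<longleftrightarrow> \<sigma> \<in> sh p q"
proof -
  let ?\<sigma> = "shift_perm \<sigma> \<circ> front_cycle p"
  have cycle: "front_cycle p permutes {..<Suc (p + q)}" by (simp add: front_cycle_permutes)
  have "?\<sigma> permutes {..<Suc (p + q)} \<longleftrightarrow> shift_perm \<sigma> permutes {..<Suc (p + q)}"
  proof
    assume "?\<sigma> permutes {..<Suc (p + q)}"
    then have "?\<sigma> \<circ> inv (front_cycle p) permutes {..<Suc (p + q)}"
      by (rule permutes_compose[OF permutes_inv[OF cycle]])
    then show "shift_perm \<sigma> permutes {..<Suc (p + q)}"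
      by (simp add: comp_assoc permutes_inv_o[OF cycle])
  qed (rule permutes_compose[OF cycle])
  moreover have "strict_mono_on {..<p} ?\<sigma> \<longleftrightarrow> strict_mono_on {..<p} \<sigma>"
    by (auto simp: strict_mono_on_def front_cycle_def)
  moreover have "strict_mono_on {p..<p + Suc q} ?\<sigma> \<longleftrightarrow> strict_mono_on {p..<p + q} \<sigma>"
  proof -
    have "{p..<p + Suc q} = insert p (Suc ` {p..<p + q})" by auto
    then have "strict_mono_on {p..<p + Suc q} ?\<sigma> \<longleftrightarrow>
        strict_mono_on {p..<p + q} (\<lambda>i. ?\<sigma> (Suc i)) \<and> (\<forall>i\<in>{p..<p + q}. ?\<sigma> p < ?\<sigma> (Suc i))"
      using strict_mono_on_insert_Suc_image[of "{p..<p + q}" p ?\<sigma>] by simp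
    then show ?thesis by (simp add: strict_mono_on_def front_cycle_def)
  qed
  ultimately show ?thesis by (simp add: sh_def shift_perm_permutes_iff)
qed

lemma sh_preimage_0:
  assumes shuffle: "\<sigma> \<in> sh p q" and "p + q > 0"
  shows "p > 0 \<and> \<sigma> 0 = 0 \<or> q > 0 \<and> \<sigma> p = 0"
proof -
  have perm: "\<sigma> permutes {..<p + q}" using shuffle by (simp add: sh_def)
  then obtain i where preimage: "\<sigma> i = 0" by (metis permutes_inverses(1))
  then have "i < p + q" using permutes_in_image[OF perm, of i] assms(2) by simp
  have first: "strict_mono_on {..<p} \<sigma>" and last: "strict_mono_on {p..<p + q} \<sigma>"
    using shuffle by (simp_all add: sh_def)
  show ?thesis
  proof (cases "i < p")
    case True
    then have "i = 0" using strict_mono_onD[OF first, of 0 i] preimage by (cases "i = 0") auto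
    then show ?thesis using True preimage by simp
  next
    case False
    then have "i = p"
      using strict_mono_onD[OF last, of p i] preimage \<open>i < p + q\<close> by (cases "i = p") auto
    then show ?thesis using preimage \<open>i < p + q\<close> by simp
  qed
qed

lemma sh_fixing_0: "{\<sigma> \<in> sh (Suc p) q. \<sigma> 0 = 0} = shift_perm ` sh p q"
proof -
  have "\<exists>\<tau>. \<sigma> = shift_perm \<tau>" if "\<sigma> \<in> sh (Suc p) q" "\<sigma> 0 = 0" for \<sigma>
    using that fixes_0_imp_shift_perm[of \<sigma>] permutes_inj by (fastforce simp: sh_def)
  then show ?thesis using shift_perm_in_sh_iff by fastforce
qed

lemma sh_mapping_to_0:
  "{\<sigma> \<in> sh p (Suc q). \<sigma> p = 0} = (\<lambda>\<tau>. shift_perm \<tau> \<circ> front_cycle p) ` sh p q"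
proof -
  have cycle: "front_cycle p permutes {..<Suc (p + q)}" by (simp add: front_cycle_permutes)
  have "\<exists>\<tau>. \<sigma> = shift_perm \<tau> \<circ> front_cycle p" if shuffle: "\<sigma> \<in> sh p (Suc q)" "\<sigma> p = 0" for \<sigma>
  proof -
    have "\<sigma> permutes {..<Suc (p + q)}" using shuffle(1) by (simp add: sh_def)
    then have "inj (\<sigma> \<circ> inv (front_cycle p))"
      using cycle by (metis permutes_compose permutes_inj permutes_inv)
    moreover have "inv (front_cycle p) 0 = p"
      using permutes_inv_eq[OF cycle] by (simp add: front_cycle_def)
    ultimately obtain \<tau> where "\<sigma> \<circ> inv (front_cycle p) = shift_perm \<tau>"
      using fixes_0_imp_shift_perm shuffle(2) by (metis comp_apply)
    then have "\<sigma> = shift_perm \<tau> \<circ> front_cycle p"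
      using permutes_inv_o(2)[OF cycle] by (metis comp_assoc comp_id)
    then show ?thesis by blast
  qed
  moreover have "(shift_perm \<tau> \<circ> front_cycle p) p = 0" for \<tau> by (simp add: front_cycle_def)
  ultimately show ?thesis using shift_perm_front_cycle_in_sh_iff[of _ p q] by fastforce
qed

lemma finite_sh: "finite (sh p q)"
  by (rule finite_subset[OF _ finite_permutations[of "{..<p + q}"]]) (auto simp: sh_def)

lemma sum_sh:
  fixes g :: "(nat \<Rightarrow> nat) \<Rightarrow> 'a::comm_monoid_add"
  assumes "p + q > 0"
  shows "sum g (sh p q) =
    (case p of 0 \<Rightarrow> 0 | Suc p' \<Rightarrow> \<Sum>\<tau>\<in>sh p' q. g (shift_perm \<tau>)) +
    (case q of 0 \<Rightarrow> 0 | Suc q' \<Rightarrow> \<Sum>\<tau>\<in>sh p q'. g (shift_perm \<tau> \<circ> front_cycle p))"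
proof -
  let ?A = "{\<sigma> \<in> sh p q. p > 0 \<and> \<sigma> 0 = 0}" and ?B = "{\<sigma> \<in> sh p q. q > 0 \<and> \<sigma> p = 0}"
  have "inj \<sigma>" if "\<sigma> \<in> sh p q" for \<sigma> using that permutes_inj by (auto simp: sh_def)
  then have "?A \<inter> ?B = {}" using injD[of _ 0 p] by fastforce
  moreover have "sh p q = ?A \<union> ?B" using sh_preimage_0[OF _ assms] by blast
  ultimately have "sum g (sh p q) = sum g ?A + sum g ?B"
    using finite_sh by (metis (no_types, lifting) finite_Un sum.union_disjoint)
  moreover have "sum g ?A = (case p of 0 \<Rightarrow> 0 | Suc p' \<Rightarrow> \<Sum>\<tau>\<in>sh p' q. g (shift_perm \<tau>))"
    using inj_shift_perm
    by (cases p) (simp_all add: sh_fixing_0 sum.reindex inj_on_def inj_def)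
  moreover have "inj_on (\<lambda>\<tau>. shift_perm \<tau> \<circ> front_cycle p) S" for S
  proof (rule inj_onI)
    fix \<sigma> \<tau> assume "shift_perm \<sigma> \<circ> front_cycle p = shift_perm \<tau> \<circ> front_cycle p"
    then have "shift_perm \<sigma> = shift_perm \<tau>"
      using permutes_inv_o(1)[OF front_cycle_permutes[OF order_refl, of p]]
      by (metis comp_assoc comp_id)
    then show "\<sigma> = \<tau>" using inj_shift_perm by (simp add: inj_def)
  qed
  then have "sum g ?B = (case q of 0 \<Rightarrow> 0 | Suc q' \<Rightarrow> \<Sum>\<tau>\<in>sh p q'. g (shift_perm \<tau> \<circ> front_cycle p))"
    by (cases q) (simp_all add: sh_mapping_to_0 sum.reindex)
  ultimately show ?thesis by simp
qed

section \<open>The shuffle product\<close>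

definition shuffle_part :: "nat \<Rightarrow> ('m, 'v) cochain \<Rightarrow> ('m, 'v) cochain \<Rightarrow> ('m, 'v) cochain" where
  "shuffle_part p a b = (\<lambda>Xs x. \<Sum>\<sigma>\<in>sh p (length Xs - p).
     of_int (sign \<sigma>) * a (take p (permute_list \<sigma> Xs)) x * b (drop p (permute_list \<sigma> Xs)) x)"

definition contraction :: "('m \<Rightarrow> 'v) \<Rightarrow> ('m, 'v) cochain \<Rightarrow> ('m, 'v) cochain" ("\<iota>") where
  "\<iota> X c = (\<lambda>Ys. c (X # Ys))"

definition grade_involution :: "('m, 'v) cochain \<Rightarrow> ('m, 'v) cochain" ("\<epsilon>") where
  "\<epsilon> c = (\<lambda>Ys y. (- 1) ^ length Ys * c Ys y)"

lemma shuffle_eq_sum_parts: "(a \<pitchfork> b) Xs x = (\<Sum>p\<le>length Xs. shuffle_part p a b Xs x)"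
  unfolding shuffle_def shuffle_part_def permute_list_def
  by (intro sum.cong refl) (simp add: take_map drop_map)

lemma shuffle_part_Cons:
  assumes "p \<le> Suc (length Xs)"
  shows "shuffle_part p a b (X # Xs) x =
    (case p of 0 \<Rightarrow> 0 | Suc p' \<Rightarrow> shuffle_part p' (\<iota> X a) b Xs x) +
    (case Suc (length Xs) - p of 0 \<Rightarrow> 0 | Suc q' \<Rightarrow> (- 1) ^ p * shuffle_part p a (\<iota> X b) Xs x)"
proof -
  define q where "q = Suc (length Xs) - p"
  define g where "g \<sigma> = of_int (sign \<sigma>) * a (take p (permute_list \<sigma> (X # Xs))) x
    * b (drop p (permute_list \<sigma> (X # Xs))) x" for \<sigma>
  have "(\<Sum>\<tau>\<in>sh p' q. g (shift_perm \<tau>)) = shuffle_part p' (\<iota> X a) b Xs x" if "p = Suc p'" for p'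
  proof -
    have "length Xs - p' = q" using assms that by (simp add: q_def)
    then show ?thesis
      unfolding shuffle_part_def g_def contraction_def
      by (intro sum.cong)
        (auto simp: that permute_list_shift_perm sign_shift_perm[where n = "p' + q"] sh_def)
  qed
  moreover have "(\<Sum>\<tau>\<in>sh p q'. g (shift_perm \<tau> \<circ> front_cycle p))
      = (- 1) ^ p * shuffle_part p a (\<iota> X b) Xs x" if "q = Suc q'" for q'
  proof -
    have q'_length: "length Xs - p = q'" "p \<le> length Xs" using that by (auto simp: q_def)
    have "permute_list (shift_perm \<tau> \<circ> front_cycle p) (X # Xs)
        = take p (permute_list \<tau> Xs) @ X # drop p (permute_list \<tau> Xs)" for \<tau>
      using q'_length(2) permute_list_compose[of "front_cycle p" "X # Xs" "shift_perm \<tau>"]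
      by (simp add: front_cycle_permutes permute_list_shift_perm permute_list_front_cycle)
    then show ?thesis
      unfolding shuffle_part_def g_def contraction_def sum_distrib_left
      using q'_length by (intro sum.cong)
        (auto simp: sign_shift_perm_front_cycle[where n = "p + q'"] sh_def min_def mult_ac)
  qed
  moreover have "shuffle_part p a b (X # Xs) x = sum g (sh p q)"
    by (simp add: shuffle_part_def g_def q_def)
  moreover have "p + q > 0" using assms by (simp add: q_def)
  ultimately show ?thesis
    unfolding q_def[symmetric] by (simp add: sum_sh split: nat.splits)
qed

lemma shuffle_Nil: "(a \<pitchfork> b) [] x = a [] x * b [] x"
proof -
  have "sh 0 0 = {id}" by (auto simp: sh_def)
  then show ?thesis by (simp add: shuffle_def)
qed

text \<open>Contraction is a graded derivation of the shuffle product; together with \<open>shuffle_Nil\<close> this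
  recursion determines the product.\<close>

lemma shuffle_Cons: "(a \<pitchfork> b) (X # Xs) x = (\<iota> X a \<pitchfork> b) Xs x + (\<epsilon> a \<pitchfork> \<iota> X b) Xs x"
proof -
  let ?n = "length Xs"
  let ?first = "\<lambda>p. case p of 0 \<Rightarrow> 0 | Suc p' \<Rightarrow> shuffle_part p' (\<iota> X a) b Xs x"
  let ?last = "\<lambda>p. case Suc ?n - p of 0 \<Rightarrow> 0 | Suc q' \<Rightarrow> (- 1) ^ p * shuffle_part p a (\<iota> X b) Xs x"
  have "(a \<pitchfork> b) (X # Xs) x = (\<Sum>p\<le>Suc ?n. ?first p + ?last p)"
    unfolding shuffle_eq_sum_parts by (intro sum.cong) (simp_all add: shuffle_part_Cons)
  also have "\<dots> = (\<Sum>p\<le>Suc ?n. ?first p) + (\<Sum>p\<le>Suc ?n. ?last p)" by (rule sum.distrib)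
  also have "(\<Sum>p\<le>Suc ?n. ?first p) = (\<iota> X a \<pitchfork> b) Xs x"
    unfolding sum.atMost_Suc_shift by (simp add: shuffle_eq_sum_parts)
  also have "(\<Sum>p\<le>Suc ?n. ?last p) = (\<Sum>p\<le>?n. (- 1) ^ p * shuffle_part p a (\<iota> X b) Xs x)"
    by (simp add: Suc_diff_le)
  also have "\<dots> = (\<epsilon> a \<pitchfork> \<iota> X b) Xs x"
    unfolding shuffle_eq_sum_parts shuffle_part_def sum_distrib_left
    by (intro sum.cong) (auto simp: grade_involution_def mult_ac min_def)
  finally show ?thesis .
qed

lemma shuffle_linear_left:
  "((\<lambda>Ys y. r * a Ys y + s * a' Ys y) \<pitchfork> b) Xs x = r * (a \<pitchfork> b) Xs x + s * (a' \<pitchfork> b) Xs x"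
  unfolding shuffle_def by (simp add: algebra_simps sum.distrib sum_distrib_left)

lemma shuffle_linear_right:
  "(a \<pitchfork> (\<lambda>Ys y. r * b Ys y + s * b' Ys y)) Xs x = r * (a \<pitchfork> b) Xs x + s * (a \<pitchfork> b') Xs x"
  unfolding shuffle_def by (simp add: algebra_simps sum.distrib sum_distrib_left)

lemma contraction_shuffle:
  "\<iota> X (a \<pitchfork> b) = (\<lambda>Ys y. (\<iota> X a \<pitchfork> b) Ys y + (\<epsilon> a \<pitchfork> \<iota> X b) Ys y)"
  by (simp add: contraction_def[of X "a \<pitchfork> b"] fun_eq_iff shuffle_Cons)

lemma contraction_grade_involution: "\<iota> X (\<epsilon> c) = (\<lambda>Ys y. - \<epsilon> (\<iota> X c) Ys y)"
  by (simp add: contraction_def grade_involution_def)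

lemma grade_involution_involutive: "\<epsilon> (\<epsilon> c) = c"
  by (simp add: grade_involution_def fun_eq_iff flip: mult.assoc power_add power_mult_distrib)

lemma shuffle_cong:
  assumes "\<And>Ys. set Ys \<subseteq> S \<Longrightarrow> a Ys = a' Ys" "\<And>Ys. set Ys \<subseteq> S \<Longrightarrow> b Ys = b' Ys" "set Xs \<subseteq> S"
  shows "(a \<pitchfork> b) Xs = (a' \<pitchfork> b') Xs"
  using assms
proof (induction Xs arbitrary: a a' b b')
  case Nil
  then show ?case by (simp add: fun_eq_iff shuffle_Nil)
next
  case (Cons X Xs)
  have "(\<iota> X a \<pitchfork> b) Xs = (\<iota> X a' \<pitchfork> b') Xs" "(\<epsilon> a \<pitchfork> \<iota> X b) Xs = (\<epsilon> a' \<pitchfork> \<iota> X b') Xs"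
    using Cons.prems by (auto intro!: Cons.IH simp: contraction_def grade_involution_def)
  then show ?case by (simp add: fun_eq_iff shuffle_Cons)
qed

lemmas shuffle_diff_left = shuffle_linear_left[where r = 1 and s = "-1", simplified]
lemmas shuffle_diff_right = shuffle_linear_right[where r = 1 and s = "-1", simplified]
lemmas shuffle_scale_left = shuffle_linear_left[where s = 0, simplified]
lemmas shuffle_minus_left = shuffle_scale_left[where r = "-1", simplified]

section \<open>Cartan calculus\<close>

lemma set_update_subset: "set Ys \<subseteq> S \<Longrightarrow> Z \<in> S \<Longrightarrow> set (Ys[j := Z]) \<subseteq> S"
  using set_update_subset_insert[of Ys j Z] by blast

locale function_algebra =
  fixes S :: "('m \<Rightarrow> 'v::real_vector) set" and A :: "('m \<Rightarrow> real) set"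
  assumes scalar_const: "(\<lambda>x. r) \<in> A"
    and scalar_add: "f \<in> A \<Longrightarrow> g \<in> A \<Longrightarrow> (\<lambda>x. f x + g x) \<in> A"
    and scalar_mult: "f \<in> A \<Longrightarrow> g \<in> A \<Longrightarrow> (\<lambda>x. f x * g x) \<in> A"
begin

definition scalar_valued :: "('m, 'v) cochain \<Rightarrow> bool" where
  "scalar_valued c \<longleftrightarrow> (\<forall>Ys. set Ys \<subseteq> S \<longrightarrow> c Ys \<in> A)"

definition slotwise_additive :: "('m, 'v) cochain \<Rightarrow> bool" where
  "slotwise_additive c \<longleftrightarrow> (\<forall>Ys Zs Y Z. set Ys \<subseteq> S \<longrightarrow> set Zs \<subseteq> S \<longrightarrow> Y \<in> S \<longrightarrow> Z \<in> S \<longrightarrow>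
     c (Ys @ (\<lambda>x. Y x + Z x) # Zs) = (\<lambda>x. c (Ys @ Y # Zs) x + c (Ys @ Z # Zs) x))"

lemma scalar_linear: "f \<in> A \<Longrightarrow> g \<in> A \<Longrightarrow> (\<lambda>x. r * f x + s * g x) \<in> A"
  by (intro scalar_add scalar_mult scalar_const)

lemma scalar_diff: "f \<in> A \<Longrightarrow> g \<in> A \<Longrightarrow> (\<lambda>x. f x - g x) \<in> A"
  using scalar_linear[of f g 1 "-1"] by simp

lemma scalar_sum: "(\<And>i. i \<in> I \<Longrightarrow> f i \<in> A) \<Longrightarrow> (\<lambda>x. \<Sum>i\<in>I. f i x) \<in> A"
  by (induction I rule: infinite_finite_induct) (auto intro: scalar_const scalar_add)

lemma scalar_valuedD: "scalar_valued c \<Longrightarrow> set Ys \<subseteq> S \<Longrightarrow> c Ys \<in> A"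
  unfolding scalar_valued_def by blast

lemma scalar_valued_contraction: "scalar_valued c \<Longrightarrow> X \<in> S \<Longrightarrow> scalar_valued (\<iota> X c)"
  unfolding scalar_valued_def contraction_def by simp

lemma scalar_valued_grade_involution: "scalar_valued c \<Longrightarrow> scalar_valued (\<epsilon> c)"
  unfolding scalar_valued_def grade_involution_def by (auto intro: scalar_mult scalar_const)

lemma scalar_valued_shuffle: "scalar_valued a \<Longrightarrow> scalar_valued b \<Longrightarrow> scalar_valued (a \<pitchfork> b)"
proof -
  have "(a \<pitchfork> b) Xs \<in> A" if "scalar_valued a" "scalar_valued b" "set Xs \<subseteq> S" for a b Xs
    using that
  proof (induction Xs arbitrary: a b)
    case Nil
    have "(a \<pitchfork> b) [] = (\<lambda>x. a [] x * b [] x)" by (simp add: fun_eq_iff shuffle_Nil)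
    then show ?case using Nil by (simp add: scalar_mult scalar_valuedD)
  next
    case (Cons X Xs)
    have "(a \<pitchfork> b) (X # Xs) = (\<lambda>x. (\<iota> X a \<pitchfork> b) Xs x + (\<epsilon> a \<pitchfork> \<iota> X b) Xs x)"
      by (simp add: fun_eq_iff shuffle_Cons)
    then show ?case
      using Cons by (simp add: scalar_add scalar_valued_contraction scalar_valued_grade_involution)
  qed
  then show "scalar_valued a \<Longrightarrow> scalar_valued b \<Longrightarrow> scalar_valued (a \<pitchfork> b)"
    unfolding scalar_valued_def[of "a \<pitchfork> b"] by blast
qed

lemma slotwise_additiveD:
  assumes "slotwise_additive c" "set Ys \<subseteq> S" "set Zs \<subseteq> S" "Y \<in> S" "Z \<in> S"
  shows "c (Ys @ (\<lambda>x. Y x + Z x) # Zs) = (\<lambda>x. c (Ys @ Y # Zs) x + c (Ys @ Z # Zs) x)"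
  using assms(1)[unfolded slotwise_additive_def, rule_format, OF assms(2-)] .

lemma slotwise_additive_contraction:
  "slotwise_additive c \<Longrightarrow> X \<in> S \<Longrightarrow> slotwise_additive (\<iota> X c)"
  unfolding slotwise_additive_def[of "\<iota> X c"]
  using slotwise_additiveD[of c "X # _"] by (simp add: contraction_def)

end

locale anchored_module = function_algebra S A
  for S :: "('m \<Rightarrow> 'v::real_vector) set" and A :: "('m \<Rightarrow> real) set" +
  fixes \<rho> :: "('m \<Rightarrow> 'v) \<Rightarrow> ('m \<Rightarrow> real) \<Rightarrow> 'm \<Rightarrow> real"
  assumes anchor_closed: "X \<in> S \<Longrightarrow> f \<in> A \<Longrightarrow> \<rho> X f \<in> A"
    and anchor_linear: "X \<in> S \<Longrightarrow> f \<in> A \<Longrightarrow> g \<in> A \<Longrightarrow>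
      \<rho> X (\<lambda>x. r * f x + s * g x) = (\<lambda>x. r * \<rho> X f x + s * \<rho> X g x)"
    and anchor_mult: "X \<in> S \<Longrightarrow> f \<in> A \<Longrightarrow> g \<in> A \<Longrightarrow>
      \<rho> X (\<lambda>x. f x * g x) = (\<lambda>x. \<rho> X f x * g x + f x * \<rho> X g x)"
begin

lemma anchor_scale: "X \<in> S \<Longrightarrow> f \<in> A \<Longrightarrow> \<rho> X (\<lambda>x. r * f x) = (\<lambda>x. r * \<rho> X f x)"
  using anchor_linear[of X f f r 0] by simp

lemma anchor_diff:
  "X \<in> S \<Longrightarrow> f \<in> A \<Longrightarrow> g \<in> A \<Longrightarrow> \<rho> X (\<lambda>x. f x - g x) = (\<lambda>x. \<rho> X f x - \<rho> X g x)"
  using anchor_linear[of X f g 1 "-1"] by simp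

lemma anchor_zero: "X \<in> S \<Longrightarrow> \<rho> X (\<lambda>x. 0) = (\<lambda>x. 0)"
  using anchor_scale[of X "\<lambda>x. 0" 0] scalar_const by simp

end

locale cartan_calculus = anchored_module S A \<rho>
  for S :: "('m \<Rightarrow> 'v::real_vector) set" and A :: "('m \<Rightarrow> real) set"
    and \<rho> :: "('m \<Rightarrow> 'v) \<Rightarrow> ('m \<Rightarrow> real) \<Rightarrow> 'm \<Rightarrow> real" +
  fixes B :: "('m \<Rightarrow> 'v) \<Rightarrow> ('m \<Rightarrow> 'v) \<Rightarrow> 'm \<Rightarrow> 'v"
  assumes bracket_closed: "X \<in> S \<Longrightarrow> Y \<in> S \<Longrightarrow> B X Y \<in> S"
    and anchor_bracket: "X \<in> S \<Longrightarrow> Y \<in> S \<Longrightarrow> f \<in> A \<Longrightarrow>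
      \<rho> (B X Y) f = (\<lambda>x. \<rho> X (\<rho> Y f) x - \<rho> Y (\<rho> X f) x)"
    and jacobi: "X \<in> S \<Longrightarrow> Y \<in> S \<Longrightarrow> Z \<in> S \<Longrightarrow>
      B X (B Y Z) = (\<lambda>x. B (B X Y) Z x + B Y (B X Z) x)"
begin

definition Lie :: "('m \<Rightarrow> 'v) \<Rightarrow> ('m, 'v) cochain \<Rightarrow> ('m, 'v) cochain" where
  "Lie X c = (\<lambda>Ys y. \<rho> X (c Ys) y - (\<Sum>j<length Ys. c (Ys[j := B X (Ys ! j)]) y))"

text \<open>Cartan's formula \<open>\<iota>\<^sub>X \<partial> + \<partial> \<iota>\<^sub>X = L\<^sub>X\<close>, read as a recursion on the list of arguments.\<close>

primrec differential :: "('m, 'v) cochain \<Rightarrow> ('m, 'v) cochain" ("\<partial>") where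
  "\<partial> c [] = (\<lambda>y. 0)"
| "\<partial> c (X # Xs) = (\<lambda>y. Lie X c Xs y - \<partial> (\<iota> X c) Xs y)"

lemma scalar_valued_Lie: "scalar_valued c \<Longrightarrow> X \<in> S \<Longrightarrow> scalar_valued (Lie X c)"
  unfolding scalar_valued_def[of "Lie X c"] unfolding Lie_def
  by (intro allI impI scalar_diff anchor_closed scalar_sum scalar_valuedD[of c]
      set_update_subset bracket_closed) (auto dest: nth_mem)

lemma scalar_valued_differential: "scalar_valued c \<Longrightarrow> scalar_valued (\<partial> c)"
proof -
  have "\<partial> c Xs \<in> A" if "scalar_valued c" "set Xs \<subseteq> S" for c Xs
    using that
  proof (induction Xs arbitrary: c)
    case (Cons X Xs)
    then show ?case
      using scalar_valuedD[OF scalar_valued_Lie[of c X], of Xs]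
      by (auto intro!: scalar_diff Cons.IH scalar_valued_contraction)
  qed (simp add: scalar_const)
  then show "scalar_valued c \<Longrightarrow> scalar_valued (\<partial> c)"
    unfolding scalar_valued_def[of "\<partial> c"] by blast
qed

lemma Lie_Cons: "Lie X c (Y # Ys) y = Lie X (\<iota> Y c) Ys y - c (B X Y # Ys) y"
  unfolding Lie_def contraction_def by (simp add: sum.lessThan_Suc_shift del: sum.lessThan_Suc)

lemma contraction_Lie: "\<iota> Y (Lie X c) = (\<lambda>Ys y. Lie X (\<iota> Y c) Ys y - \<iota> (B X Y) c Ys y)"
  by (simp add: contraction_def[of Y "Lie X c"] contraction_def[of "B X Y" c] fun_eq_iff Lie_Cons)

lemma contraction_differential: "\<iota> Y (\<partial> c) = (\<lambda>Ys y. Lie Y c Ys y - \<partial> (\<iota> Y c) Ys y)"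
  by (simp add: contraction_def[of Y "\<partial> c"])

lemma Lie_cong:
  assumes "\<And>Ys. set Ys \<subseteq> S \<Longrightarrow> c Ys = d Ys" "X \<in> S" "set Xs \<subseteq> S"
  shows "Lie X c Xs = Lie X d Xs"
proof -
  have "c (Xs[j := B X (Xs ! j)]) = d (Xs[j := B X (Xs ! j)])" if "j < length Xs" for j
    using that assms(2,3) by (intro assms(1) set_update_subset bracket_closed) auto
  then show ?thesis using assms by (simp add: Lie_def)
qed

lemma differential_cong:
  assumes "\<And>Ys. set Ys \<subseteq> S \<Longrightarrow> c Ys = d Ys" "set Xs \<subseteq> S"
  shows "\<partial> c Xs = \<partial> d Xs"
  using assms
proof (induction Xs arbitrary: c d)
  case (Cons X Xs)
  have "Lie X c Xs = Lie X d Xs" using Cons.prems by (intro Lie_cong) auto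
  moreover have "\<partial> (\<iota> X c) Xs = \<partial> (\<iota> X d) Xs"
    using Cons.prems by (intro Cons.IH) (auto simp: contraction_def)
  ultimately show ?case by simp
qed simp

lemma Lie_linear:
  assumes "scalar_valued c" "scalar_valued d" "X \<in> S" "set Xs \<subseteq> S"
  shows "Lie X (\<lambda>Ys y. r * c Ys y + s * d Ys y) Xs y = r * Lie X c Xs y + s * Lie X d Xs y"
  using assms
  by (simp add: Lie_def anchor_linear scalar_valuedD sum.distrib sum_distrib_left algebra_simps)

lemma differential_linear:
  assumes "scalar_valued c" "scalar_valued d" "set Xs \<subseteq> S"
  shows "\<partial> (\<lambda>Ys y. r * c Ys y + s * d Ys y) Xs y = r * \<partial> c Xs y + s * \<partial> d Xs y"
  using assms
proof (induction Xs arbitrary: c d)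
  case (Cons X Xs)
  have "\<iota> X (\<lambda>Ys y. r * c Ys y + s * d Ys y) = (\<lambda>Ys y. r * \<iota> X c Ys y + s * \<iota> X d Ys y)"
    by (simp add: contraction_def)
  then show ?case using Cons by (simp add: Lie_linear scalar_valued_contraction algebra_simps)
qed simp

lemmas Lie_add = Lie_linear[where r = 1 and s = 1, simplified]
lemmas Lie_diff = Lie_linear[where r = 1 and s = "-1", simplified]
lemmas differential_add = differential_linear[where r = 1 and s = 1, simplified]
lemmas differential_diff = differential_linear[where r = 1 and s = "-1", simplified]
lemmas differential_minus = differential_linear[where r = "-1" and s = 0, simplified]

lemma Lie_grade_involution:
  assumes "scalar_valued c" "X \<in> S" "set Xs \<subseteq> S"
  shows "Lie X (\<epsilon> c) Xs = \<epsilon> (Lie X c) Xs"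
  using assms
  by (simp add: Lie_def grade_involution_def anchor_scale scalar_valuedD sum_distrib_left
      right_diff_distrib)

lemma differential_grade_involution:
  assumes "scalar_valued c" "set Xs \<subseteq> S"
  shows "\<partial> (\<epsilon> c) Xs y = - \<epsilon> (\<partial> c) Xs y"
  using assms
proof (induction Xs arbitrary: c)
  case Nil
  then show ?case by (simp add: grade_involution_def)
next
  case (Cons X Xs)
  have "\<partial> (\<iota> X (\<epsilon> c)) Xs y = - \<partial> (\<epsilon> (\<iota> X c)) Xs y"
    using Cons.prems differential_minus[of "\<epsilon> (\<iota> X c)" _ Xs y]
    by (simp add: contraction_grade_involution scalar_valued_grade_involution
        scalar_valued_contraction)
  then show ?case
    using Cons
    by (simp add: Lie_grade_involution grade_involution_def[of "Lie X c"]
        grade_involution_def[of "\<partial> _"] scalar_valued_contraction algebra_simps)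
qed

lemma Lie_Lie_Cons:
  assumes "scalar_valued c" "U \<in> S" "V \<in> S" "Z \<in> S" "set Zs \<subseteq> S"
  shows "Lie U (Lie V c) (Z # Zs) y = Lie U (Lie V (\<iota> Z c)) Zs y - Lie U (\<iota> (B V Z) c) Zs y
    - Lie V (\<iota> (B U Z) c) Zs y + c (B V (B U Z) # Zs) y"
proof -
  have "Lie U (\<iota> Z (Lie V c)) Zs y = Lie U (Lie V (\<iota> Z c)) Zs y - Lie U (\<iota> (B V Z) c) Zs y"
    unfolding contraction_Lie using assms
    by (intro Lie_diff scalar_valued_Lie scalar_valued_contraction bracket_closed)
  then show ?thesis by (simp add: Lie_Cons[of U "Lie V c"] Lie_Cons[of V c])
qed

lemma Lie_commutator:
  assumes "scalar_valued c" "slotwise_additive c" "X \<in> S" "Y \<in> S" "set Ys \<subseteq> S"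
  shows "Lie X (Lie Y c) Ys y - Lie Y (Lie X c) Ys y = Lie (B X Y) c Ys y"
  using assms
proof (induction Ys arbitrary: c)
  case Nil
  then show ?case by (simp add: Lie_def anchor_bracket scalar_valuedD)
next
  case (Cons Z Zs)
  have Z_in_S: "Z \<in> S" "set Zs \<subseteq> S" using Cons.prems by auto
  have "c (B X (B Y Z) # Zs) y = c (B (B X Y) Z # Zs) y + c (B Y (B X Z) # Zs) y"
    unfolding jacobi[OF Cons.prems(3,4) Z_in_S(1)]
    using slotwise_additiveD[OF Cons.prems(2), of "[]"] Cons.prems Z_in_S
    by (simp add: bracket_closed)
  moreover have "Lie X (Lie Y (\<iota> Z c)) Zs y - Lie Y (Lie X (\<iota> Z c)) Zs y
      = Lie (B X Y) (\<iota> Z c) Zs y"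
    using Cons.prems Z_in_S
    by (intro Cons.IH scalar_valued_contraction slotwise_additive_contraction)
  ultimately show ?case
    using Lie_Lie_Cons[OF Cons.prems(1,3,4) Z_in_S] Lie_Lie_Cons[OF Cons.prems(1,4,3) Z_in_S]
    by (simp add: Lie_Cons[of "B X Y"])
qed

lemma Lie_differential:
  assumes "scalar_valued c" "slotwise_additive c" "X \<in> S" "set Ys \<subseteq> S"
  shows "Lie X (\<partial> c) Ys y = \<partial> (Lie X c) Ys y"
  using assms
proof (induction Ys arbitrary: c)
  case Nil
  then show ?case by (simp add: Lie_def anchor_zero)
next
  case (Cons Y Ys)
  have Y_in_S: "Y \<in> S" "set Ys \<subseteq> S" using Cons.prems by auto
  have "Lie X (\<iota> Y (\<partial> c)) Ys y = Lie X (Lie Y c) Ys y - Lie X (\<partial> (\<iota> Y c)) Ys y"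
    unfolding contraction_differential using Cons.prems Y_in_S
    by (intro Lie_diff scalar_valued_Lie scalar_valued_differential scalar_valued_contraction)
  also have "Lie X (\<partial> (\<iota> Y c)) Ys y = \<partial> (Lie X (\<iota> Y c)) Ys y"
    using Cons.prems Y_in_S
    by (intro Cons.IH scalar_valued_contraction slotwise_additive_contraction)
  also have "\<partial> (Lie X (\<iota> Y c)) Ys y = \<partial> (\<iota> Y (Lie X c)) Ys y + \<partial> (\<iota> (B X Y) c) Ys y"
    unfolding contraction_Lie using Cons.prems Y_in_S
    by (subst differential_diff)
      (auto intro!: scalar_valued_Lie scalar_valued_contraction bracket_closed)
  finally show ?case
    using Lie_commutator[OF Cons.prems(1-3) Y_in_S, of y] by (simp add: Lie_Cons[of X "\<partial> c"])
qed

lemma differential_differential: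
  assumes "scalar_valued c" "slotwise_additive c" "set Xs \<subseteq> S"
  shows "\<partial> (\<partial> c) Xs y = 0"
  using assms
proof (induction Xs arbitrary: c)
  case (Cons X Xs)
  then have X_in_S: "X \<in> S" "set Xs \<subseteq> S" by auto
  have "\<partial> (\<iota> X (\<partial> c)) Xs y = \<partial> (Lie X c) Xs y - \<partial> (\<partial> (\<iota> X c)) Xs y"
    unfolding contraction_differential using Cons.prems X_in_S
    by (intro differential_diff scalar_valued_Lie scalar_valued_differential
        scalar_valued_contraction)
  also have "\<partial> (\<partial> (\<iota> X c)) Xs y = 0"
    using Cons.prems X_in_S
    by (intro Cons.IH scalar_valued_contraction slotwise_additive_contraction)
  finally show ?case using Lie_differential[OF Cons.prems(1,2) X_in_S] by simp
qed simp

lemma Lie_shuffle: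
  assumes "scalar_valued a" "scalar_valued b" "X \<in> S" "set Ys \<subseteq> S"
  shows "Lie X (a \<pitchfork> b) Ys y = (Lie X a \<pitchfork> b) Ys y + (a \<pitchfork> Lie X b) Ys y"
  using assms
proof (induction Ys arbitrary: a b)
  case Nil
  have "(a \<pitchfork> b) [] = (\<lambda>x. a [] x * b [] x)" by (simp add: fun_eq_iff shuffle_Nil)
  then show ?case using Nil by (simp add: Lie_def shuffle_Nil anchor_mult scalar_valuedD)
next
  case (Cons Y Ys)
  have Y_in_S: "Y \<in> S" "set Ys \<subseteq> S" using Cons.prems by auto
  note valued = scalar_valued_contraction scalar_valued_grade_involution scalar_valued_shuffle
  have involution: "(\<epsilon> (Lie X a) \<pitchfork> c) Ys = (Lie X (\<epsilon> a) \<pitchfork> c) Ys" for c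
    by (rule shuffle_cong[OF _ refl Y_in_S(2)]) (simp add: Lie_grade_involution Cons.prems)
  have "Lie X (\<iota> Y (a \<pitchfork> b)) Ys y = Lie X (\<iota> Y a \<pitchfork> b) Ys y + Lie X (\<epsilon> a \<pitchfork> \<iota> Y b) Ys y"
    unfolding contraction_shuffle using Cons.prems Y_in_S by (intro Lie_add valued)
  also have "Lie X (\<iota> Y a \<pitchfork> b) Ys y = (Lie X (\<iota> Y a) \<pitchfork> b) Ys y + (\<iota> Y a \<pitchfork> Lie X b) Ys y"
    using Cons.prems Y_in_S by (intro Cons.IH valued)
  also have "Lie X (\<epsilon> a \<pitchfork> \<iota> Y b) Ys y
      = (Lie X (\<epsilon> a) \<pitchfork> \<iota> Y b) Ys y + (\<epsilon> a \<pitchfork> Lie X (\<iota> Y b)) Ys y"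
    using Cons.prems Y_in_S by (intro Cons.IH valued)
  finally show ?case
    by (simp add: Lie_Cons[of X "a \<pitchfork> b"] shuffle_Cons contraction_Lie shuffle_diff_left
        shuffle_diff_right involution)
qed

lemma differential_shuffle:
  assumes "scalar_valued a" "scalar_valued b" "set Xs \<subseteq> S"
  shows "\<partial> (a \<pitchfork> b) Xs y = (\<partial> a \<pitchfork> b) Xs y + (\<epsilon> a \<pitchfork> \<partial> b) Xs y"
  using assms
proof (induction Xs arbitrary: a b)
  case Nil
  then show ?case by (simp add: shuffle_Nil)
next
  case (Cons X Xs)
  have X_in_S: "X \<in> S" "set Xs \<subseteq> S" using Cons.prems by auto
  note valued = scalar_valued_contraction scalar_valued_grade_involution scalar_valued_shuffle
  have "(\<epsilon> (\<partial> a) \<pitchfork> c) Xs = ((\<lambda>Ys y. - \<partial> (\<epsilon> a) Ys y) \<pitchfork> c) Xs" for c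
    by (rule shuffle_cong[OF _ refl X_in_S(2)])
      (simp add: fun_eq_iff differential_grade_involution Cons.prems)
  then have involution: "(\<epsilon> (\<partial> a) \<pitchfork> c) Xs y = - (\<partial> (\<epsilon> a) \<pitchfork> c) Xs y" for c
    by (simp add: shuffle_minus_left)
  have "\<partial> (\<iota> X (a \<pitchfork> b)) Xs y = \<partial> (\<iota> X a \<pitchfork> b) Xs y + \<partial> (\<epsilon> a \<pitchfork> \<iota> X b) Xs y"
    unfolding contraction_shuffle using Cons.prems X_in_S by (intro differential_add valued)
  also have "\<partial> (\<iota> X a \<pitchfork> b) Xs y = (\<partial> (\<iota> X a) \<pitchfork> b) Xs y + (\<epsilon> (\<iota> X a) \<pitchfork> \<partial> b) Xs y"
    using Cons.prems X_in_S by (intro Cons.IH valued)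
  also have "\<partial> (\<epsilon> a \<pitchfork> \<iota> X b) Xs y
      = (\<partial> (\<epsilon> a) \<pitchfork> \<iota> X b) Xs y + (\<epsilon> (\<epsilon> a) \<pitchfork> \<partial> (\<iota> X b)) Xs y"
    using Cons.prems X_in_S by (intro Cons.IH valued)
  finally show ?case
    using Lie_shuffle[OF Cons.prems(1,2) X_in_S, of y]
    by (simp add: shuffle_Cons contraction_differential shuffle_diff_left shuffle_diff_right
        involution contraction_grade_involution shuffle_minus_left grade_involution_involutive)
qed

lemma differential_eq_sum:
  "\<partial> c Xs y =
    (\<Sum>i<length Xs. (- 1) ^ i * Lie (Xs ! i) (\<lambda>Zs. c (take i Xs @ Zs)) (drop (Suc i) Xs) y)"
proof (induction Xs arbitrary: c)
  case (Cons X Xs)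
  then show ?case
    by (simp add: sum.lessThan_Suc_shift contraction_def sum_negf del: sum.lessThan_Suc)
qed simp

lemma differential_component:
  assumes "set Xs \<subseteq> S"
  shows "\<partial> (component p c) Xs = (if length Xs = Suc p then \<partial> c Xs else (\<lambda>x. 0))"
proof
  fix y
  let ?L = "\<lambda>c i. Lie (Xs ! i) (\<lambda>Zs. c (take i Xs @ Zs)) (drop (Suc i) Xs) y"
  have "?L (component p c) i = (if length Xs = Suc p then ?L c i else 0)" if "i < length Xs" for i
  proof -
    have "Xs ! i \<in> S" using that assms by (auto dest: nth_mem)
    moreover have "component p c (take i Xs @ Zs)
        = (if length Xs = Suc p then c (take i Xs @ Zs) else (\<lambda>x. 0))"
      if "length Zs = length Xs - Suc i" for Zs
      using that \<open>i < length Xs\<close> by (auto simp: component_def)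
    ultimately show ?thesis by (simp add: Lie_def anchor_zero)
  qed
  then show "\<partial> (component p c) Xs y = (if length Xs = Suc p then \<partial> c Xs else (\<lambda>x. 0)) y"
    unfolding differential_eq_sum by (simp add: differential_eq_sum[of c])
qed

end

section \<open>Smooth functions\<close>

lemma Ck_on_cong:
  assumes "open U" "\<And>x. x \<in> U \<Longrightarrow> f x = g x" "Ck_on k U f"
  shows "Ck_on k U g"
proof (cases k)
  case 0
  then show ?thesis using assms continuous_on_cong[of U U f g] by simp
next
  case (Suc j)
  then obtain f'
    where derivative: "\<forall>x\<in>U. (f has_derivative f' x) (at x)" "\<forall>v. Ck_on j U (\<lambda>x. f' x v)"
    using assms(3) by auto
  have "\<forall>x\<in>U. (g has_derivative f' x) (at x)"
    using derivative(1) assms(1,2) has_derivative_transform_within_open by blast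
  then show ?thesis using derivative(2) Suc by auto
qed

lemma Ck_on_subset: "V \<subseteq> U \<Longrightarrow> Ck_on k U f \<Longrightarrow> Ck_on k V f"
proof (induction k arbitrary: f)
  case 0
  then show ?case by (auto intro: continuous_on_subset)
next
  case (Suc k)
  then show ?case by (simp add: subset_iff) blast
qed

lemma Ck_on_SucD: "Ck_on (Suc k) U f \<Longrightarrow> Ck_on k U f"
proof (induction k arbitrary: f)
  case 0
  then show ?case
    by (auto intro!: continuous_at_imp_continuous_on dest: has_derivative_continuous)
next
  case (Suc k)
  from Suc.prems obtain f' where derivative: "\<forall>x\<in>U. (f has_derivative f' x) (at x)"
    "\<forall>v. Ck_on (Suc k) U (\<lambda>x. f' x v)" unfolding Ck_on.simps(2)[of "Suc k"] by blast
  with Suc.IH show ?case unfolding Ck_on.simps(2)[of k] by blast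
qed

lemma Ck_on_local:
  assumes "\<And>x. x \<in> U \<Longrightarrow> \<exists>V. open V \<and> x \<in> V \<and> Ck_on k V f"
  shows "Ck_on k U f"
  using assms
proof (induction k arbitrary: f)
  case 0
  then show ?case
    by (metis Ck_on.simps(1) continuous_at_imp_continuous_on continuous_on_eq_continuous_at)
next
  case (Suc k)
  define F where "F = (\<lambda>x. frechet_derivative f (at x))"
  have derivative:
      "\<exists>V. open V \<and> x \<in> V \<and> (\<forall>y\<in>V. (f has_derivative F y) (at y)) \<and> (\<forall>v. Ck_on k V (\<lambda>y. F y v))"
    if x_in_U: "x \<in> U" for x
  proof -
    obtain V f' where local_derivative: "open V" "x \<in> V" "\<forall>y\<in>V. (f has_derivative f' y) (at y)"
      "\<forall>v. Ck_on k V (\<lambda>y. f' y v)"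
      using Suc.prems[OF x_in_U] by auto
    have derivative_eq: "f' y = F y" if "y \<in> V" for y
      using local_derivative(3) that unfolding F_def by (metis frechet_derivative_at)
    have "Ck_on k V (\<lambda>y. F y v)" for v
      by (rule Ck_on_cong[OF local_derivative(1) _ local_derivative(4)[rule_format]])
        (simp add: derivative_eq)
    then show ?thesis using local_derivative derivative_eq by (intro exI[of _ V]) auto
  qed
  have "\<forall>x\<in>U. (f has_derivative F x) (at x)" using derivative by blast
  moreover have "Ck_on k U (\<lambda>x. F x v)" for v
    by (rule Suc.IH) (use derivative in blast)
  ultimately show ?case by auto
qed

lemma Ck_on_const: "Ck_on k U (\<lambda>x. c)"
proof (induction k arbitrary: c)
  case (Suc k)
  then show ?case by (auto intro!: exI[of _ "\<lambda>x v. 0"])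
qed simp

lemma Ck_on_add: "Ck_on k U f \<Longrightarrow> Ck_on k U g \<Longrightarrow> Ck_on k U (\<lambda>x. f x + g x)"
proof (induction k arbitrary: f g)
  case 0
  then show ?case by (auto intro: continuous_intros)
next
  case (Suc k)
  then obtain f' g' where
    "\<forall>x\<in>U. (f has_derivative f' x) (at x)" "\<forall>v. Ck_on k U (\<lambda>x. f' x v)"
    "\<forall>x\<in>U. (g has_derivative g' x) (at x)" "\<forall>v. Ck_on k U (\<lambda>x. g' x v)" by auto
  then show ?case using Suc.IH
    by (auto intro!: exI[of _ "\<lambda>x v. f' x v + g' x v"] has_derivative_add)
qed

lemma (in bounded_bilinear) Ck_on_prod:
  "Ck_on k U f \<Longrightarrow> Ck_on k U g \<Longrightarrow> Ck_on k U (\<lambda>x. prod (f x) (g x))"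
proof (induction k arbitrary: f g)
  case 0
  then show ?case by (auto intro: continuous_on)
next
  case (Suc k)
  then obtain f' g' where derivative:
    "\<forall>x\<in>U. (f has_derivative f' x) (at x)" "\<forall>v. Ck_on k U (\<lambda>x. f' x v)"
    "\<forall>x\<in>U. (g has_derivative g' x) (at x)" "\<forall>v. Ck_on k U (\<lambda>x. g' x v)" by auto
  have "Ck_on k U f" "Ck_on k U g" using Suc.prems Ck_on_SucD by blast+
  then show ?case using derivative Suc.IH
    by (auto intro!: exI[of _ "\<lambda>x v. prod (f x) (g' x v) + prod (f' x v) (g x)"] FDERIV Ck_on_add)
qed

lemma Ck_on_inverse:
  fixes f :: "'a::real_normed_vector \<Rightarrow> real"
  shows "Ck_on k U f \<Longrightarrow> (\<And>x. x \<in> U \<Longrightarrow> f x \<noteq> 0) \<Longrightarrow> Ck_on k U (\<lambda>x. inverse (f x))"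
proof (induction k)
  case 0
  then show ?case by (auto intro!: continuous_on_inverse)
next
  case (Suc k)
  then obtain f' where derivative:
    "\<forall>x\<in>U. (f has_derivative f' x) (at x)" "\<forall>v. Ck_on k U (\<lambda>x. f' x v)" by auto
  have Ck_inverse: "Ck_on k U (\<lambda>x. inverse (f x))" using Suc Ck_on_SucD by blast
  have "Ck_on k U (\<lambda>x. (- 1) * (inverse (f x) * f' x v * inverse (f x)))" for v
    by (intro bounded_bilinear.Ck_on_prod[OF bounded_bilinear_mult] Ck_inverse
        derivative(2)[rule_format] Ck_on_const)
  then show ?case using derivative Suc.prems(2)
    by (auto intro!: exI[of _ "\<lambda>x v. - (inverse (f x) * f' x v * inverse (f x))"]
        Deriv.has_derivative_inverse)
qed

definition flat :: "nat \<Rightarrow> real \<Rightarrow> real" where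
  "flat m t = (if t > 0 then exp (- inverse t) / t ^ m else 0)"

lemma flat_tendsto_0: "(flat m \<longlongrightarrow> 0) (at_right 0)"
proof -
  have "((\<lambda>t. (inverse t) ^ m / exp (inverse t)) \<longlongrightarrow> (0::real)) (at_right 0)"
    using filterlim_compose[OF tendsto_power_div_exp_0 filterlim_inverse_at_top_right] .
  moreover have "\<forall>\<^sub>F t in at_right 0. (inverse t) ^ m / exp (inverse t) = flat m t"
    unfolding eventually_at_filter flat_def
    by (auto simp: exp_minus field_simps power_inverse)
  ultimately show ?thesis by (rule Lim_transform_eventually)
qed

lemma flat_has_derivative_nonzero:
  assumes "t \<noteq> 0"
  shows "(flat m has_real_derivative (flat (m + 2) t - real m * flat (m + 1) t)) (at t)"
proof (cases "t > 0")
  case True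
  have "((\<lambda>t. exp (- inverse t) / t ^ m) has_real_derivative
      (flat (m + 2) t - real m * flat (m + 1) t)) (at t)"
  proof (cases m)
    case (Suc j)
    have "j = 0 \<or> t ^ j = t * t ^ (j - Suc 0)" by (cases j) auto
    then show ?thesis
      using True Suc
      by (auto intro!: derivative_eq_intros simp: flat_def field_simps power2_eq_square)
  qed (use True in \<open>auto intro!: derivative_eq_intros simp: flat_def field_simps power2_eq_square\<close>)
  then show ?thesis
    by (rule has_field_derivative_transform_within_open[where S = "{0<..}"])
      (use True in \<open>auto simp: flat_def\<close>)
next
  case False
  have "((\<lambda>t. 0) has_real_derivative 0) (at t)" by simp
  then have "(flat m has_real_derivative 0) (at t)"
    by (rule has_field_derivative_transform_within_open[where S = "{..<0}"])
      (use False assms in \<open>auto simp: flat_def\<close>)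
  then show ?thesis using False by (simp add: flat_def)
qed

lemma flat_has_derivative_0: "(flat m has_real_derivative 0) (at 0)"
proof -
  have "((\<lambda>h. flat m h / h) \<longlongrightarrow> 0) (at 0)"
  proof (rule filterlim_split_at)
    have "\<forall>\<^sub>F h in at_left 0. 0 = flat m h / h"
      unfolding eventually_at_filter flat_def by simp
    then show "((\<lambda>h. flat m h / h) \<longlongrightarrow> 0) (at_left 0)"
      by (rule Lim_transform_eventually[OF tendsto_const])
    have "\<forall>\<^sub>F h in at_right 0. flat (Suc m) h = flat m h / h"
      unfolding eventually_at_filter flat_def by simp
    then show "((\<lambda>h. flat m h / h) \<longlongrightarrow> 0) (at_right 0)"
      by (rule Lim_transform_eventually[OF flat_tendsto_0])
  qed
  then show ?thesis by (simp add: DERIV_def flat_def)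
qed

lemma flat_has_derivative:
  "(flat m has_real_derivative (flat (m + 2) t - real m * flat (m + 1) t)) (at t)"
  using flat_has_derivative_nonzero[of t] flat_has_derivative_0[of m]
  by (cases "t = 0") (simp_all add: flat_def)

lemma Ck_on_flat:
  fixes f :: "'a::real_normed_vector \<Rightarrow> real"
  shows "Ck_on k U f \<Longrightarrow> Ck_on k U (\<lambda>x. flat m (f x))"
proof (induction k arbitrary: m)
  case 0
  have "continuous_on UNIV (flat m)"
    using flat_has_derivative by (meson DERIV_isCont continuous_at_imp_continuous_on)
  then show ?case using 0 by (auto intro: continuous_on_compose2)
next
  case (Suc k)
  then obtain f' where derivative: "\<And>x. x \<in> U \<Longrightarrow> (f has_derivative f' x) (at x)"
    "\<And>v. Ck_on k U (\<lambda>x. f' x v)" by auto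
  define G where "G t = flat (m + 2) t - real m * flat (m + 1) t" for t
  have "Ck_on k U (\<lambda>x. flat (m + 2) (f x) + (- real m) * flat (m + 1) (f x))"
    using Suc Ck_on_SucD
    by (intro bounded_bilinear.Ck_on_prod[OF bounded_bilinear_mult] Ck_on_add Ck_on_const) blast+
  then have "Ck_on k U (\<lambda>x. G (f x) * f' x v)" for v
    by (intro bounded_bilinear.Ck_on_prod[OF bounded_bilinear_mult] derivative(2)) (simp add: G_def)
  moreover have "((\<lambda>x. flat m (f x)) has_derivative (\<lambda>v. G (f x) * f' x v)) (at x)" if "x \<in> U" for x
    using has_derivative_compose[OF derivative(1)[OF that]
        flat_has_derivative[unfolded has_field_derivative_def]] unfolding G_def .
  ultimately show ?case
    unfolding Ck_on.simps by (intro exI[of _ "\<lambda>x v. G (f x) * f' x v"]) blast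
qed

section \<open>Finite-dimensional inner product spaces\<close>

lemma finite_dim_orthogonal_basis:
  assumes "finite_dim TYPE('a::real_inner)"
  obtains C :: "'a::real_inner set"
  where "finite C" "0 \<notin> C" "\<And>w. w = (\<Sum>b\<in>C. (w \<bullet> b / (b \<bullet> b)) *\<^sub>R b)"
proof -
  obtain B :: "'a set" where "finite B" "span B = UNIV"
    using assms unfolding finite_dim_def by blast
  then obtain C' :: "'a set"
    where orthogonal_span: "finite C'" "span C' = UNIV" "pairwise orthogonal C'"
    using basis_orthogonal[of B] by auto
  define C where "C = C' - {0}"
  have basis: "finite C" "0 \<notin> C" "span C = UNIV" using orthogonal_span unfolding C_def by simp_all
  have "w = (\<Sum>b\<in>C. (w \<bullet> b / (b \<bullet> b)) *\<^sub>R b)" for w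
  proof -
    obtain u where expansion: "w = (\<Sum>b\<in>C. u b *\<^sub>R b)"
      using span_finite[OF basis(1)] basis(3) by (metis (no_types, lifting) UNIV_I imageE)
    have "w \<bullet> b = u b * (b \<bullet> b)" if b_in_C: "b \<in> C" for b
    proof -
      have "w \<bullet> b = (\<Sum>c\<in>C. u c * (c \<bullet> b))" unfolding expansion by (simp add: inner_sum_left)
      also have "\<dots> = (\<Sum>c\<in>C. if c = b then u b * (b \<bullet> b) else 0)"
        using orthogonal_span(3) b_in_C
        by (intro sum.cong refl) (auto simp: pairwise_def orthogonal_def C_def)
      also have "\<dots> = u b * (b \<bullet> b)" using basis(1) b_in_C by simp
      finally show ?thesis .
    qed
    then show ?thesis using basis(2) by (subst expansion) (auto intro!: sum.cong)
  qed
  then show ?thesis using that basis by blast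
qed

lemma compact_linear_combinations:
  fixes C :: "'a::real_normed_vector set"
  assumes "finite C" "\<And>b. b \<in> C \<Longrightarrow> compact (T b)"
  shows "compact ((\<lambda>a. \<Sum>b\<in>C. a b *\<^sub>R b) ` Pi\<^sub>E C T)"
  using assms
proof (induction C)
  case (insert c C)
  let ?comb = "\<lambda>a. \<Sum>b\<in>C. a b *\<^sub>R b"
  have "(\<Sum>b\<in>insert c C. (a(c := t)) b *\<^sub>R b) = t *\<^sub>R c + ?comb a" for a t
    using insert.hyps by (auto intro: sum.cong)
  then have "(\<lambda>a. \<Sum>b\<in>insert c C. a b *\<^sub>R b) ` Pi\<^sub>E (insert c C) T
      = (\<lambda>(t, a). t *\<^sub>R c + ?comb a) ` (T c \<times> Pi\<^sub>E C T)"
    unfolding PiE_insert_eq image_image by (simp add: case_prod_unfold)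
  also have "\<dots> = (\<lambda>(t, y). t *\<^sub>R c + y) ` (T c \<times> ?comb ` Pi\<^sub>E C T)"
    by (auto simp: image_iff)
  finally have "(\<lambda>a. \<Sum>b\<in>insert c C. a b *\<^sub>R b) ` Pi\<^sub>E (insert c C) T
      = (\<lambda>(t, y). t *\<^sub>R c + y) ` (T c \<times> ?comb ` Pi\<^sub>E C T)" .
  moreover have "compact ((\<lambda>(t, y). t *\<^sub>R c + y) ` (T c \<times> ?comb ` Pi\<^sub>E C T))"
    using insert.prems
    by (intro compact_continuous_image compact_Times insert.IH)
      (auto simp: case_prod_unfold intro!: continuous_intros)
  ultimately show ?case by simp
qed simp

lemma compact_cball_finite_dim:
  assumes "finite_dim TYPE('a::real_inner)"
  shows "compact (cball (a::'a::real_inner) r)"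
proof -
  obtain C :: "'a set" where basis: "finite C" "0 \<notin> C" "\<And>w. w = (\<Sum>b\<in>C. (w \<bullet> b / (b \<bullet> b)) *\<^sub>R b)"
    using finite_dim_orthogonal_basis[OF assms] by blast
  let ?box = "\<Pi>\<^sub>E b\<in>C. {- (r / norm b)..r / norm b}"
  let ?comb = "\<lambda>a. \<Sum>b\<in>C. a b *\<^sub>R b"
  have "cball 0 r \<subseteq> ?comb ` ?box"
  proof (intro subsetI image_eqI)
    fix w :: 'a assume in_ball: "w \<in> cball 0 r"
    let ?coord = "\<lambda>b\<in>C. w \<bullet> b / (b \<bullet> b)"
    show "w = ?comb ?coord" using basis(3)[of w] by simp
    have "\<bar>w \<bullet> b / (b \<bullet> b)\<bar> \<le> r / norm b" if "b \<in> C" for b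
    proof -
      have "norm b > 0" using that basis(2) by auto
      moreover have "\<bar>w \<bullet> b\<bar> \<le> r * norm b"
        using Cauchy_Schwarz_ineq2[of w b] in_ball
        by (meson mem_cball_0 mult_right_mono norm_ge_zero order_trans)
      ultimately show ?thesis
        by (simp add: dot_square_norm power2_eq_square field_simps abs_mult)
    qed
    then show "?coord \<in> ?box" by (simp only: restrict_PiE_iff atLeastAtMost_iff abs_le_iff) force
  qed
  moreover have "compact (cball 0 r \<inter> ?comb ` ?box)"
    by (intro closed_Int_compact closed_cball compact_linear_combinations basis(1)) simp
  ultimately have "compact (cball (0::'a) r)" by (simp add: inf.absorb1)
  then have "compact ((+) a ` cball 0 r)" by (rule compact_translation)
  then show ?thesis by (simp add: cball_translation)
qed

section \<open>Smooth manifolds and bump functions\<close>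

lemma smooth_map_onI:
  "(\<And>U \<phi> k. (U, \<phi>) \<in> C \<Longrightarrow> Ck_on k (\<phi> ` (U \<inter> W)) (\<lambda>x. f (inv_into U \<phi> x))) \<Longrightarrow> smooth_map_on C W f"
  unfolding smooth_map_on_def Cinf_on_def o_def by blast

lemma smooth_map_onD:
  "smooth_map_on C W f \<Longrightarrow> (U, \<phi>) \<in> C \<Longrightarrow> Ck_on k (\<phi> ` (U \<inter> W)) (\<lambda>x. f (inv_into U \<phi> x))"
  unfolding smooth_map_on_def Cinf_on_def o_def by blast

lemma smooth_map_on_subset: "V \<subseteq> W \<Longrightarrow> smooth_map_on C W f \<Longrightarrow> smooth_map_on C V f"
  by (rule smooth_map_onI, erule Ck_on_subset[OF _ smooth_map_onD, rotated]) auto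

lemma smooth_map_on_const: "smooth_map_on C W (\<lambda>x. c)"
  unfolding smooth_map_on_def Cinf_on_def o_def by (auto intro: Ck_on_const)

lemma smooth_map_on_add:
  "smooth_map_on C W f \<Longrightarrow> smooth_map_on C W g \<Longrightarrow> smooth_map_on C W (\<lambda>x. f x + g x)"
  by (intro smooth_map_onI Ck_on_add) (auto dest: smooth_map_onD)

lemma smooth_map_on_bilinear:
  "bounded_bilinear h \<Longrightarrow> smooth_map_on C W f \<Longrightarrow> smooth_map_on C W g
    \<Longrightarrow> smooth_map_on C W (\<lambda>x. h (f x) (g x))"
  by (rule smooth_map_onI, erule bounded_bilinear.Ck_on_prod) (erule smooth_map_onD, assumption)+

lemmas smooth_map_on_scaleR = smooth_map_on_bilinear[OF bounded_bilinear_scaleR]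
lemmas smooth_map_on_mult = smooth_map_on_bilinear[OF bounded_bilinear_mult]
lemmas smooth_map_on_inner = smooth_map_on_bilinear[OF bounded_bilinear_inner]

lemma smooth_map_on_diff:
  "smooth_map_on C W f \<Longrightarrow> smooth_map_on C W g \<Longrightarrow> smooth_map_on C W (\<lambda>x. f x - g x)"
  using smooth_map_on_add[OF _ smooth_map_on_scaleR[OF smooth_map_on_const[of _ _ "-1"]],
      of C W f g]
  by simp

lemma smooth_map_on_flat: "smooth_map_on C W f \<Longrightarrow> smooth_map_on C W (\<lambda>x. flat m (f x))"
  by (rule smooth_map_onI, rule Ck_on_flat, erule smooth_map_onD)

locale smooth_manifold =
  fixes C :: "('m::{t2_space,second_countable_topology} set \<times> ('m \<Rightarrow> 'e::real_inner)) set"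
  assumes atlas: "smooth_atlas C"
begin

lemma chart_cover: obtains U \<phi> where "(U, \<phi>) \<in> C" "x \<in> U"
proof -
  have "x \<in> \<Union>(fst ` C)" using atlas unfolding smooth_atlas_def by blast
  then show ?thesis using that by auto
qed

lemma
  assumes "(U, \<phi>) \<in> C"
  shows chart_open: "open U"
    and chart_homeomorphism: "homeomorphism U (\<phi> ` U) \<phi> (inv_into U \<phi>)"
    and chart_image_open: "open (\<phi> ` U)"
    and chart_smooth: "smooth_map_on C U \<phi>"
  using atlas assms unfolding smooth_atlas_def smooth_map_on_def by blast+

lemma inv_chart: "(U, \<phi>) \<in> C \<Longrightarrow> x \<in> U \<Longrightarrow> inv_into U \<phi> (\<phi> x) = x"
  by (rule homeomorphism_apply1[OF chart_homeomorphism])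

lemma chart_image_open_Int:
  assumes "(U, \<phi>) \<in> C" "open W"
  shows "open (\<phi> ` (U \<inter> W))"
proof -
  have "openin (top_of_set (\<phi> ` U)) (\<phi> ` (U \<inter> W))"
    using assms by (intro homeomorphism_imp_open_map[OF chart_homeomorphism]) auto
  then show ?thesis using chart_image_open[OF assms(1)] openin_open_eq by blast
qed

lemma smooth_map_on_local:
  assumes "\<And>x. x \<in> W \<Longrightarrow> \<exists>V g. open V \<and> x \<in> V \<and> smooth_map_on C V g \<and> (\<forall>y\<in>V. g y = f y)"
  shows "smooth_map_on C W f"
proof (rule smooth_map_onI)
  fix U \<phi> k assume chart: "(U, \<phi>) \<in> C"
  show "Ck_on k (\<phi> ` (U \<inter> W)) (\<lambda>x. f (inv_into U \<phi> x))"
  proof (rule Ck_on_local)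
    fix z assume "z \<in> \<phi> ` (U \<inter> W)"
    then obtain x where preimage: "x \<in> U" "x \<in> W" "z = \<phi> x" by blast
    then obtain V g where local_extension: "open V" "x \<in> V" "smooth_map_on C V g" "\<forall>y\<in>V. g y = f y"
      using assms by blast
    have open_image: "open (\<phi> ` (U \<inter> V))"
      by (rule chart_image_open_Int[OF chart local_extension(1)])
    have "Ck_on k (\<phi> ` (U \<inter> V)) (\<lambda>x. g (inv_into U \<phi> x))"
      using local_extension(3) chart by (rule smooth_map_onD)
    then have "Ck_on k (\<phi> ` (U \<inter> V)) (\<lambda>x. f (inv_into U \<phi> x))"
      by (rule Ck_on_cong[OF open_image, rotated])
        (use local_extension(4) inv_chart[OF chart] in auto)
    then show "\<exists>V. open V \<and> z \<in> V \<and> Ck_on k V (\<lambda>x. f (inv_into U \<phi> x))"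
      using open_image preimage local_extension(2) by blast
  qed
qed

lemma smooth_map_on_cong:
  assumes "open W" "smooth_map_on C W g" "\<And>y. y \<in> W \<Longrightarrow> g y = f y"
  shows "smooth_map_on C W f"
  using assms by (intro smooth_map_on_local exI[of _ W] exI[of _ g]) simp

lemma smooth_map_on_inverse:
  fixes f :: "_ \<Rightarrow> real"
  assumes "smooth_map_on C W f" "\<And>x. x \<in> W \<Longrightarrow> f x \<noteq> 0"
  shows "smooth_map_on C W (\<lambda>x. inverse (f x))"
proof (rule smooth_map_onI, rule Ck_on_inverse)
  fix U \<phi> k assume chart: "(U, \<phi>) \<in> C"
  show "Ck_on k (\<phi> ` (U \<inter> W)) (\<lambda>x. f (inv_into U \<phi> x))"
    using assms(1) chart by (rule smooth_map_onD)
  show "f (inv_into U \<phi> z) \<noteq> 0" if "z \<in> \<phi> ` (U \<inter> W)" for z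
    using that assms(2) inv_chart[OF chart] by auto
qed

lemma smooth_imp_continuous:
  assumes "smooth_map_on C UNIV f"
  shows "continuous_on UNIV f"
proof (rule continuous_at_imp_continuous_on, rule ballI)
  fix x
  obtain U \<phi> where chart: "(U, \<phi>) \<in> C" "x \<in> U" by (rule chart_cover)
  have "continuous_on (\<phi> ` U) (\<lambda>z. f (inv_into U \<phi> z))"
    using smooth_map_onD[OF assms chart(1), of 0] by simp
  then have "continuous_on U (\<lambda>y. f (inv_into U \<phi> (\<phi> y)))"
    by (rule continuous_on_compose2[OF _ homeomorphism_cont1[OF chart_homeomorphism[OF chart(1)]]])
      simp
  then have "continuous_on U f" by (rule continuous_on_eq) (simp add: inv_chart[OF chart(1)])
  then show "isCont f x" using chart_open[OF chart(1)] chart(2) continuous_on_eq_continuous_at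
    by blast
qed

lemma smooth_map_on_extend_by_zero:
  assumes "open W" "closed K" "K \<subseteq> W" "open V" "smooth_map_on C (V \<inter> W) f"
    and zero: "\<And>y. y \<in> V \<Longrightarrow> y \<notin> K \<Longrightarrow> f y = 0"
  shows "smooth_map_on C V f"
proof (rule smooth_map_on_local)
  fix y assume y_in_V: "y \<in> V"
  show "\<exists>V g. open V \<and> y \<in> V \<and> smooth_map_on C V g \<and> (\<forall>z\<in>V. g z = f z)"
  proof (cases "y \<in> W")
    case True
    then show ?thesis using assms y_in_V by (intro exI[of _ "V \<inter> W"] exI[of _ f]) auto
  next
    case False
    then have "y \<in> V - K" using assms(3) y_in_V by blast
    then show ?thesis using assms
      by (intro exI[of _ "V - K"] exI[of _ "\<lambda>z. 0"]) (auto intro: smooth_map_on_const)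
  qed
qed

lemma chart_closed_ball:
  assumes chart: "(U, \<phi>) \<in> C" "x \<in> U" and neighbourhood: "open W" "x \<in> W"
  obtains r where "r > 0" "closed {y \<in> U. dist (\<phi> x) (\<phi> y) \<le> r}"
    "{y \<in> U. dist (\<phi> x) (\<phi> y) \<le> r} \<subseteq> W"
proof -
  obtain r where radius: "r > 0" "cball (\<phi> x) r \<subseteq> \<phi> ` (U \<inter> W)"
    using chart_image_open_Int[OF chart(1) neighbourhood(1)] chart neighbourhood
    by (meson IntI image_eqI open_contains_cball_eq)
  have ball: "{y \<in> U. dist (\<phi> x) (\<phi> y) \<le> r} = inv_into U \<phi> ` cball (\<phi> x) r"
  proof (intro set_eqI iffI)
    fix y assume "y \<in> {y \<in> U. dist (\<phi> x) (\<phi> y) \<le> r}"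
    then show "y \<in> inv_into U \<phi> ` cball (\<phi> x) r"
      by (intro image_eqI[of _ _ "\<phi> y"]) (simp_all add: inv_chart[OF chart(1)])
  next
    fix y assume "y \<in> inv_into U \<phi> ` cball (\<phi> x) r"
    then obtain z where preimage: "y = inv_into U \<phi> z" "z \<in> cball (\<phi> x) r" by blast
    then obtain u where "u \<in> U" "z = \<phi> u" using radius(2) by blast
    then show "y \<in> {y \<in> U. dist (\<phi> x) (\<phi> y) \<le> r}" using preimage
      by (simp add: inv_chart[OF chart(1)])
  qed
  have "finite_dim TYPE('e)" using atlas unfolding smooth_atlas_def by blast
  moreover have "continuous_on (cball (\<phi> x) r) (inv_into U \<phi>)"
    using continuous_on_subset[OF homeomorphism_cont2[OF chart_homeomorphism[OF chart(1)]]]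
      radius(2) by blast
  ultimately have "compact (inv_into U \<phi> ` cball (\<phi> x) r)"
    by (intro compact_continuous_image compact_cball_finite_dim)
  then have "closed {y \<in> U. dist (\<phi> x) (\<phi> y) \<le> r}" unfolding ball by (rule compact_imp_closed)
  moreover have "{y \<in> U. dist (\<phi> x) (\<phi> y) \<le> r} \<subseteq> W"
    unfolding ball using radius(2) inv_chart[OF chart(1)] by auto
  ultimately show ?thesis using that radius(1) by blast
qed

lemma bump_function:
  assumes "open W" "x \<in> W"
  obtains \<beta> :: "'m \<Rightarrow> real" and K where "smooth_map_on C UNIV \<beta>" "\<beta> x \<noteq> 0"
    "closed K" "K \<subseteq> W" "\<And>y. y \<notin> K \<Longrightarrow> \<beta> y = 0"
proof -
  obtain U \<phi> where chart: "(U, \<phi>) \<in> C" "x \<in> U" by (rule chart_cover)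
  obtain r where radius: "r > 0" "closed {y \<in> U. dist (\<phi> x) (\<phi> y) \<le> r}"
    "{y \<in> U. dist (\<phi> x) (\<phi> y) \<le> r} \<subseteq> W" (is "?K \<subseteq> W")
    by (rule chart_closed_ball[OF chart assms])
  define \<beta> where
    "\<beta> y = (if y \<in> U then flat 0 (r * r - (\<phi> y - \<phi> x) \<bullet> (\<phi> y - \<phi> x)) else 0)" for y
  have zero: "\<beta> y = 0" if "y \<notin> ?K" for y
  proof (cases "y \<in> U")
    case True
    then have "r * r < dist (\<phi> x) (\<phi> y) * dist (\<phi> x) (\<phi> y)"
      using that radius(1) by (intro mult_strict_mono) auto
    then show ?thesis
      by (simp add: \<beta>_def flat_def dist_norm norm_minus_commute dot_square_norm power2_eq_square)
  qed (simp add: \<beta>_def)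
  have "smooth_map_on C U (\<lambda>y. flat 0 (r * r - (\<phi> y - \<phi> x) \<bullet> (\<phi> y - \<phi> x)))"
    by (intro smooth_map_on_flat smooth_map_on_diff smooth_map_on_inner smooth_map_on_const
        chart_smooth[OF chart(1)])
  then have "smooth_map_on C U \<beta>"
    by (rule smooth_map_on_cong[OF chart_open[OF chart(1)]]) (simp add: \<beta>_def)
  then have "smooth_map_on C UNIV \<beta>"
    by (intro smooth_map_on_extend_by_zero[OF chart_open[OF chart(1)] radius(2) _ open_UNIV _
        zero]) auto
  moreover have "\<beta> x \<noteq> 0" using chart radius(1) by (simp add: \<beta>_def flat_def)
  ultimately show ?thesis using that radius(2,3) zero by blast
qed

end

section \<open>Sections of a vector bundle\<close>

lemma fmult_linear:
  "fmult f (\<lambda>x. r *\<^sub>R Y x + s *\<^sub>R Z x) = (\<lambda>x. r *\<^sub>R fmult f Y x + s *\<^sub>R fmult f Z x)"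
  by (simp add: fmult_def fun_eq_iff algebra_simps)

locale smooth_vector_bundle =
  fixes E :: "('m::{t2_space,second_countable_topology}, 'e::real_inner, 'v::real_vector, 'f::real_inner) vbundle"
  assumes vector_bundle: "vector_bundle E"
begin

sublocale smooth_manifold "charts E"
  using vector_bundle unfolding vector_bundle_def by unfold_locales (elim conjE)

lemma fibre_subspace: "subspace (fibre E x)"
  using vector_bundle unfolding vector_bundle_def by (elim conjE) (erule spec)

lemma typical_fibre_finite_dim: "finite_dim TYPE('f)"
  using vector_bundle unfolding vector_bundle_def by (elim conjE)

lemma triv_cover: obtains U \<Phi> where "(U, \<Phi>) \<in> trivs E" "x \<in> U"
proof -
  have "\<Union>(fst ` trivs E) = UNIV"
    using vector_bundle unfolding vector_bundle_def by (elim conjE)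
  then have "x \<in> \<Union>(fst ` trivs E)" by blast
  then show ?thesis using that by auto
qed

lemma
  assumes "(U, \<Phi>) \<in> trivs E"
  shows triv_open: "open U"
    and triv_bij: "x \<in> U \<Longrightarrow> bij_betw (\<Phi> x) (fibre E x) UNIV"
    and triv_add: "x \<in> U \<Longrightarrow> u \<in> fibre E x \<Longrightarrow> u' \<in> fibre E x \<Longrightarrow> \<Phi> x (u + u') = \<Phi> x u + \<Phi> x u'"
    and triv_scale: "x \<in> U \<Longrightarrow> u \<in> fibre E x \<Longrightarrow> \<Phi> x (r *\<^sub>R u) = r *\<^sub>R \<Phi> x u"
    and triv_transition: "(V, \<Psi>) \<in> trivs E \<Longrightarrow>
      smooth_map_on (charts E) (U \<inter> V) (\<lambda>x. \<Psi> x (inv_into (fibre E x) (\<Phi> x) w))"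
proof -
  have local_triv: "\<forall>(U, \<Phi>)\<in>trivs E. open U \<and>
        (\<forall>x\<in>U. bij_betw (\<Phi> x) (fibre E x) UNIV \<and>
           (\<forall>u\<in>fibre E x. \<forall>w\<in>fibre E x. \<Phi> x (u + w) = \<Phi> x u + \<Phi> x w) \<and>
           (\<forall>r. \<forall>u\<in>fibre E x. \<Phi> x (r *\<^sub>R u) = r *\<^sub>R \<Phi> x u))"
    and transition: "\<forall>(U, \<Phi>)\<in>trivs E. \<forall>(V, \<Psi>)\<in>trivs E. \<forall>w.
        smooth_map_on (charts E) (U \<inter> V) (\<lambda>x. \<Psi> x (inv_into (fibre E x) (\<Phi> x) w))"
    using vector_bundle unfolding vector_bundle_def by - (elim conjE, assumption)+
  from bspec[OF local_triv assms] show "open U"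
    "x \<in> U \<Longrightarrow> bij_betw (\<Phi> x) (fibre E x) UNIV"
    "x \<in> U \<Longrightarrow> u \<in> fibre E x \<Longrightarrow> u' \<in> fibre E x \<Longrightarrow> \<Phi> x (u + u') = \<Phi> x u + \<Phi> x u'"
    "x \<in> U \<Longrightarrow> u \<in> fibre E x \<Longrightarrow> \<Phi> x (r *\<^sub>R u) = r *\<^sub>R \<Phi> x u" by auto
  show "smooth_map_on (charts E) (U \<inter> V) (\<lambda>x. \<Psi> x (inv_into (fibre E x) (\<Phi> x) w))"
    if "(V, \<Psi>) \<in> trivs E" using bspec[OF transition assms] that by auto
qed

lemma triv_inv:
  assumes "(U, \<Phi>) \<in> trivs E" "x \<in> U"
  shows "inv_into (fibre E x) (\<Phi> x) w \<in> fibre E x" "\<Phi> x (inv_into (fibre E x) (\<Phi> x) w) = w"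
  using triv_bij[OF assms] unfolding bij_betw_def by (auto intro: inv_into_into f_inv_into_f)

lemma triv_zero: "(U, \<Phi>) \<in> trivs E \<Longrightarrow> x \<in> U \<Longrightarrow> \<Phi> x 0 = 0"
  using triv_scale[of U \<Phi> x 0 0] subspace_0[OF fibre_subspace] by simp

lemma triv_sum:
  assumes U_triv: "(U, \<Phi>) \<in> trivs E" "x \<in> U" and "finite I" "\<And>i. i \<in> I \<Longrightarrow> u i \<in> fibre E x"
  shows "\<Phi> x (\<Sum>i\<in>I. r i *\<^sub>R u i) = (\<Sum>i\<in>I. r i *\<^sub>R \<Phi> x (u i))"
  using assms(3,4)
proof (induction I)
  case (insert i I)
  have "(\<Sum>i\<in>I. r i *\<^sub>R u i) \<in> fibre E x" "r i *\<^sub>R u i \<in> fibre E x"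
    using insert fibre_subspace by (auto intro!: subspace_sum subspace_scale)
  then show ?case using insert triv_add[OF U_triv] triv_scale[OF U_triv] by simp
qed (simp add: triv_zero[OF U_triv])

lemma triv_eqI:
  assumes "(U, \<Phi>) \<in> trivs E" "x \<in> U" "u \<in> fibre E x" "w \<in> fibre E x" "\<Phi> x u = \<Phi> x w"
  shows "u = w"
  using triv_bij[OF assms(1,2)] assms(3-) unfolding bij_betw_def inj_on_def by blast

lemma Cinf_smooth: "f \<in> Cinf E \<Longrightarrow> smooth_map_on (charts E) W f"
  using smooth_map_on_subset[OF subset_UNIV] by (simp add: Cinf_def)

sublocale function_algebra "Sec E" "Cinf E"
  by unfold_locales
    (simp_all add: Cinf_def smooth_map_on_const smooth_map_on_add smooth_map_on_mult)

lemma SecI: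
  assumes "\<And>x. X x \<in> fibre E x"
    and "\<And>U \<Phi>. (U, \<Phi>) \<in> trivs E \<Longrightarrow> smooth_map_on (charts E) U (\<lambda>x. \<Phi> x (X x))"
  shows "X \<in> Sec E"
  using assms unfolding Sec_def by blast

lemma Sec_fibre: "X \<in> Sec E \<Longrightarrow> X x \<in> fibre E x"
  unfolding Sec_def by blast

lemma Sec_smooth:
  "X \<in> Sec E \<Longrightarrow> (U, \<Phi>) \<in> trivs E \<Longrightarrow> smooth_map_on (charts E) U (\<lambda>x. \<Phi> x (X x))"
  unfolding Sec_def by blast

lemma Sec_add: "X \<in> Sec E \<Longrightarrow> Y \<in> Sec E \<Longrightarrow> (\<lambda>x. X x + Y x) \<in> Sec E"
proof (rule SecI)
  assume XY_Sec: "X \<in> Sec E" "Y \<in> Sec E"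
  show "X x + Y x \<in> fibre E x" for x
    using XY_Sec by (intro subspace_add[OF fibre_subspace] Sec_fibre)
  fix U \<Phi> assume U_triv: "(U, \<Phi>) \<in> trivs E"
  have "smooth_map_on (charts E) U (\<lambda>x. \<Phi> x (X x) + \<Phi> x (Y x))"
    using XY_Sec U_triv by (intro smooth_map_on_add Sec_smooth)
  then show "smooth_map_on (charts E) U (\<lambda>x. \<Phi> x (X x + Y x))"
    by (rule smooth_map_on_cong[OF triv_open[OF U_triv]])
      (use XY_Sec in \<open>simp add: triv_add[OF U_triv] Sec_fibre\<close>)
qed

lemma Sec_fmult: "f \<in> Cinf E \<Longrightarrow> X \<in> Sec E \<Longrightarrow> fmult f X \<in> Sec E"
  unfolding fmult_def
proof (rule SecI)
  assume fX_Cinf: "f \<in> Cinf E" "X \<in> Sec E"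
  show "f x *\<^sub>R X x \<in> fibre E x" for x
    using fX_Cinf by (intro subspace_scale[OF fibre_subspace] Sec_fibre)
  fix U \<Phi> assume U_triv: "(U, \<Phi>) \<in> trivs E"
  have "smooth_map_on (charts E) U (\<lambda>x. f x *\<^sub>R \<Phi> x (X x))"
    using fX_Cinf U_triv by (intro smooth_map_on_scaleR Sec_smooth Cinf_smooth)
  then show "smooth_map_on (charts E) U (\<lambda>x. \<Phi> x (f x *\<^sub>R X x))"
    by (rule smooth_map_on_cong[OF triv_open[OF U_triv]])
      (use fX_Cinf in \<open>simp add: triv_scale[OF U_triv] Sec_fibre\<close>)
qed

lemma Sec_scale: "X \<in> Sec E \<Longrightarrow> (\<lambda>x. r *\<^sub>R X x) \<in> Sec E"
  using Sec_fmult[OF scalar_const[of r]] unfolding fmult_def .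

lemma Sec_linear: "X \<in> Sec E \<Longrightarrow> Y \<in> Sec E \<Longrightarrow> (\<lambda>x. r *\<^sub>R X x + s *\<^sub>R Y x) \<in> Sec E"
  by (intro Sec_add Sec_scale)

lemma Sec_diff: "X \<in> Sec E \<Longrightarrow> Y \<in> Sec E \<Longrightarrow> (\<lambda>x. X x - Y x) \<in> Sec E"
  using Sec_linear[of X Y 1 "-1"] by simp

lemma Sec_zero: "(\<lambda>x. 0) \<in> Sec E"
proof (rule SecI)
  show "0 \<in> fibre E x" for x by (rule subspace_0[OF fibre_subspace])
  fix U \<Phi> assume U_triv: "(U, \<Phi>) \<in> trivs E"
  show "smooth_map_on (charts E) U (\<lambda>x. \<Phi> x 0)"
    by (rule smooth_map_on_cong[OF triv_open[OF U_triv] smooth_map_on_const[of _ _ 0]])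
      (simp add: triv_zero[OF U_triv])
qed

lemma Sec_sum: "(\<And>i. i \<in> I \<Longrightarrow> X i \<in> Sec E) \<Longrightarrow> (\<lambda>x. \<Sum>i\<in>I. X i x) \<in> Sec E"
  by (induction I rule: infinite_finite_induct) (auto intro: Sec_zero Sec_add)

lemma Sec_rank_0:
  assumes "\<forall>w::'f. w = 0" "X \<in> Sec E"
  shows "X = (\<lambda>x. 0)"
proof
  fix x
  obtain U \<Phi> where U_triv: "(U, \<Phi>) \<in> trivs E" "x \<in> U" by (rule triv_cover)
  have "\<Phi> x (X x) = \<Phi> x 0" using assms(1) by metis
  then show "X x = 0"
    by (intro triv_eqI[OF U_triv]) (auto simp: Sec_fibre assms(2) subspace_0[OF fibre_subspace])
qed

lemma Sec_glue_fibre: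
  assumes "\<beta> x \<noteq> 0" "fmult \<beta> Z \<in> Sec E"
  shows "Z x \<in> fibre E x"
proof -
  have "inverse (\<beta> x) *\<^sub>R (\<beta> x *\<^sub>R Z x) \<in> fibre E x"
    using Sec_fibre[OF assms(2), of x] unfolding fmult_def
    by (rule subspace_scale[OF fibre_subspace])
  then show ?thesis using assms(1) by simp
qed

lemma Sec_glue:
  assumes "\<And>x. \<exists>\<beta>\<in>Cinf E. \<beta> x \<noteq> 0 \<and> fmult \<beta> Z \<in> Sec E"
  shows "Z \<in> Sec E"
proof (rule SecI)
  show fibre: "Z x \<in> fibre E x" for x using assms Sec_glue_fibre by blast
  fix U \<Phi> assume U_triv: "(U, \<Phi>) \<in> trivs E"
  show "smooth_map_on (charts E) U (\<lambda>x. \<Phi> x (Z x))"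
  proof (rule smooth_map_on_local)
    fix x assume x_in_U: "x \<in> U"
    obtain \<beta> where multiple: "\<beta> \<in> Cinf E" "\<beta> x \<noteq> 0" "fmult \<beta> Z \<in> Sec E" using assms by blast
    define V where "V = U \<inter> {y. \<beta> y \<noteq> 0}"
    have "open {y. \<beta> y \<noteq> 0}"
      using smooth_imp_continuous[OF Cinf_smooth[OF multiple(1)]] by (intro open_Collect_neq) auto
    then have "open V" using triv_open[OF U_triv] by (auto simp: V_def)
    moreover have "smooth_map_on (charts E) V (\<lambda>y. inverse (\<beta> y) *\<^sub>R \<Phi> y (fmult \<beta> Z y))"
    proof (intro smooth_map_on_scaleR smooth_map_on_inverse Cinf_smooth multiple(1))
      show "smooth_map_on (charts E) V (\<lambda>y. \<Phi> y (fmult \<beta> Z y))"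
        by (rule smooth_map_on_subset[OF _ Sec_smooth[OF multiple(3) U_triv]]) (simp add: V_def)
    qed (simp add: V_def)
    moreover have "inverse (\<beta> y) *\<^sub>R \<Phi> y (fmult \<beta> Z y) = \<Phi> y (Z y)" if "y \<in> V" for y
      using that by (simp add: V_def fmult_def triv_scale[OF U_triv] fibre)
    moreover have "x \<in> V" using x_in_U multiple(2) by (simp add: V_def)
    ultimately show "\<exists>V g. open V \<and> x \<in> V \<and> smooth_map_on (charts E) V g \<and> (\<forall>y\<in>V. g y = \<Phi> y (Z y))"
      by blast
  qed
qed

end

section \<open>Multilinear operators of bounded total order\<close>

text \<open>Covectors have degree \<open>1\<close>, which the simplifier would otherwise turn into \<open>Suc 0\<close>.\<close>

declare One_nat_def [simp del]

definition binary_op :: "('a \<Rightarrow> 'a \<Rightarrow> 'b) \<Rightarrow> 'a list \<Rightarrow> 'b" where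
  "binary_op B Xs = B (Xs ! 0) (Xs ! 1)"

lemma binary_op_pair [simp]: "binary_op B [X, Y] = B X Y"
  by (simp add: binary_op_def One_nat_def)

lemma args_length: "Xs \<in> args E p \<Longrightarrow> length Xs = p"
  unfolding args_def by auto

lemma args_nth: "Xs \<in> args E p \<Longrightarrow> i < p \<Longrightarrow> Xs ! i \<in> Sec E"
  unfolding args_def by auto

lemma args_update: "Xs \<in> args E p \<Longrightarrow> Z \<in> Sec E \<Longrightarrow> Xs[i := Z] \<in> args E p"
  unfolding args_def by (auto intro: set_update_subset[THEN subsetD])

lemma args_take: "Xs \<in> args E (p + q) \<Longrightarrow> take p Xs \<in> args E p"
  unfolding args_def by (auto dest: in_set_takeD)

lemma args_drop: "Xs \<in> args E (p + q) \<Longrightarrow> drop p Xs \<in> args E q"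
  unfolding args_def by (auto dest: in_set_dropD)

lemma args_permute_list:
  assumes "\<sigma> permutes {..<p}" "Xs \<in> args E p"
  shows "permute_list \<sigma> Xs \<in> args E p"
  using assms set_permute_list[of \<sigma> Xs] unfolding args_def by auto

lemma args_0 [simp]: "args E 0 = {[]}"
  by (auto simp: args_def)

lemma args_Cons [simp]: "X # Xs \<in> args E (Suc p) \<longleftrightarrow> X \<in> Sec E \<and> Xs \<in> args E p"
  by (auto simp: args_def)

lemma args_SucE:
  assumes "Xs \<in> args E (Suc p)"
  obtains X Ys where "Xs = X # Ys" "X \<in> Sec E" "Ys \<in> args E p"
  using assms by (cases Xs) (auto simp: args_def)

lemma args_1: "args E 1 = (\<lambda>X. [X]) ` Sec E"
  by (auto simp: One_nat_def elim!: args_SucE)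

lemma pair_in_args_2: "X \<in> Sec E \<Longrightarrow> Y \<in> Sec E \<Longrightarrow> [X, Y] \<in> args E 2"
  by (simp add: args_def)

lemma args_2E:
  assumes "Xs \<in> args E 2"
  obtains X Y where "Xs = [X, Y]" "X \<in> Sec E" "Y \<in> Sec E"
  using assms by (auto simp: numeral_2_eq_2 elim!: args_SucE)

lemma permute_list_update:
  assumes "\<sigma> permutes {..<length Xs}" "j < length Xs"
  shows "permute_list \<sigma> (Xs[\<sigma> j := Z]) = (permute_list \<sigma> Xs)[j := Z]"
proof (rule nth_equalityI)
  fix i assume "i < length (permute_list \<sigma> (Xs[\<sigma> j := Z]))"
  moreover have "\<sigma> j < length Xs" using permutes_in_image[OF assms(1), of j] assms(2) by simp
  moreover have "\<sigma> j = \<sigma> i \<longleftrightarrow> j = i" using permutes_inj[OF assms(1)] by (auto dest: injD)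
  ultimately show "permute_list \<sigma> (Xs[\<sigma> j := Z]) ! i = (permute_list \<sigma> Xs)[j := Z] ! i"
    using assms by (simp add: permute_list_nth nth_list_update)
qed simp

lemma permute_list_inv_front_cycle:
  assumes "i < length Xs"
  shows "permute_list (inv (front_cycle i)) Xs = Xs ! i # take i Xs @ drop (Suc i) Xs"
proof -
  let ?Ys = "take i Xs @ drop (Suc i) Xs"
  obtain n where length: "length Xs = Suc n" "i \<le> n" using assms by (cases "length Xs") auto
  note cycle = front_cycle_permutes[OF length(2)]
  have "Xs = permute_list (front_cycle i) (Xs ! i # ?Ys)"
    using assms by (simp add: permute_list_front_cycle id_take_nth_drop)
  then have "permute_list (inv (front_cycle i)) Xs
      = permute_list (front_cycle i \<circ> inv (front_cycle i)) (Xs ! i # ?Ys)"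
    using permute_list_compose[of "inv (front_cycle i)" "Xs ! i # ?Ys"] permutes_inv[OF cycle]
      length
    by (metis length_permute_list)
  then show ?thesis by (simp add: permutes_inv_o[OF cycle])
qed

text \<open>Total order at most \<open>n - 1\<close>, so that \<open>n = 0\<close> is the zero operator.\<close>

primrec total_order_less :: "('m, 'e::real_inner, 'v::real_vector, 'f::real_inner) vbundle
    \<Rightarrow> nat \<Rightarrow> nat \<Rightarrow> (('m \<Rightarrow> 'v) list \<Rightarrow> 'm \<Rightarrow> 'w::real_vector) \<Rightarrow> bool" where
  "total_order_less E p 0 = (\<lambda>D. \<forall>Xs\<in>args E p. D Xs = (\<lambda>x. 0))"
| "total_order_less E p (Suc n) = (\<lambda>D. \<forall>i<p. \<forall>f\<in>Cinf E. total_order_less E p n (\<delta> i f D))"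

lemma total_order_less_iff_foldr:
  "total_order_less E p n D \<longleftrightarrow> (\<forall>ifs. length ifs = n \<and> set ifs \<subseteq> {..<p} \<times> Cinf E \<longrightarrow>
     (\<forall>Xs\<in>args E p. foldr (\<lambda>(i, f). \<delta> i f) ifs D Xs = (\<lambda>x. 0)))"
    (is "_ \<longleftrightarrow> ?annihilated n D")
proof (induction n arbitrary: D)
  case (Suc n)
  show ?case
  proof
    assume less: "total_order_less E p (Suc n) D"
    show "?annihilated (Suc n) D"
    proof (intro allI impI, elim conjE)
      fix ifs assume commutators: "length ifs = Suc n" "set ifs \<subseteq> {..<p} \<times> Cinf E"
      then obtain js i f where snoc: "ifs = js @ [(i, f)]" by (cases ifs rule: rev_cases) auto
      then have "total_order_less E p n (\<delta> i f D)" using less commutators by simp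
      then show "\<forall>Xs\<in>args E p. foldr (\<lambda>(i, f). \<delta> i f) ifs D Xs = (\<lambda>x. 0)"
        using Suc.IH[of "\<delta> i f D"] commutators snoc by auto
    qed
  next
    assume annihilated: "?annihilated (Suc n) D"
    have "total_order_less E p n (\<delta> i f D)" if "i < p" "f \<in> Cinf E" for i f
      unfolding Suc.IH using annihilated[rule_format, of "_ @ [(i, f)]"] that by auto
    then show "total_order_less E p (Suc n) D" by simp
  qed
qed simp

lemma total_order_le_iff_less: "total_order_le E p k D \<longleftrightarrow> total_order_less E p (Suc k) D"
  unfolding total_order_le_def total_order_less_iff_foldr by (simp add: One_nat_def)

lemma total_order_le_imp_order_le:
  assumes "total_order_le E p k D" "i < p"
  shows "order_le E p i k D"
  unfolding order_le_def
proof (intro allI impI ballI)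
  fix fs Xs assume commutators: "length fs = k + 1 \<and> set fs \<subseteq> Cinf E" and Xs_args: "Xs \<in> args E p"
  have "foldr (\<lambda>(i, f). \<delta> i f) (map (Pair i) fs) D Xs = (\<lambda>x. 0)"
    using assms(1)[unfolded total_order_le_def, rule_format, of "map (Pair i) fs" Xs] assms(2)
      commutators Xs_args
    by auto
  moreover have "foldr (\<lambda>(i, f). \<delta> i f) (map (Pair i) fs) D = foldr (\<delta> i) fs D"
    by (induction fs) auto
  ultimately show "foldr (\<delta> i) fs D Xs = (\<lambda>x. 0)" by simp
qed

context smooth_vector_bundle
begin

lemma args_fmult: "Xs \<in> args E p \<Longrightarrow> i < p \<Longrightarrow> f \<in> Cinf E \<Longrightarrow> Xs[i := fmult f (Xs ! i)] \<in> args E p"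
  by (intro args_update Sec_fmult args_nth)

lemma \<delta>_Cinf:
  assumes "\<And>Xs. Xs \<in> args E p \<Longrightarrow> D Xs \<in> Cinf E" "i < p" "f \<in> Cinf E" "Xs \<in> args E p"
  shows "\<delta> i f D Xs \<in> Cinf E"
  unfolding \<delta>_def using assms by (auto intro!: scalar_diff scalar_mult args_fmult)

lemma \<delta>_Sec:
  assumes "\<And>Xs. Xs \<in> args E p \<Longrightarrow> D Xs \<in> Sec E" "i < p" "f \<in> Cinf E" "Xs \<in> args E p"
  shows "\<delta> i f D Xs \<in> Sec E"
  unfolding \<delta>_def using assms Sec_fmult[of f "D Xs"]
  by (auto intro!: Sec_diff args_fmult simp: fmult_def[of f "D Xs"])

lemma total_order_less_zero:
  "(\<And>Xs. Xs \<in> args E p \<Longrightarrow> D Xs = (\<lambda>x. 0)) \<Longrightarrow> total_order_less E p n D"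
proof (induction n arbitrary: D)
  case (Suc n)
  have "total_order_less E p n (\<delta> i f D)" if "i < p" "f \<in> Cinf E" for i f
    by (rule Suc.IH) (use Suc.prems that in \<open>auto simp: \<delta>_def args_fmult\<close>)
  then show ?case by simp
qed simp

lemma total_order_less_linear:
  assumes "total_order_less E p n D" "total_order_less E p n D'"
  shows "total_order_less E p n (\<lambda>Xs x. r *\<^sub>R D Xs x + s *\<^sub>R D' Xs x)"
  using assms
proof (induction n arbitrary: D D')
  case (Suc n)
  have "\<delta> i f (\<lambda>Xs x. r *\<^sub>R D Xs x + s *\<^sub>R D' Xs x)
      = (\<lambda>Xs x. r *\<^sub>R \<delta> i f D Xs x + s *\<^sub>R \<delta> i f D' Xs x)" for i f
    by (simp add: \<delta>_def fun_eq_iff algebra_simps)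
  then show ?case using Suc by simp
qed simp

lemma total_order_less_cong:
  assumes "total_order_less E p n D" "\<And>Xs. Xs \<in> args E p \<Longrightarrow> D Xs = D' Xs"
  shows "total_order_less E p n D'"
  using assms
proof (induction n arbitrary: D D')
  case (Suc n)
  have "total_order_less E p n (\<delta> i f D')" if "i < p" "f \<in> Cinf E" for i f
    by (rule Suc.IH[of "\<delta> i f D"]) (use Suc.prems that in \<open>auto simp: \<delta>_def args_fmult\<close>)
  then show ?case by simp
qed simp

lemma total_order_less_add:
  "total_order_less E p n D \<Longrightarrow> total_order_less E p n D' \<Longrightarrow>
    total_order_less E p n (\<lambda>Xs x. D Xs x + D' Xs x)"
  using total_order_less_linear[of p n D D' 1 1] by simp

text \<open>A Leibniz rule for commutators with a composite makes orders add up.  Both \<open>outer\<close> and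
  \<open>partial_comp\<close> below have one.\<close>

lemma total_order_less_composite:
  assumes zero: "\<And>n m D Xs. composite n m D \<Longrightarrow> n = 0 \<or> m = 0 \<Longrightarrow> Xs \<in> args E p \<Longrightarrow> D Xs = (\<lambda>x. 0)"
    and Leibniz: "\<And>n m D i f r. composite (Suc n) (Suc m) D \<Longrightarrow> i < p \<Longrightarrow> f \<in> Cinf E \<Longrightarrow>
      (\<And>D'. composite n (Suc m) D' \<Longrightarrow> total_order_less E p r D') \<Longrightarrow>
      (\<And>D'. composite (Suc n) m D' \<Longrightarrow> total_order_less E p r D') \<Longrightarrow>
      total_order_less E p r (\<delta> i f D)"
  shows "composite n m D \<Longrightarrow> n + m \<le> Suc r \<Longrightarrow> total_order_less E p r D"
proof (induction r arbitrary: n m D)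
  case 0
  then have "n = 0 \<or> m = 0" by auto
  then show ?case using 0(1) zero by simp
next
  case (Suc r)
  show ?case
  proof (cases "n = 0 \<or> m = 0")
    case True
    then show ?thesis using Suc.prems zero by (intro total_order_less_zero)
  next
    case False
    then obtain n' m' where "n = Suc n'" "m = Suc m'" by (metis not0_implies_Suc)
    then have "total_order_less E p r (\<delta> i f D)" if "i < p" "f \<in> Cinf E" for i f
      using Suc.prems that Suc.IH[of n' m] Suc.IH[of n m'] by (intro Leibniz[of n' m']) simp_all
    then show ?thesis by simp
  qed
qed

lemma multilinearD:
  assumes "multilinear E p D" "Xs \<in> args E p" "i < p" "Y \<in> Sec E" "Z \<in> Sec E"
  shows "D (Xs[i := (\<lambda>x. r *\<^sub>R Y x + s *\<^sub>R Z x)])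
      = (\<lambda>x. r *\<^sub>R D (Xs[i := Y]) x + s *\<^sub>R D (Xs[i := Z]) x)"
proof -
  note linear = assms(1)[unfolded multilinear_def, rule_format, OF assms(2,3)]
  show ?thesis
    using linear[OF Sec_scale[OF assms(4), of r] Sec_scale[OF assms(5), of s]]
      linear[OF assms(4,5), of r] linear[OF assms(5,4), of s] by simp
qed

lemma multilinearI:
  assumes "\<And>Xs i Y Z r s. Xs \<in> args E p \<Longrightarrow> i < p \<Longrightarrow> Y \<in> Sec E \<Longrightarrow> Z \<in> Sec E \<Longrightarrow>
    D (Xs[i := (\<lambda>x. r *\<^sub>R Y x + s *\<^sub>R Z x)])
        = (\<lambda>x. r *\<^sub>R D (Xs[i := Y]) x + s *\<^sub>R D (Xs[i := Z]) x)"
  shows "multilinear E p D"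
  unfolding multilinear_def
proof (intro ballI allI impI conjI)
  fix Xs i Y Z and r :: real
  assume XY_args: "Xs \<in> args E p" "i < p" "Y \<in> Sec E" "Z \<in> Sec E"
  show "D (Xs[i := (\<lambda>x. Y x + Z x)]) = (\<lambda>x. D (Xs[i := Y]) x + D (Xs[i := Z]) x)"
    using assms[OF XY_args, of 1 1] by simp
  show "D (Xs[i := (\<lambda>x. r *\<^sub>R Y x)]) = (\<lambda>x. r *\<^sub>R D (Xs[i := Y]) x)"
    using assms[OF XY_args, of r 0] by simp
qed

lemma multilinear_SucI:
  assumes "\<And>X Y Ys r s. X \<in> Sec E \<Longrightarrow> Y \<in> Sec E \<Longrightarrow> Ys \<in> args E p \<Longrightarrow>
      D ((\<lambda>x. r *\<^sub>R X x + s *\<^sub>R Y x) # Ys) = (\<lambda>x. r *\<^sub>R D (X # Ys) x + s *\<^sub>R D (Y # Ys) x)"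
    and "\<And>X. X \<in> Sec E \<Longrightarrow> multilinear E p (\<lambda>Ys. D (X # Ys))"
  shows "multilinear E (Suc p) D"
proof (rule multilinearI)
  fix Xs i Y Z and r s :: real
  assume "Xs \<in> args E (Suc p)" "i < Suc p" and YZ_Sec: "Y \<in> Sec E" "Z \<in> Sec E"
  moreover from this obtain X Xs' where "Xs = X # Xs'" "X \<in> Sec E" "Xs' \<in> args E p"
    by (auto elim: args_SucE)
  ultimately show "D (Xs[i := (\<lambda>x. r *\<^sub>R Y x + s *\<^sub>R Z x)])
      = (\<lambda>x. r *\<^sub>R D (Xs[i := Y]) x + s *\<^sub>R D (Xs[i := Z]) x)"
    using assms(1) multilinearD[OF assms(2)] by (cases i) auto
qed

lemma multilinear_zero_slot:
  assumes "multilinear E p D" "Xs \<in> args E p" "i < p"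
  shows "D (Xs[i := (\<lambda>x. 0)]) = (\<lambda>x. 0)"
  using multilinearD[OF assms Sec_zero Sec_zero, of 0 0] by simp

lemma multilinear_zero: "multilinear E p (\<lambda>Xs x. 0)"
  unfolding multilinear_def by simp

lemma multilinear_cong:
  assumes "multilinear E p D" "\<And>Xs. Xs \<in> args E p \<Longrightarrow> D Xs = D' Xs"
  shows "multilinear E p D'"
  using assms unfolding multilinear_def by (simp add: args_update Sec_add Sec_scale)

lemma multilinear_linear:
  assumes "multilinear E p D" "multilinear E p D'"
  shows "multilinear E p (\<lambda>Xs x. r *\<^sub>R D Xs x + s *\<^sub>R D' Xs x)"
  using assms unfolding multilinear_def by (simp add: fun_eq_iff algebra_simps)

lemma multilinear_\<delta>:
  assumes "multilinear E p D" "i < p" "f \<in> Cinf E"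
  shows "multilinear E p (\<delta> i f D)"
proof (rule multilinearI)
  fix Xs j Y Z and r s :: real
  assume XY_args: "Xs \<in> args E p" "j < p" "Y \<in> Sec E" "Z \<in> Sec E"
  show "\<delta> i f D (Xs[j := (\<lambda>x. r *\<^sub>R Y x + s *\<^sub>R Z x)]) =
      (\<lambda>x. r *\<^sub>R \<delta> i f D (Xs[j := Y]) x + s *\<^sub>R \<delta> i f D (Xs[j := Z]) x)"
  proof (cases "i = j")
    case True
    then show ?thesis
      using multilinearD[OF assms(1) XY_args, of r s] XY_args
        multilinearD[OF assms(1) XY_args(1,2) Sec_fmult[OF assms(3) XY_args(3)]
            Sec_fmult[OF assms(3) XY_args(4)]]
      by (simp add: \<delta>_def args_length fmult_linear fun_eq_iff algebra_simps)
  next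
    case False
    then show ?thesis
      using multilinearD[OF assms(1) XY_args, of r s]
        multilinearD[OF assms(1) args_fmult[OF XY_args(1) assms(2,3)] XY_args(2-), of r s]
      by (simp add: \<delta>_def fun_eq_iff algebra_simps list_update_swap)
  qed
qed

definition multidiff_less :: "nat \<Rightarrow> nat \<Rightarrow> (('m \<Rightarrow> 'v) list \<Rightarrow> 'm \<Rightarrow> 'w::real_vector) \<Rightarrow> bool" where
  "multidiff_less p n D \<longleftrightarrow> multilinear E p D \<and> total_order_less E p n D"

lemma multidiff_less_cong:
  "multidiff_less p n D \<Longrightarrow> (\<And>Xs. Xs \<in> args E p \<Longrightarrow> D Xs = D' Xs) \<Longrightarrow> multidiff_less p n D'"
  unfolding multidiff_less_def using multilinear_cong total_order_less_cong by blast

lemma multidiff_less_zero: "multidiff_less p n (\<lambda>Xs x. 0)"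
  by (simp add: multidiff_less_def multilinear_zero total_order_less_zero)

lemma multidiff_less_linear:
  "multidiff_less p n D \<Longrightarrow> multidiff_less p n D' \<Longrightarrow>
    multidiff_less p n (\<lambda>Xs x. r *\<^sub>R D Xs x + s *\<^sub>R D' Xs x)"
  unfolding multidiff_less_def using multilinear_linear total_order_less_linear by blast

lemma multidiff_less_scale: "multidiff_less p n D \<Longrightarrow> multidiff_less p n (\<lambda>Xs x. r *\<^sub>R D Xs x)"
  using multidiff_less_linear[of p n D D r 0] by simp

lemma multidiff_less_sum:
  assumes "\<And>i. i \<in> I \<Longrightarrow> multidiff_less p n (D i)"
  shows "multidiff_less p n (\<lambda>Xs x. \<Sum>i\<in>I. D i Xs x)"
  using assms
proof (induction I rule: infinite_finite_induct)
  case (insert i I)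
  then show ?case
    using multidiff_less_linear[of p n "D i" "\<lambda>Xs x. \<Sum>i\<in>I. D i Xs x" 1 1] by simp
qed (simp_all add: multidiff_less_zero)

lemma multilinear_permute_list:
  assumes "\<sigma> permutes {..<p}" "multilinear E p D"
  shows "multilinear E p (\<lambda>Xs. D (permute_list \<sigma> Xs))"
proof (rule multilinearI)
  fix Xs i Y Z and r s :: real
  assume Xs_args: "Xs \<in> args E p" and "i < p" and YZ_Sec: "Y \<in> Sec E" "Z \<in> Sec E"
  then obtain j where "i = \<sigma> j" "j < p"
    using permutes_in_image[OF assms(1)] permutes_inverses(1)[OF assms(1), of i]
    by (metis lessThan_iff)
  then show "D (permute_list \<sigma> (Xs[i := (\<lambda>x. r *\<^sub>R Y x + s *\<^sub>R Z x)]))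
      = (\<lambda>x. r *\<^sub>R D (permute_list \<sigma> (Xs[i := Y])) x + s *\<^sub>R D (permute_list \<sigma> (Xs[i := Z])) x)"
    using multilinearD[OF assms(2) args_permute_list[OF assms(1) Xs_args] _ YZ_Sec]
    by (simp add: permute_list_update args_length[OF Xs_args] assms(1))
qed

lemma total_order_less_permute_list:
  assumes perm: "\<sigma> permutes {..<p}"
  shows "total_order_less E p n D \<Longrightarrow> total_order_less E p n (\<lambda>Xs. D (permute_list \<sigma> Xs))"
proof (induction n arbitrary: D)
  case 0
  then show ?case by (simp add: args_permute_list[OF perm])
next
  case (Suc n)
  have "total_order_less E p n (\<delta> i f (\<lambda>Xs. D (permute_list \<sigma> Xs)))" if i_less: "i < p"
    and f_Cinf: "f \<in> Cinf E" for i f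
  proof -
    obtain j where preimage: "i = \<sigma> j" "j < p"
      using permutes_in_image[OF perm] permutes_inverses(1)[OF perm, of i] i_less
      by (metis lessThan_iff)
    show ?thesis
    proof (rule total_order_less_cong)
      show "total_order_less E p n (\<lambda>Xs. \<delta> j f D (permute_list \<sigma> Xs))"
        using Suc.prems preimage f_Cinf by (intro Suc.IH) simp
      show "\<delta> j f D (permute_list \<sigma> Xs) = \<delta> i f (\<lambda>Xs. D (permute_list \<sigma> Xs)) Xs"
        if "Xs \<in> args E p" for Xs
        using args_length[OF that] perm preimage
        by (simp add: \<delta>_def permute_list_update permute_list_nth)
    qed
  qed
  then show ?case by simp
qed

lemma multidiff_less_permute_list:
  "\<sigma> permutes {..<p} \<Longrightarrow> multidiff_less p n D \<Longrightarrow> multidiff_less p n (\<lambda>Xs. D (permute_list \<sigma> Xs))"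
  unfolding multidiff_less_def using multilinear_permute_list total_order_less_permute_list by blast

definition outer :: "nat \<Rightarrow> ('m, 'v) cochain \<Rightarrow> ('m, 'v) cochain \<Rightarrow> ('m, 'v) cochain" where
  "outer p a b = (\<lambda>Xs x. a (take p Xs) x * b (drop p Xs) x)"

lemma outer_update:
  assumes "length Xs = p + q" "i < p + q"
  shows "outer p a b (Xs[i := Z]) = (if i < p then (\<lambda>x. a ((take p Xs)[i := Z]) x * b (drop p Xs) x)
    else (\<lambda>x. a (take p Xs) x * b ((drop p Xs)[i - p := Z]) x))"
  using assms by (simp add: outer_def take_update_swap drop_update_swap list_update_beyond)

lemma multilinear_outer:
  assumes a_multilinear: "multilinear E p a" and b_multilinear: "multilinear E q b"
  shows "multilinear E (p + q) (outer p a b)"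
proof (rule multilinearI)
  fix Xs i Y Z and r s :: real
  assume Xs_args: "Xs \<in> args E (p + q)" and i_less: "i < p + q" and YZ_Sec: "Y \<in> Sec E" "Z \<in> Sec E"
  show "outer p a b (Xs[i := (\<lambda>x. r *\<^sub>R Y x + s *\<^sub>R Z x)]) =
      (\<lambda>x. r *\<^sub>R outer p a b (Xs[i := Y]) x + s *\<^sub>R outer p a b (Xs[i := Z]) x)"
    using multilinearD[OF a_multilinear args_take[OF Xs_args] _ YZ_Sec, of i r s]
      multilinearD[OF b_multilinear args_drop[OF Xs_args] _ YZ_Sec, of "i - p" r s] i_less
    by (simp add: outer_update[OF args_length[OF Xs_args] i_less] algebra_simps)
qed

lemma \<delta>_outer:
  assumes "length Xs = p + q" "i < p + q"
  shows "\<delta> i f (outer p a b) Xs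
    = (if i < p then outer p (\<delta> i f a) b Xs else outer p a (\<delta> (i - p) f b) Xs)"
  unfolding \<delta>_def outer_update[OF assms] using assms by (auto simp: outer_def algebra_simps)

lemma total_order_less_outer:
  assumes "total_order_less E p n a" "total_order_less E q m b" "n + m \<le> Suc r"
  shows "total_order_less E (p + q) r (outer p a b)"
    (is "?less r (outer p a b)")
proof -
  define composite where "composite n m D \<longleftrightarrow>
    (\<exists>a b. D = outer p a b \<and> total_order_less E p n a \<and> total_order_less E q m b)" for n m D
  have compositeI: "composite n m (outer p a b)"
    if "total_order_less E p n a" "total_order_less E q m b" for n m a b
    using that unfolding composite_def by blast
  show ?thesis
  proof (rule total_order_less_composite[of composite, OF _ _ compositeI[OF assms(1,2)] assms(3)])
    show "D Xs = (\<lambda>x. 0)"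
      if "composite n m D" "n = 0 \<or> m = 0" "Xs \<in> args E (p + q)" for n m D Xs
      using that args_take args_drop unfolding composite_def by (fastforce simp: outer_def)
    show "?less r (\<delta> i f D)"
      if composite: "composite (Suc n) (Suc m) D" and i_less: "i < p + q" and f_Cinf: "f \<in> Cinf E"
        and left: "\<And>D'. composite n (Suc m) D' \<Longrightarrow> ?less r D'"
        and right: "\<And>D'. composite (Suc n) m D' \<Longrightarrow> ?less r D'" for n m D i f r
    proof -
      obtain a b where factors: "D = outer p a b" "total_order_less E p (Suc n) a"
        "total_order_less E q (Suc m) b" using composite unfolding composite_def by blast
      have "?less r (if i < p then outer p (\<delta> i f a) b else outer p a (\<delta> (i - p) f b))"
        using factors i_less f_Cinf left[OF compositeI, of "\<delta> i f a" b]
          right[OF compositeI, of a "\<delta> (i - p) f b"]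
        by simp
      then show ?thesis
        by (rule total_order_less_cong) (simp add: factors(1) \<delta>_outer[OF args_length i_less])
    qed
  qed
qed

lemma multidiff_less_outer:
  "multidiff_less p n a \<Longrightarrow> multidiff_less q m b \<Longrightarrow> n + m \<le> Suc r \<Longrightarrow>
    multidiff_less (p + q) r (outer p a b)"
  unfolding multidiff_less_def using multilinear_outer total_order_less_outer by blast

text \<open>The partial composition of operads, except that the first argument of \<open>b\<close> comes first.\<close>

definition partial_comp :: "nat \<Rightarrow> ('m, 'v) cochain \<Rightarrow> (('m \<Rightarrow> 'v) list \<Rightarrow> 'm \<Rightarrow> 'v) \<Rightarrow> ('m, 'v) cochain"
  where "partial_comp j c b = (\<lambda>Xs. c ((tl Xs)[j := b [hd Xs, tl Xs ! j]]))"

lemma partial_comp_Cons: "partial_comp j c b (X # Ys) = c (Ys[j := b [X, Ys ! j]])"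
  by (simp add: partial_comp_def)

lemma multilinear_partial_comp:
  assumes j_less: "j < p" and c_multilinear: "multilinear E p c"
    and b_multilinear: "multilinear E 2 b"
    and b_Sec: "\<And>Ys. Ys \<in> args E 2 \<Longrightarrow> b Ys \<in> Sec E"
  shows "multilinear E (Suc p) (partial_comp j c b)"
proof (rule multilinear_SucI)
  fix X Y Ys and r s :: real
  assume XY_Sec: "X \<in> Sec E" "Y \<in> Sec E" and Ys_args: "Ys \<in> args E p"
  have Ys_j_Sec: "Ys ! j \<in> Sec E" using Ys_args j_less by (rule args_nth)
  have "b [\<lambda>x. r *\<^sub>R X x + s *\<^sub>R Y x, Ys ! j] = (\<lambda>x. r *\<^sub>R b [X, Ys ! j] x + s *\<^sub>R b [Y, Ys ! j] x)"
    using multilinearD[OF b_multilinear pair_in_args_2[OF XY_Sec(1) Ys_j_Sec] _ XY_Sec, of 0 r s]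
    by simp
  then show "partial_comp j c b ((\<lambda>x. r *\<^sub>R X x + s *\<^sub>R Y x) # Ys)
      = (\<lambda>x. r *\<^sub>R partial_comp j c b (X # Ys) x + s *\<^sub>R partial_comp j c b (Y # Ys) x)"
    using XY_Sec Ys_j_Sec multilinearD[OF c_multilinear Ys_args j_less]
    by (simp add: partial_comp_Cons b_Sec pair_in_args_2)
next
  fix X assume X_Sec: "X \<in> Sec E"
  show "multilinear E p (\<lambda>Ys. partial_comp j c b (X # Ys))"
  proof (rule multilinearI)
    fix Ys i Y Z and r s :: real
    assume Ys_args: "Ys \<in> args E p" and i_less: "i < p" and YZ_Sec: "Y \<in> Sec E" "Z \<in> Sec E"
    have Ys_j_Sec: "Ys ! j \<in> Sec E" using Ys_args j_less by (rule args_nth)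
    show "partial_comp j c b (X # Ys[i := (\<lambda>x. r *\<^sub>R Y x + s *\<^sub>R Z x)])
        = (\<lambda>x. r *\<^sub>R partial_comp j c b (X # Ys[i := Y]) x
            + s *\<^sub>R partial_comp j c b (X # Ys[i := Z]) x)"
    proof (cases "i = j")
      case True
      have "b [X, \<lambda>x. r *\<^sub>R Y x + s *\<^sub>R Z x] = (\<lambda>x. r *\<^sub>R b [X, Y] x + s *\<^sub>R b [X, Z] x)"
        using multilinearD[OF b_multilinear pair_in_args_2[OF X_Sec Ys_j_Sec] _ YZ_Sec, of 1 r s]
        by (simp add: One_nat_def)
      then show ?thesis
        using True X_Sec YZ_Sec j_less args_length[OF Ys_args]
          multilinearD[OF c_multilinear Ys_args j_less]
        by (simp add: partial_comp_Cons b_Sec pair_in_args_2)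
    next
      case False
      have "Ys[j := b [X, Ys ! j]] \<in> args E p"
        by (intro args_update Ys_args b_Sec pair_in_args_2 X_Sec Ys_j_Sec)
      from multilinearD[OF c_multilinear this i_less YZ_Sec] show ?thesis
        using False by (simp add: partial_comp_Cons list_update_swap)
    qed
  qed
qed

lemma partial_comp_eq_0:
  assumes "j < p" "multilinear E p c" "total_order_less E p n c"
    and b_Sec: "\<And>Ys. Ys \<in> args E 2 \<Longrightarrow> b Ys \<in> Sec E" "total_order_less E 2 m b"
    and "n = 0 \<or> m = 0" "Xs \<in> args E (Suc p)"
  shows "partial_comp j c b Xs = (\<lambda>x. 0)"
proof -
  obtain X Ys where Cons: "Xs = X # Ys" "X \<in> Sec E" "Ys \<in> args E p"
    using assms(7) by (rule args_SucE)
  have pair: "[X, Ys ! j] \<in> args E 2" using Cons assms(1) by (intro pair_in_args_2 args_nth)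
  from assms(6) show ?thesis
  proof
    assume "n = 0"
    then show ?thesis
      using assms(3) args_update[OF Cons(3) b_Sec(1)[OF pair]]
      by (simp add: Cons(1) partial_comp_Cons)
  next
    assume "m = 0"
    then have "b [X, Ys ! j] = (\<lambda>x. 0)" using b_Sec(2) pair by simp
    then show ?thesis
      using multilinear_zero_slot[OF assms(2) Cons(3) assms(1)]
      by (simp add: Cons(1) partial_comp_Cons)
  qed
qed

lemma multilinear_commutator_split:
  assumes c_multilinear: "multilinear E p c" and Ys_args: "Ys \<in> args E p" "j < p"
    and f_Cinf: "f \<in> Cinf E"
    and UW_Sec: "U \<in> Sec E" "W \<in> Sec E"
  shows "c (Ys[j := U]) x - f x * c (Ys[j := W]) x
    = c (Ys[j := (\<lambda>x. U x - f x *\<^sub>R W x)]) x + \<delta> j f c (Ys[j := W]) x"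
proof -
  have "(\<lambda>x. U x - f x *\<^sub>R W x) \<in> Sec E"
    using Sec_diff[OF UW_Sec(1) Sec_fmult[OF f_Cinf UW_Sec(2)]] by (simp add: fmult_def)
  moreover have "(\<lambda>x. fmult f W x + (U x - f x *\<^sub>R W x)) = U" by (simp add: fmult_def)
  ultimately have "c (Ys[j := U]) x
      = c (Ys[j := fmult f W]) x + c (Ys[j := (\<lambda>x. U x - f x *\<^sub>R W x)]) x"
    using multilinearD[OF c_multilinear Ys_args Sec_fmult[OF f_Cinf UW_Sec(2)],
        of "\<lambda>x. U x - f x *\<^sub>R W x" 1 1] by simp
  then show ?thesis using Ys_args(2) by (simp add: \<delta>_def args_length[OF Ys_args(1)])
qed

lemma \<delta>_partial_comp:
  assumes j_less: "j < p" and c_multilinear: "multilinear E p c"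
    and b_Sec: "\<And>Ys. Ys \<in> args E 2 \<Longrightarrow> b Ys \<in> Sec E" and f_Cinf: "f \<in> Cinf E"
    and X_Ys: "X \<in> Sec E" "Ys \<in> args E p"
  shows "\<delta> 0 f (partial_comp j c b) (X # Ys)
      = (\<lambda>x. partial_comp j c (\<delta> 0 f b) (X # Ys) x + partial_comp j (\<delta> j f c) b (X # Ys) x)"
    and "\<delta> (Suc j) f (partial_comp j c b) (X # Ys)
      = (\<lambda>x. partial_comp j c (\<delta> 1 f b) (X # Ys) x + partial_comp j (\<delta> j f c) b (X # Ys) x)"
    and "i \<noteq> j \<Longrightarrow> \<delta> (Suc i) f (partial_comp j c b) (X # Ys) = partial_comp j (\<delta> i f c) b (X # Ys)"
proof -
  have Ys_j_Sec: "Ys ! j \<in> Sec E" using X_Ys(2) j_less by (rule args_nth)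
  note split = multilinear_commutator_split[OF c_multilinear X_Ys(2) j_less f_Cinf b_Sec
      b_Sec[OF pair_in_args_2[OF X_Ys(1) Ys_j_Sec]]]
  show "\<delta> 0 f (partial_comp j c b) (X # Ys)
      = (\<lambda>x. partial_comp j c (\<delta> 0 f b) (X # Ys) x + partial_comp j (\<delta> j f c) b (X # Ys) x)"
    using split[OF pair_in_args_2[OF Sec_fmult[OF f_Cinf X_Ys(1)] Ys_j_Sec]]
    by (simp add: \<delta>_def[of 0] partial_comp_Cons)
  show "\<delta> (Suc j) f (partial_comp j c b) (X # Ys)
      = (\<lambda>x. partial_comp j c (\<delta> 1 f b) (X # Ys) x + partial_comp j (\<delta> j f c) b (X # Ys) x)"
    using split[OF pair_in_args_2[OF X_Ys(1) Sec_fmult[OF f_Cinf Ys_j_Sec]]]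
      args_length[OF X_Ys(2)] j_less
    by (simp add: \<delta>_def[of "Suc j"] \<delta>_def[of "Suc 0"] partial_comp_Cons One_nat_def)
  show "\<delta> (Suc i) f (partial_comp j c b) (X # Ys) = partial_comp j (\<delta> i f c) b (X # Ys)"
    if "i \<noteq> j"
    using that by (simp add: \<delta>_def partial_comp_Cons list_update_swap)
qed

lemma total_order_less_\<delta>_partial_comp:
  assumes j_less: "j < p" and c_multilinear: "multilinear E p c"
    and b_Sec: "\<And>Ys. Ys \<in> args E 2 \<Longrightarrow> b Ys \<in> Sec E"
    and f_Cinf: "f \<in> Cinf E" and i_less: "i < Suc p"
    and left: "\<And>k. k < p \<Longrightarrow> total_order_less E (Suc p) r (partial_comp j (\<delta> k f c) b)"
    and right: "\<And>k. k < 2 \<Longrightarrow> total_order_less E (Suc p) r (partial_comp j c (\<delta> k f b))"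
  shows "total_order_less E (Suc p) r (\<delta> i f (partial_comp j c b))"
proof -
  note commutator = \<delta>_partial_comp[OF j_less c_multilinear b_Sec f_Cinf]
  consider (inserted) "i = 0" | (bracketed) "i = Suc j" | (other) k where "i = Suc k" "k \<noteq> j"
    by (cases i) auto
  then show ?thesis
  proof cases
    case inserted
    have "total_order_less E (Suc p) r
        (\<lambda>Xs x. partial_comp j c (\<delta> 0 f b) Xs x + partial_comp j (\<delta> j f c) b Xs x)"
      using j_less by (intro total_order_less_add left right) auto
    then show ?thesis
      by (rule total_order_less_cong) (auto simp: inserted commutator(1) elim!: args_SucE)
  next
    case bracketed
    have "total_order_less E (Suc p) r
        (\<lambda>Xs x. partial_comp j c (\<delta> 1 f b) Xs x + partial_comp j (\<delta> j f c) b Xs x)"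
      using j_less by (intro total_order_less_add left right) auto
    then show ?thesis
      by (rule total_order_less_cong) (auto simp: bracketed commutator(2) elim!: args_SucE)
  next
    case other
    then show ?thesis
      using i_less
      by (intro total_order_less_cong[OF left[of k]])
        (auto simp: commutator(3) elim!: args_SucE)
  qed
qed

lemma total_order_less_partial_comp:
  assumes j_less: "j < p" and "multilinear E p c" "total_order_less E p n c"
    and "\<And>Ys. Ys \<in> args E 2 \<Longrightarrow> b Ys \<in> Sec E" "total_order_less E 2 m b" and "n + m \<le> Suc r"
  shows "total_order_less E (Suc p) r (partial_comp j c b)"
    (is "?less r (partial_comp j c b)")
proof -
  define composite where "composite n m D \<longleftrightarrow>
    (\<exists>c b. D = partial_comp j c b \<and> multilinear E p c \<and> total_order_less E p n c
      \<and> (\<forall>Ys\<in>args E 2. b Ys \<in> Sec E) \<and> total_order_less E 2 m b)" for n m D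
  have compositeI: "composite n m (partial_comp j c b)"
    if "multilinear E p c" "total_order_less E p n c"
      "\<And>Ys. Ys \<in> args E 2 \<Longrightarrow> b Ys \<in> Sec E" "total_order_less E 2 m b" for n m c b
    using that unfolding composite_def by blast
  show ?thesis
  proof (rule total_order_less_composite[of composite, OF _ _ compositeI[OF assms(2-5)] assms(6)])
    show "D Xs = (\<lambda>x. 0)"
      if "composite n m D" "n = 0 \<or> m = 0" "Xs \<in> args E (Suc p)" for n m D Xs
      using that partial_comp_eq_0[OF j_less] unfolding composite_def by blast
    show "?less r (\<delta> i f D)"
      if composite: "composite (Suc n) (Suc m) D" and i_less: "i < Suc p" and f_Cinf: "f \<in> Cinf E"
        and left: "\<And>D'. composite n (Suc m) D' \<Longrightarrow> ?less r D'"
        and right: "\<And>D'. composite (Suc n) m D' \<Longrightarrow> ?less r D'" for n m D i f r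
    proof -
      obtain c b where factors: "D = partial_comp j c b" "multilinear E p c"
        "total_order_less E p (Suc n) c" "\<And>Ys. Ys \<in> args E 2 \<Longrightarrow> b Ys \<in> Sec E"
        "total_order_less E 2 (Suc m) b" using composite unfolding composite_def by blast
      show ?thesis
        unfolding factors(1) using factors f_Cinf
        by (intro total_order_less_\<delta>_partial_comp[OF j_less factors(2,4) f_Cinf i_less] left right
            compositeI)
          (auto intro: multilinear_\<delta> \<delta>_Sec)
    qed
  qed
qed

lemma multidiff_less_partial_comp:
  "j < p \<Longrightarrow> multidiff_less p n c \<Longrightarrow> (\<And>Ys. Ys \<in> args E 2 \<Longrightarrow> b Ys \<in> Sec E) \<Longrightarrow>
    multidiff_less 2 m b \<Longrightarrow> n + m \<le> Suc r \<Longrightarrow> multidiff_less (Suc p) r (partial_comp j c b)"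
  unfolding multidiff_less_def
  using multilinear_partial_comp total_order_less_partial_comp by blast

end

section \<open>The reduced shuffle algebra\<close>

lemma fn_Nil [simp]: "fn f [] = f" and fn_Cons [simp]: "fn f (X # Xs) = (\<lambda>x. 0)"
  by (simp_all add: fn_def)

lemma fn_linear: "fn (\<lambda>x. r * f x + s * g x) = (\<lambda>Xs x. r * fn f Xs x + s * fn g Xs x)"
  by (auto simp: fn_def fun_eq_iff)

lemma shuffle_zero_left: "(\<lambda>Ys y. 0) \<pitchfork> b = (\<lambda>Xs x. 0)"
  by (simp add: shuffle_def)

lemma shuffle_zero_right: "a \<pitchfork> (\<lambda>Ys y. 0) = (\<lambda>Xs x. 0)"
  by (simp add: shuffle_def)

lemma shuffle_fn_left:
  fixes b :: "('m, 'v) cochain"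
  shows "(fn f \<pitchfork> b) Xs x = f x * b Xs x"
proof (induction Xs arbitrary: b)
  case (Cons X Xs)
  have "\<iota> X (fn f) = (\<lambda>Ys y. 0)" "\<epsilon> (fn f :: ('m, 'v) cochain) = fn f"
    by (auto simp: contraction_def grade_involution_def fn_def fun_eq_iff)
  then show ?case
    using Cons by (simp add: shuffle_Cons shuffle_zero_left contraction_def[of X b])
qed (simp add: shuffle_Nil)

lemma shuffle_one: "(a \<pitchfork> b) [X] x = a [X] x * b [] x + a [] x * b [X] x"
  by (simp add: shuffle_Cons shuffle_Nil contraction_def grade_involution_def)

lemma shuffle_two:
  "(a \<pitchfork> b) [X, Y] x =
    a [X, Y] x * b [] x + a [X] x * b [Y] x - a [Y] x * b [X] x + a [] x * b [X, Y] x"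
  by (simp add: shuffle_Cons shuffle_Nil contraction_def grade_involution_def)

lemma shuffle_homogeneous_left:
  assumes "\<And>Ys. length Ys \<noteq> p \<Longrightarrow> a Ys = (\<lambda>x. 0)"
  shows "(a \<pitchfork> b) Xs x = (if p \<le> length Xs then shuffle_part p a b Xs x else 0)"
proof -
  have "shuffle_part r a b Xs x = 0" if "r \<le> length Xs" "r \<noteq> p" for r
    using assms that by (simp add: shuffle_part_def)
  then have "(a \<pitchfork> b) Xs x = (\<Sum>r\<le>length Xs. if r = p then shuffle_part r a b Xs x else 0)"
    unfolding shuffle_eq_sum_parts by (intro sum.cong) auto
  then show ?thesis by (simp add: sum.delta)
qed

lemma shuffle_homogeneous:
  assumes a_degree: "\<And>Ys. length Ys \<noteq> p \<Longrightarrow> a Ys = (\<lambda>x. 0)"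
    and b_degree: "\<And>Ys. length Ys \<noteq> q \<Longrightarrow> b Ys = (\<lambda>x. 0)"
    and length: "length Xs \<noteq> p + q"
  shows "(a \<pitchfork> b) Xs = (\<lambda>x. 0)"
proof
  fix x
  have "shuffle_part p a b Xs x = 0" if "p \<le> length Xs"
    using that length b_degree by (simp add: shuffle_part_def)
  then show "(a \<pitchfork> b) Xs x = 0" by (simp add: shuffle_homogeneous_left[OF a_degree])
qed

lemma shuffle_supported:
  assumes "\<And>Ys. \<not> set Ys \<subseteq> S \<Longrightarrow> a Ys = (\<lambda>x. 0)" "\<And>Ys. \<not> set Ys \<subseteq> S \<Longrightarrow> b Ys = (\<lambda>x. 0)"
    "\<not> set Xs \<subseteq> S"
  shows "(a \<pitchfork> b) Xs x = 0"
  using assms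
proof (induction Xs arbitrary: a b)
  case (Cons X Xs)
  show ?case
  proof (cases "X \<in> S")
    case True
    have "(\<iota> X a \<pitchfork> b) Xs x = 0" "(\<epsilon> a \<pitchfork> \<iota> X b) Xs x = 0"
      by (rule Cons.IH; use Cons.prems True in \<open>simp add: contraction_def grade_involution_def\<close>)+
    then show ?thesis by (simp add: shuffle_Cons)
  next
    case False
    then have "\<iota> X a = (\<lambda>Ys y. 0)" "\<iota> X b = (\<lambda>Ys y. 0)"
      using Cons.prems by (auto simp: contraction_def)
    then show ?thesis by (simp add: shuffle_Cons shuffle_zero_left shuffle_zero_right)
  qed
qed simp

lemma component_length [simp]: "component (length Xs) c Xs = c Xs"
  by (simp add: component_def)

lemma component_linear:
  "component p (\<lambda>Xs x. r * a Xs x + s * b Xs x)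
    = (\<lambda>Xs x. r * component p a Xs x + s * component p b Xs x)"
  by (auto simp: component_def fun_eq_iff)

lemma component_shuffle:
  assumes a_degree: "\<And>Ys. length Ys \<noteq> p \<Longrightarrow> a Ys = (\<lambda>x. 0)"
  shows "component n (a \<pitchfork> b) = (if p \<le> n then a \<pitchfork> component (n - p) b else (\<lambda>Xs x. 0))"
proof (intro ext)
  fix Xs x
  show "component n (a \<pitchfork> b) Xs x
      = (if p \<le> n then a \<pitchfork> component (n - p) b else (\<lambda>Xs x. 0)) Xs x"
  proof (cases "length Xs = n")
    case True
    then show ?thesis
      by (simp add: component_def shuffle_homogeneous_left[OF a_degree] shuffle_part_def)
  next
    case False
    then have "(a \<pitchfork> component (n - p) b) Xs = (\<lambda>x. 0)" if "p \<le> n"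
      using that by (intro shuffle_homogeneous[where q = "n - p", OF a_degree])
        (auto simp: component_def)
    then show ?thesis using False by (simp add: component_def[of n])
  qed
qed

context smooth_vector_bundle
begin

definition last_linear :: "('m, 'v) cochain \<Rightarrow> bool" where
  "last_linear c \<longleftrightarrow> (\<forall>Xs Y f. set Xs \<subseteq> Sec E \<longrightarrow> Y \<in> Sec E \<longrightarrow> f \<in> Cinf E \<longrightarrow>
     c (Xs @ [fmult f Y]) = (\<lambda>x. f x * c (Xs @ [Y]) x))"

lemma last_linearD:
  assumes "last_linear c" "set Xs \<subseteq> Sec E" "Y \<in> Sec E" "f \<in> Cinf E"
  shows "c (Xs @ [fmult f Y]) = (\<lambda>x. f x * c (Xs @ [Y]) x)"
  using assms(1)[unfolded last_linear_def, rule_format, OF assms(2-)] .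

lemma last_linear_contraction: "last_linear c \<Longrightarrow> X \<in> Sec E \<Longrightarrow> last_linear (\<iota> X c)"
  unfolding last_linear_def[of "\<iota> X c"] using last_linearD[of c "X # _"]
  by (simp add: contraction_def)

lemma last_linear_grade_involution: "last_linear c \<Longrightarrow> last_linear (\<epsilon> c)"
  unfolding last_linear_def grade_involution_def by (simp add: mult.left_commute)

lemma last_linear_shuffle:
  assumes "last_linear a" "last_linear b"
  shows "last_linear (a \<pitchfork> b)"
proof -
  have "(a \<pitchfork> b) (Xs @ [fmult f Y]) x = f x * (a \<pitchfork> b) (Xs @ [Y]) x"
    if "last_linear a" "last_linear b" "set Xs \<subseteq> Sec E" "Y \<in> Sec E" "f \<in> Cinf E" for a b Xs Y f x
    using that
  proof (induction Xs arbitrary: a b)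
    case Nil
    then show ?case
      using last_linearD[of a "[]" Y f] last_linearD[of b "[]" Y f]
      by (simp add: shuffle_one shuffle_Nil algebra_simps)
  next
    case (Cons X Xs)
    then show ?case
      by (simp add: shuffle_Cons last_linear_contraction last_linear_grade_involution distrib_left)
  qed
  then show ?thesis unfolding last_linear_def[of "a \<pitchfork> b"] using assms by (simp add: fun_eq_iff)
qed

lemma order_le_0_iff:
  "order_le E p i 0 D \<longleftrightarrow> (\<forall>f\<in>Cinf E. \<forall>Xs\<in>args E p. \<delta> i f D Xs = (\<lambda>x. 0))"
proof -
  have "(\<forall>fs. length fs = 1 \<and> set fs \<subseteq> Cinf E \<longrightarrow> P fs) \<longleftrightarrow> (\<forall>f\<in>Cinf E. P [f])" for P
    by (auto simp: One_nat_def length_Suc_conv)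
  then show ?thesis unfolding order_le_def by simp
qed

lemma last_order_le_0_iff_last_linear:
  assumes outside: "\<And>Xs. Xs \<notin> args E (Suc k) \<Longrightarrow> c Xs = (\<lambda>x. 0)"
  shows "order_le E (Suc k) k 0 c \<longleftrightarrow> last_linear c"
proof -
  have args: "Xs \<in> args E (Suc k) \<longleftrightarrow> (\<exists>Ys Y. Xs = Ys @ [Y] \<and> Ys \<in> args E k \<and> Y \<in> Sec E)" for Xs
    by (cases Xs rule: rev_cases) (auto simp: args_def)
  have commutator: "\<delta> k f c (Ys @ [Y]) = (\<lambda>x. 0) \<longleftrightarrow>
      c (Ys @ [fmult f Y]) = (\<lambda>x. f x * c (Ys @ [Y]) x)" if "length Ys = k" for f Ys Y
    using that by (auto simp: \<delta>_def fun_eq_iff)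
  have "c (Xs @ [fmult f Y]) = (\<lambda>x. f x * c (Xs @ [Y]) x)" if "length Xs \<noteq> k" for Xs f Y
    using that outside[of "Xs @ [_]"] by (simp add: args_def)
  then have "last_linear c \<longleftrightarrow> (\<forall>Xs\<in>args E k. \<forall>Y\<in>Sec E. \<forall>f\<in>Cinf E.
      c (Xs @ [fmult f Y]) = (\<lambda>x. f x * c (Xs @ [Y]) x))"
    unfolding last_linear_def args_def by blast
  then show ?thesis
    unfolding order_le_0_iff using args commutator args_length by (metis (no_types, lifting))
qed

lemma reduced_ops_iff:
  "c \<in> reduced_ops E k \<longleftrightarrow> (\<forall>Xs. Xs \<notin> args E k \<longrightarrow> c Xs = (\<lambda>x. 0)) \<and> (\<forall>Xs\<in>args E k. c Xs \<in> Cinf E) \<and>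
     last_linear c \<and> multidiff_less k (max 1 k) c"
proof (cases k)
  case 0
  have "last_linear c" if "\<forall>Xs. Xs \<notin> args E 0 \<longrightarrow> c Xs = (\<lambda>x. 0)"
    using that by (simp add: last_linear_def)
  then show ?thesis
    unfolding reduced_ops_def diff_ops_def multidifferential_def multidiff_less_def
    by (auto simp: 0 One_nat_def)
next
  case (Suc j)
  have "\<exists>r. \<forall>i<k. order_le E k i r c" if "total_order_le E k j c"
    using total_order_le_imp_order_le[OF that] by blast
  then show ?thesis
    using last_order_le_0_iff_last_linear[of j c] total_order_le_iff_less[of E k j c]
    unfolding reduced_ops_def diff_ops_def multidifferential_def multidiff_less_def
    by (auto simp: Suc One_nat_def)
qed

lemma
  assumes "c \<in> reduced_ops E k"
  shows reduced_outside: "Xs \<notin> args E k \<Longrightarrow> c Xs = (\<lambda>x. 0)"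
    and reduced_length: "length Xs \<noteq> k \<Longrightarrow> c Xs = (\<lambda>x. 0)"
    and reduced_Cinf: "set Xs \<subseteq> Sec E \<Longrightarrow> c Xs \<in> Cinf E"
    and reduced_last_linear: "last_linear c"
    and reduced_multidiff: "multidiff_less k (max 1 k) c"
proof -
  note reduced = assms[unfolded reduced_ops_iff]
  show "Xs \<notin> args E k \<Longrightarrow> c Xs = (\<lambda>x. 0)" "last_linear c" "multidiff_less k (max 1 k) c"
    using reduced by simp_all
  show "length Xs \<noteq> k \<Longrightarrow> c Xs = (\<lambda>x. 0)" using reduced by (simp add: args_def)
  show "c Xs \<in> Cinf E" if "set Xs \<subseteq> Sec E"
    using reduced that scalar_const[of 0] by (cases "Xs \<in> args E k") auto
qed

lemma reduced_multilinear: "c \<in> reduced_ops E k \<Longrightarrow> multilinear E k c"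
  using reduced_multidiff by (simp add: multidiff_less_def)

lemma reduced_linear:
  assumes "a \<in> reduced_ops E k" "b \<in> reduced_ops E k"
  shows "(\<lambda>Xs x. r * a Xs x + s * b Xs x) \<in> reduced_ops E k"
proof -
  have "last_linear (\<lambda>Xs x. r * a Xs x + s * b Xs x)"
    using assms[THEN reduced_last_linear] by (simp add: last_linear_def algebra_simps)
  then show ?thesis
    using assms multidiff_less_linear[OF assms[THEN reduced_multidiff], of r s]
    by (simp add: reduced_ops_iff scalar_linear)
qed

lemma reduced_zero: "(\<lambda>Xs x. 0) \<in> reduced_ops E k"
  unfolding reduced_ops_iff
  by (auto simp: scalar_const last_linear_def intro: multidiff_less_zero)

lemma fn_reduced: "f \<in> Cinf E \<Longrightarrow> fn f \<in> reduced_ops E 0"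
  unfolding reduced_ops_iff multidiff_less_def
  by (simp add: fn_def multilinear_def last_linear_def One_nat_def)

lemma reduced_0_eq_fn: "c \<in> reduced_ops E 0 \<Longrightarrow> c = fn (c []) \<and> c [] \<in> Cinf E"
  using reduced_length[of c 0] reduced_Cinf[of c 0 "[]"] by (auto simp: fn_def fun_eq_iff)

lemma component_reduced:
  "c \<in> reduced_ops E p \<Longrightarrow> component q c = (if q = p then c else (\<lambda>Xs x. 0))"
  using reduced_length by (auto simp: component_def fun_eq_iff)

lemma reduced_shuffle_iff:
  "c \<in> reduced_shuffle E \<longleftrightarrow>
    (\<forall>p. component p c \<in> reduced_ops E p) \<and> (\<exists>N. \<forall>p\<ge>N. component p c = (\<lambda>Xs x. 0))"
  unfolding reduced_shuffle_def finite_nat_set_iff_bounded by (auto simp: not_less[symmetric])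

lemma reduced_ops_subset: "c \<in> reduced_ops E p \<Longrightarrow> c \<in> reduced_shuffle E"
  unfolding reduced_shuffle_iff
  by (simp add: component_reduced reduced_zero) (use not_less_eq_eq in blast)

lemma component_in_reduced_ops: "c \<in> reduced_shuffle E \<Longrightarrow> component p c \<in> reduced_ops E p"
  unfolding reduced_shuffle_iff by blast

lemma fn_reduced_shuffle: "f \<in> Cinf E \<Longrightarrow> fn f \<in> reduced_shuffle E"
  by (rule reduced_ops_subset[OF fn_reduced])

lemma reduced_shuffle_outside:
  "c \<in> reduced_shuffle E \<Longrightarrow> \<not> set Xs \<subseteq> Sec E \<Longrightarrow> c Xs = (\<lambda>x. 0)"
  using reduced_outside[OF component_in_reduced_ops, of c Xs "length Xs"] by (simp add: args_def)

lemma reduced_shuffle_scalar_valued: "c \<in> reduced_shuffle E \<Longrightarrow> scalar_valued c"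
  unfolding scalar_valued_def
  using reduced_Cinf[OF component_in_reduced_ops, of c] by (metis component_length)

lemma reduced_shuffle_slotwise_additive:
  assumes "c \<in> reduced_shuffle E"
  shows "slotwise_additive c"
  unfolding slotwise_additive_def
proof (intro allI impI)
  fix Ys Zs Y Z
  assume slots_Sec: "set Ys \<subseteq> Sec E" "set Zs \<subseteq> Sec E" "Y \<in> Sec E" "Z \<in> Sec E"
  let ?n = "length (Ys @ Y # Zs)"
  have "Ys @ Y # Zs \<in> args E ?n" using slots_Sec by (simp add: args_def)
  from multilinearD[OF reduced_multilinear[OF component_in_reduced_ops[OF assms]] this,
      of "length Ys" Y Z 1 1]
  show "c (Ys @ (\<lambda>x. Y x + Z x) # Zs) = (\<lambda>x. c (Ys @ Y # Zs) x + c (Ys @ Z # Zs) x)"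
    using slots_Sec by (simp add: component_def)
qed

lemma reduced_shuffle_linear:
  assumes "a \<in> reduced_shuffle E" "b \<in> reduced_shuffle E"
  shows "(\<lambda>Xs x. r * a Xs x + s * b Xs x) \<in> reduced_shuffle E"
proof -
  obtain M N where "\<forall>p\<ge>M. component p a = (\<lambda>Xs x. 0)" "\<forall>p\<ge>N. component p b = (\<lambda>Xs x. 0)"
    using assms unfolding reduced_shuffle_iff by blast
  then have "\<forall>p\<ge>max M N. component p (\<lambda>Xs x. r * a Xs x + s * b Xs x) = (\<lambda>Xs x. 0)"
    by (simp add: component_linear)
  moreover have "component p (\<lambda>Xs x. r * a Xs x + s * b Xs x) \<in> reduced_ops E p" for p
    unfolding component_linear using assms by (intro reduced_linear component_in_reduced_ops)
  ultimately show ?thesis unfolding reduced_shuffle_iff by blast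
qed

lemma shuffle_reduced:
  assumes a_reduced: "a \<in> reduced_ops E p" and b_reduced: "b \<in> reduced_ops E q"
  shows "a \<pitchfork> b \<in> reduced_ops E (p + q)"
proof -
  note rs = reduced_ops_subset[OF a_reduced] reduced_ops_subset[OF b_reduced]
  have "(a \<pitchfork> b) Xs = (\<lambda>x. 0)" if "Xs \<notin> args E (p + q)" for Xs
  proof (cases "set Xs \<subseteq> Sec E")
    case True
    then show ?thesis
      using that shuffle_homogeneous[OF reduced_length[OF a_reduced] reduced_length[OF b_reduced]]
      by (simp add: args_def)
  next
    case False
    show ?thesis
      by (rule ext, rule shuffle_supported[OF _ _ False]) (simp_all add: rs reduced_shuffle_outside)
  qed
  moreover have "(a \<pitchfork> b) Xs \<in> Cinf E" if "Xs \<in> args E (p + q)" for Xs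
    using that scalar_valuedD[OF scalar_valued_shuffle[OF rs[THEN reduced_shuffle_scalar_valued]]]
    by (simp add: args_def)
  moreover have "last_linear (a \<pitchfork> b)"
    by (rule last_linear_shuffle[OF reduced_last_linear[OF a_reduced]
        reduced_last_linear[OF b_reduced]])
  moreover have "multidiff_less (p + q) (max 1 (p + q)) (a \<pitchfork> b)"
  proof (rule multidiff_less_cong)
    show "multidiff_less (p + q) (max 1 (p + q))
        (\<lambda>Xs x. \<Sum>\<sigma>\<in>sh p q. of_int (sign \<sigma>) *\<^sub>R outer p a b (permute_list \<sigma> Xs) x)"
      using reduced_multidiff[OF a_reduced] reduced_multidiff[OF b_reduced]
      by (intro multidiff_less_sum multidiff_less_scale multidiff_less_permute_list
          multidiff_less_outer) (auto simp: sh_def)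
    show "(\<lambda>x. \<Sum>\<sigma>\<in>sh p q. of_int (sign \<sigma>) *\<^sub>R outer p a b (permute_list \<sigma> Xs) x) = (a \<pitchfork> b) Xs"
      if "Xs \<in> args E (p + q)" for Xs
      using args_length[OF that]
      by (simp add: fun_eq_iff shuffle_homogeneous_left[OF reduced_length[OF a_reduced]]
          shuffle_part_def
          outer_def mult.assoc)
  qed
  ultimately show ?thesis unfolding reduced_ops_iff by blast
qed

lemma shuffle_reduced_shuffle:
  assumes a_reduced: "a \<in> reduced_ops E p" and b_reduced: "b \<in> reduced_shuffle E"
  shows "a \<pitchfork> b \<in> reduced_shuffle E"
proof -
  note component = component_shuffle[OF reduced_length[OF a_reduced], where b = b]
  have "component n (a \<pitchfork> b) \<in> reduced_ops E n" for n
    using shuffle_reduced[OF a_reduced component_in_reduced_ops[OF b_reduced], of "n - p"]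
      reduced_zero
    by (auto simp: component)
  moreover obtain N where "\<forall>q\<ge>N. component q b = (\<lambda>Xs x. 0)"
    using b_reduced unfolding reduced_shuffle_iff by blast
  then have "\<forall>n\<ge>p + N. component n (a \<pitchfork> b) = (\<lambda>Xs x. 0)"
    by (simp add: component shuffle_zero_right)
  ultimately show ?thesis unfolding reduced_shuffle_iff by blast
qed

end

section \<open>Covectors and reflexivity\<close>

context smooth_vector_bundle
begin

lemma covectorI:
  assumes outside: "\<And>Xs. Xs \<notin> args E 1 \<Longrightarrow> l Xs = (\<lambda>x. 0)"
    and Cinf: "\<And>X. X \<in> Sec E \<Longrightarrow> l [X] \<in> Cinf E"
    and add: "\<And>X Y. X \<in> Sec E \<Longrightarrow> Y \<in> Sec E \<Longrightarrow> l [\<lambda>x. X x + Y x] = (\<lambda>x. l [X] x + l [Y] x)"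
    and fmult: "\<And>f X. f \<in> Cinf E \<Longrightarrow> X \<in> Sec E \<Longrightarrow> l [fmult f X] = (\<lambda>x. f x * l [X] x)"
  shows "l \<in> reduced_ops E 1"
proof -
  have "l (Xs @ [fmult f Y]) = (\<lambda>x. f x * l (Xs @ [Y]) x)" if "Y \<in> Sec E" "f \<in> Cinf E" for Xs Y f
    using that fmult outside[of "Xs @ [_]"] by (cases Xs) (auto simp: args_def)
  then have "last_linear l" by (simp add: last_linear_def)
  moreover have "l [\<lambda>x. r *\<^sub>R X x + s *\<^sub>R Y x] = (\<lambda>x. r * l [X] x + s * l [Y] x)"
    if "X \<in> Sec E" "Y \<in> Sec E" for X Y r s
    using add[OF Sec_scale[OF that(1)] Sec_scale[OF that(2)]] that
      fmult[OF scalar_const] unfolding fmult_def by simp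
  then have "multilinear E 1 l"
    unfolding One_nat_def by (intro multilinear_SucI) (auto simp: multilinear_def)
  moreover have "total_order_less E 1 (max 1 1) l"
    using fmult by (auto simp: One_nat_def \<delta>_def elim!: args_SucE)
  ultimately show ?thesis
    using outside Cinf by (auto simp: reduced_ops_iff multidiff_less_def args_1)
qed

lemma
  assumes "l \<in> reduced_ops E 1"
  shows covector_outside: "Xs \<notin> args E 1 \<Longrightarrow> l Xs = (\<lambda>x. 0)"
    and covector_Cinf: "X \<in> Sec E \<Longrightarrow> l [X] \<in> Cinf E"
    and covector_linear: "X \<in> Sec E \<Longrightarrow> Y \<in> Sec E \<Longrightarrow>
      l [\<lambda>x. r *\<^sub>R X x + s *\<^sub>R Y x] = (\<lambda>x. r * l [X] x + s * l [Y] x)"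
    and covector_fmult: "f \<in> Cinf E \<Longrightarrow> X \<in> Sec E \<Longrightarrow> l [fmult f X] = (\<lambda>x. f x * l [X] x)"
  using assms reduced_outside reduced_Cinf[of l 1 "[X]"]
    multilinearD[OF reduced_multilinear, of l 1 "[X]" 0 X Y r s]
    last_linearD[OF reduced_last_linear, of l 1 "[]" X f]
  by (auto simp: args_1)

lemma covector_add:
  "l \<in> reduced_ops E 1 \<Longrightarrow> X \<in> Sec E \<Longrightarrow> Y \<in> Sec E \<Longrightarrow>
    l [\<lambda>x. X x + Y x] = (\<lambda>x. l [X] x + l [Y] x)"
  using covector_linear[of l X Y 1 1] by simp

lemma covector_diff:
  "l \<in> reduced_ops E 1 \<Longrightarrow> X \<in> Sec E \<Longrightarrow> Y \<in> Sec E \<Longrightarrow>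
    l [\<lambda>x. X x - Y x] = (\<lambda>x. l [X] x - l [Y] x)"
  using covector_linear[of l X Y 1 "-1"] by simp

lemma covector_zero: "l \<in> reduced_ops E 1 \<Longrightarrow> l [\<lambda>x. 0] = (\<lambda>x. 0)"
  using covector_linear[OF _ Sec_zero Sec_zero, of l 0 0] by simp

lemma covector_sum:
  assumes l_covector: "l \<in> reduced_ops E 1" and "finite I" "\<And>i. i \<in> I \<Longrightarrow> X i \<in> Sec E"
  shows "l [\<lambda>x. \<Sum>i\<in>I. X i x] = (\<lambda>x. \<Sum>i\<in>I. l [X i] x)"
  using assms(2,3)
  by (induction I) (simp_all add: covector_zero[OF l_covector] covector_add[OF l_covector] Sec_sum)

lemma covector_combination:
  assumes "\<And>i. i \<in> I \<Longrightarrow> l i \<in> reduced_ops E 1" "\<And>i. i \<in> I \<Longrightarrow> f i \<in> Cinf E"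
  shows "(\<lambda>Xs x. \<Sum>i\<in>I. f i x * l i Xs x) \<in> reduced_ops E 1"
proof (rule covectorI)
  show "(\<lambda>x. \<Sum>i\<in>I. f i x * l i Xs x) = (\<lambda>x. 0)" if "Xs \<notin> args E 1" for Xs
    using assms(1) that by (simp add: covector_outside)
  show "(\<lambda>x. \<Sum>i\<in>I. f i x * l i [X] x) \<in> Cinf E" if "X \<in> Sec E" for X
    using assms that by (intro scalar_sum scalar_mult) (auto intro: covector_Cinf)
  show "(\<lambda>x. \<Sum>i\<in>I. f i x * l i [\<lambda>x. X x + Y x] x) =
      (\<lambda>x. (\<Sum>i\<in>I. f i x * l i [X] x) + (\<Sum>i\<in>I. f i x * l i [Y] x))"
    if "X \<in> Sec E" "Y \<in> Sec E" for X Y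
    using assms(1) that by (simp add: covector_add distrib_left sum.distrib)
  show "(\<lambda>x. \<Sum>i\<in>I. f i x * l i [fmult g X] x) = (\<lambda>x. g x * (\<Sum>i\<in>I. f i x * l i [X] x))"
    if "g \<in> Cinf E" "X \<in> Sec E" for g X
    using assms(1) that by (simp add: covector_fmult sum_distrib_left mult.left_commute)
qed

end

locale localized_triv = smooth_vector_bundle E
  for E :: "('m::{t2_space,second_countable_topology}, 'e::real_inner, 'v::real_vector, 'f::real_inner) vbundle" +
  fixes V and \<Phi> :: "'m \<Rightarrow> 'v \<Rightarrow> 'f" and \<beta> :: "'m \<Rightarrow> real" and K
  assumes triv: "(V, \<Phi>) \<in> trivs E"
    and bump_Cinf: "\<beta> \<in> Cinf E" and closed_K: "closed K" and K_subset: "K \<subseteq> V"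
    and bump_zero: "y \<notin> K \<Longrightarrow> \<beta> y = 0"
begin

definition local_section :: "'f \<Rightarrow> 'm \<Rightarrow> 'v" where
  "local_section w = (\<lambda>y. if y \<in> V then \<beta> y *\<^sub>R inv_into (fibre E y) (\<Phi> y) w else 0)"

definition local_covector :: "'f \<Rightarrow> ('m, 'v) cochain" where
  "local_covector w = (\<lambda>Xs y. if Xs \<in> args E 1 \<and> y \<in> V then \<beta> y * (\<Phi> y ((Xs ! 0) y) \<bullet> w) else 0)"

lemma triv_local_section: "y \<in> V \<Longrightarrow> \<Phi> y (local_section w y) = \<beta> y *\<^sub>R w"
  using triv_scale[OF triv, of y "inv_into (fibre E y) (\<Phi> y) w"]
  by (simp add: local_section_def triv_inv[OF triv])

lemma local_section_Sec: "local_section w \<in> Sec E"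
proof (rule SecI)
  show "local_section w y \<in> fibre E y" for y
    using triv_inv[OF triv]
    by (auto simp: local_section_def intro: subspace_scale subspace_0 fibre_subspace)
  fix U \<Psi> assume U_triv: "(U, \<Psi>) \<in> trivs E"
  show "smooth_map_on (charts E) U (\<lambda>y. \<Psi> y (local_section w y))"
  proof (rule smooth_map_on_extend_by_zero[OF triv_open[OF triv] closed_K K_subset
      triv_open[OF U_triv]])
    have "smooth_map_on (charts E) (U \<inter> V) (\<lambda>y. \<beta> y *\<^sub>R \<Psi> y (inv_into (fibre E y) (\<Phi> y) w))"
      using triv_transition[OF triv U_triv, of w]
      by (intro smooth_map_on_scaleR Cinf_smooth bump_Cinf) (simp add: Int_commute)
    then show "smooth_map_on (charts E) (U \<inter> V) (\<lambda>y. \<Psi> y (local_section w y))"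
      by (rule smooth_map_on_cong[OF open_Int[OF triv_open[OF U_triv] triv_open[OF triv]]])
        (simp add: local_section_def triv_scale[OF U_triv] triv_inv[OF triv])
  qed (simp add: local_section_def bump_zero triv_zero[OF U_triv])
qed

lemma local_covector_apply:
  "X \<in> Sec E \<Longrightarrow> local_covector w [X] y = (if y \<in> V then \<beta> y * (\<Phi> y (X y) \<bullet> w) else 0)"
  by (simp add: local_covector_def args_1)

lemma local_covector_covector: "local_covector w \<in> reduced_ops E 1"
proof (rule covectorI)
  show "local_covector w Xs = (\<lambda>x. 0)" if "Xs \<notin> args E 1" for Xs
    using that by (simp add: local_covector_def)
  show "local_covector w [X] \<in> Cinf E" if X_Sec: "X \<in> Sec E" for X
    unfolding Cinf_def
  proof (rule CollectI,
      rule smooth_map_on_extend_by_zero[OF triv_open[OF triv] closed_K K_subset open_UNIV])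
    have "smooth_map_on (charts E) V (\<lambda>y. \<beta> y * (\<Phi> y (X y) \<bullet> w))"
      by (intro smooth_map_on_mult smooth_map_on_inner Cinf_smooth bump_Cinf smooth_map_on_const
          Sec_smooth[OF X_Sec triv])
    then have "smooth_map_on (charts E) V (local_covector w [X])"
      by (rule smooth_map_on_cong[OF triv_open[OF triv]]) (simp add: local_covector_apply[OF X_Sec])
    then show "smooth_map_on (charts E) (UNIV \<inter> V) (local_covector w [X])" by simp
  qed (simp add: local_covector_apply[OF X_Sec] bump_zero)
  show "local_covector w [\<lambda>x. X x + Y x] = (\<lambda>x. local_covector w [X] x + local_covector w [Y] x)"
    if "X \<in> Sec E" "Y \<in> Sec E" for X Y
    using that
    by (auto simp: local_covector_apply Sec_add triv_add[OF triv] Sec_fibre inner_add_left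
        algebra_simps)
  show "local_covector w [fmult f X] = (\<lambda>x. f x * local_covector w [X] x)"
    if "f \<in> Cinf E" "X \<in> Sec E" for f X
    using that local_covector_apply[OF Sec_fmult[OF that]] local_covector_apply[OF that(2)]
    by (intro ext) (auto simp: fmult_def triv_scale[OF triv] Sec_fibre)
qed

lemma local_expansion:
  assumes basis: "finite I" "\<And>w::'f. w = (\<Sum>b\<in>I. (w \<bullet> b / (b \<bullet> b)) *\<^sub>R b)" and X_Sec: "X \<in> Sec E"
  shows "(\<beta> y * \<beta> y) *\<^sub>R X y = (\<Sum>b\<in>I. local_covector (b /\<^sub>R (b \<bullet> b)) [X] y *\<^sub>R local_section b y)"
    (is "?lhs = ?rhs")
proof (cases "y \<in> V")
  case True
  let ?coord = "\<lambda>b. \<Phi> y (X y) \<bullet> b / (b \<bullet> b)"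
  have fibre: "local_section b y \<in> fibre E y" for b by (rule Sec_fibre[OF local_section_Sec])
  show ?thesis
  proof (rule triv_eqI[OF triv True])
    show "?lhs \<in> fibre E y" "?rhs \<in> fibre E y"
      using fibre Sec_fibre[OF X_Sec] by (auto intro!: subspace_sum subspace_scale fibre_subspace)
    have "\<Phi> y ?rhs = (\<Sum>b\<in>I. (\<beta> y * ?coord b) *\<^sub>R \<beta> y *\<^sub>R b)"
      using True basis(1) fibre
      by (simp add: triv_sum[OF triv True] triv_local_section local_covector_apply[OF X_Sec]
          divide_inverse mult_ac)
    also have "\<dots> = (\<beta> y * \<beta> y) *\<^sub>R (\<Sum>b\<in>I. ?coord b *\<^sub>R b)"
      by (simp add: scaleR_sum_right mult_ac)
    also have "\<dots> = \<Phi> y ?lhs"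
      using basis(2)[of "\<Phi> y (X y)"] by (simp add: triv_scale[OF triv True] Sec_fibre[OF X_Sec])
    finally show "\<Phi> y ?lhs = \<Phi> y ?rhs" by simp
  qed
next
  case False
  then have "\<beta> y = 0" using bump_zero K_subset by blast
  then show ?thesis using False by (simp add: local_section_def)
qed

end

context smooth_vector_bundle
begin

lemma localized_triv_exists:
  obtains V \<Phi> \<beta> K where "localized_triv E V \<Phi> \<beta> K" "x \<in> V" "\<beta> x \<noteq> 0"
proof -
  obtain V \<Phi> where V_triv: "(V, \<Phi>) \<in> trivs E" "x \<in> V" by (rule triv_cover)
  obtain \<beta> :: "'m \<Rightarrow> real" and K where bump: "smooth_map_on (charts E) UNIV \<beta>" "\<beta> x \<noteq> 0"
    "closed K" "K \<subseteq> V" "\<And>y. y \<notin> K \<Longrightarrow> \<beta> y = 0"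
    by (rule bump_function[OF triv_open[OF V_triv(1)] V_triv(2)]) (rule that)
  have "localized_triv E V \<Phi> \<beta> K" by unfold_locales (simp_all add: V_triv bump Cinf_def)
  then show ?thesis using V_triv(2) bump(2) by (rule that)
qed

lemma nonvanishing_section:
  assumes "(w::'f) \<noteq> 0"
  obtains Y where "Y \<in> Sec E" "Y x \<noteq> 0"
proof -
  obtain V \<Phi> \<beta> K where "localized_triv E V \<Phi> \<beta> K" and local: "x \<in> V" "\<beta> x \<noteq> 0"
    by (rule localized_triv_exists)
  then interpret localized_triv E V \<Phi> \<beta> K by simp
  have "local_section w x \<noteq> 0"
    using triv_local_section[OF local(1), of w] triv_zero[OF triv local(1)] local(2) assms by auto
  then show ?thesis using that local_section_Sec by blast
qed

lemma dual_frame: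
  obtains g and I :: "'f set" and l e where "g \<in> Cinf E" "g x \<noteq> 0" "finite I"
    "\<And>b. l b \<in> reduced_ops E 1" "\<And>b. e b \<in> Sec E"
    "\<And>X. X \<in> Sec E \<Longrightarrow> fmult g X = (\<lambda>y. \<Sum>b\<in>I. fmult (l b [X]) (e b) y)"
proof -
  obtain V \<Phi> \<beta> K where "localized_triv E V \<Phi> \<beta> K" and bump_nonzero: "\<beta> x \<noteq> 0"
    by (rule localized_triv_exists)
  then interpret localized_triv E V \<Phi> \<beta> K by simp
  obtain I :: "'f set" where basis: "finite I" "\<And>w. w = (\<Sum>b\<in>I. (w \<bullet> b / (b \<bullet> b)) *\<^sub>R b)"
    by (rule finite_dim_orthogonal_basis[OF typical_fibre_finite_dim]) (rule that)
  show ?thesis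
  proof (rule that[of "\<lambda>y. \<beta> y * \<beta> y" I "\<lambda>b. local_covector (b /\<^sub>R (b \<bullet> b))" local_section])
    show "fmult (\<lambda>y. \<beta> y * \<beta> y) X
        = (\<lambda>y. \<Sum>b\<in>I. fmult (local_covector (b /\<^sub>R (b \<bullet> b)) [X]) (local_section b) y)"
      if "X \<in> Sec E" for X
      unfolding fmult_def using local_expansion[OF basis that] by blast
  qed (simp_all add: bump_nonzero basis(1) scalar_mult bump_Cinf local_covector_covector
    local_section_Sec)
qed

lemma covectors_separate_at:
  assumes W_Sec: "W \<in> Sec E" "\<And>l. l \<in> reduced_ops E 1 \<Longrightarrow> l [W] y = 0"
  shows "W y = 0"
proof -
  obtain g and I :: "'f set" and l e where frame: "g y \<noteq> 0" "\<And>b. l b \<in> reduced_ops E 1"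
    "\<And>X. X \<in> Sec E \<Longrightarrow> fmult g X = (\<lambda>y. \<Sum>b\<in>I. fmult (l b [X]) (e b) y)"
    by (rule dual_frame[of y]) (rule that)
  have "g y *\<^sub>R W y = 0"
    using fun_cong[OF frame(3)[OF W_Sec(1)], of y] W_Sec(2)[OF frame(2)] by (simp add: fmult_def)
  then show ?thesis using frame(1) by simp
qed

lemma Sec_eqI:
  assumes "X \<in> Sec E" "Y \<in> Sec E" "\<And>l. l \<in> reduced_ops E 1 \<Longrightarrow> l [X] = l [Y]"
  shows "X = Y"
proof
  fix x
  have "(\<lambda>x. X x - Y x) x = 0"
    using assms by (intro covectors_separate_at Sec_diff) (simp_all add: covector_diff)
  then show "X x = Y x" by simp
qed

lemma derived_bracketI:
  assumes "X \<in> Sec E" "Y \<in> Sec E" "Z \<in> Sec E"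
    and "\<And>l. l \<in> reduced_ops E 1 \<Longrightarrow>
      l [Z] = (\<lambda>x. d (fn (l [Y])) [X] x - d (fn (l [X])) [Y] x - d l [X, Y] x)"
  shows "derived_bracket E d X Y = Z"
proof -
  let ?paired = "\<lambda>Z. Z \<in> Sec E \<and> (\<forall>l\<in>reduced_ops E 1.
      l [Z] = (\<lambda>x. d (fn (l [Y])) [X] x - d (fn (l [X])) [Y] x - d l [X, Y] x))"
  have "W = Z" if "?paired W" for W
    using that assms(4) by (intro Sec_eqI assms(3)) simp_all
  then have "(THE Z. ?paired Z) = Z" using assms(3,4) by (intro the_equality) simp_all
  then show ?thesis using assms(1,2) by (simp add: derived_bracket_def)
qed

definition bidual :: "(('m, 'v) cochain \<Rightarrow> 'm \<Rightarrow> real) set" where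
  "bidual = {T. (\<forall>l\<in>reduced_ops E 1. T l \<in> Cinf E) \<and>
    (\<forall>l\<in>reduced_ops E 1. \<forall>l'\<in>reduced_ops E 1.
       T (\<lambda>Xs x. l Xs x + l' Xs x) = (\<lambda>x. T l x + T l' x)) \<and>
    (\<forall>f\<in>Cinf E. \<forall>l\<in>reduced_ops E 1. T (\<lambda>Xs x. f x * l Xs x) = (\<lambda>x. f x * T l x))}"

lemma
  assumes "T \<in> bidual"
  shows bidual_Cinf: "l \<in> reduced_ops E 1 \<Longrightarrow> T l \<in> Cinf E"
    and bidual_add: "l \<in> reduced_ops E 1 \<Longrightarrow> l' \<in> reduced_ops E 1 \<Longrightarrow>
      T (\<lambda>Xs x. l Xs x + l' Xs x) = (\<lambda>x. T l x + T l' x)"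
    and bidual_mult: "f \<in> Cinf E \<Longrightarrow> l \<in> reduced_ops E 1 \<Longrightarrow>
      T (\<lambda>Xs x. f x * l Xs x) = (\<lambda>x. f x * T l x)"
  using assms unfolding bidual_def by blast+

lemma bidual_combination:
  assumes T_bidual: "T \<in> bidual" and "finite I"
    and "\<And>i. i \<in> I \<Longrightarrow> l i \<in> reduced_ops E 1" "\<And>i. i \<in> I \<Longrightarrow> f i \<in> Cinf E"
  shows "T (\<lambda>Xs x. \<Sum>i\<in>I. f i x * l i Xs x) = (\<lambda>x. \<Sum>i\<in>I. f i x * T (l i) x)"
  using assms(2-)
proof (induction I)
  case empty
  from bidual_mult[OF T_bidual scalar_const[of 0] reduced_zero] show ?case by simp
next
  case (insert i I)
  have "(\<lambda>Xs x. \<Sum>i\<in>I. f i x * l i Xs x) \<in> reduced_ops E 1"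
    using insert by (intro covector_combination) auto
  moreover have "(\<lambda>Xs x. f i x * l i Xs x) \<in> reduced_ops E 1"
    using covector_combination[of "{i}" l f] insert by simp
  ultimately show ?case using insert by (simp add: bidual_add[OF T_bidual] bidual_mult[OF T_bidual])
qed

lemma bidual_locally_represented:
  assumes T_bidual: "T \<in> bidual"
  obtains g W where "g \<in> Cinf E" "g x \<noteq> 0" "W \<in> Sec E"
    "\<And>k. k \<in> reduced_ops E 1 \<Longrightarrow> k [W] = (\<lambda>y. g y * T k y)"
proof -
  obtain g and I :: "'f set" and l e where frame: "g \<in> Cinf E" "g x \<noteq> 0" "finite I"
    "\<And>b. l b \<in> reduced_ops E 1" "\<And>b. e b \<in> Sec E"
    "\<And>X. X \<in> Sec E \<Longrightarrow> fmult g X = (\<lambda>y. \<Sum>b\<in>I. fmult (l b [X]) (e b) y)"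
    by (rule dual_frame[of x]) (rule that)
  define W where "W = (\<lambda>y. \<Sum>b\<in>I. fmult (T (l b)) (e b) y)"
  have "k [W] = (\<lambda>y. g y * T k y)" if k_covector: "k \<in> reduced_ops E 1" for k
  proof -
    have "(\<lambda>x. g x * k Xs x) = (\<lambda>x. \<Sum>b\<in>I. k [e b] x * l b Xs x)" for Xs
    proof (cases "Xs \<in> args E 1")
      case True
      then obtain X where X_Sec: "X \<in> Sec E" "Xs = [X]" by (auto simp: args_1)
      have "(\<lambda>x. g x * k [X] x) = k [fmult g X]"
        using covector_fmult[OF k_covector frame(1) X_Sec(1)] by (rule sym)
      also have "\<dots> = (\<lambda>x. \<Sum>b\<in>I. k [fmult (l b [X]) (e b)] x)"
        unfolding frame(6)[OF X_Sec(1)]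
        by (rule covector_sum[OF k_covector frame(3)]) (intro Sec_fmult covector_Cinf frame X_Sec)
      finally show ?thesis
        using frame(4,5) X_Sec
        by (simp add: covector_fmult[OF k_covector] covector_Cinf mult.commute)
    next
      case False
      then show ?thesis by (simp add: covector_outside[OF k_covector] covector_outside[OF frame(4)])
    qed
    then have "T (\<lambda>Xs x. g x * k Xs x) = T (\<lambda>Xs x. \<Sum>b\<in>I. k [e b] x * l b Xs x)" by simp
    then have "(\<lambda>x. g x * T k x) = (\<lambda>x. \<Sum>b\<in>I. k [e b] x * T (l b) x)"
      using frame k_covector
      by (simp add: bidual_mult[OF T_bidual] bidual_combination[OF T_bidual] covector_Cinf)
    also have "\<dots> = k [W]"
      unfolding W_def using frame(3,4,5) k_covector
      by (subst covector_sum)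
        (auto simp: Sec_fmult bidual_Cinf[OF T_bidual] covector_fmult mult.commute)
    finally show ?thesis by (rule sym)
  qed
  moreover have "W \<in> Sec E"
    unfolding W_def by (intro Sec_sum Sec_fmult bidual_Cinf[OF T_bidual] frame)
  ultimately show ?thesis using that frame(1,2) by blast
qed

lemma Sec_reflexive:
  assumes T_bidual: "T \<in> bidual"
  obtains Z where "Z \<in> Sec E" "\<And>l. l \<in> reduced_ops E 1 \<Longrightarrow> l [Z] = T l"
proof -
  have "\<exists>g W. g \<in> Cinf E \<and> g x \<noteq> 0 \<and> W \<in> Sec E \<and>
      (\<forall>k\<in>reduced_ops E 1. k [W] = (\<lambda>y. g y * T k y))" for x
    using bidual_locally_represented[OF T_bidual, of x] by metis
  then obtain g W where local: "\<And>x. g x \<in> Cinf E" "\<And>x. g x x \<noteq> 0" "\<And>x. W x \<in> Sec E"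
    "\<And>x l. l \<in> reduced_ops E 1 \<Longrightarrow> l [W x] = (\<lambda>y. g x y * T l y)"
    by metis
  define Z where "Z y = W y y /\<^sub>R g y y" for y
  have glued: "fmult (g x) Z = W x" for x
  proof
    fix y
    define D where "D = (\<lambda>z. g y y *\<^sub>R W x z + (- g x y) *\<^sub>R W y z)"
    have "D y = 0"
      unfolding D_def
      by (rule covectors_separate_at[OF Sec_linear]) (simp_all only: covector_linear local, simp)
    then have "g x y *\<^sub>R W y y = g y y *\<^sub>R W x y" by (simp add: D_def)
    then show "fmult (g x) Z y = W x y"
      using local(2)[of y]
      by (simp add: fmult_def Z_def) (metis scaleR_one scaleR_scaleR left_inverse mult.commute)
  qed
  have Z_Sec: "Z \<in> Sec E" by (rule Sec_glue) (metis local(1-3) glued)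
  have "l [Z] = T l" if l_covector: "l \<in> reduced_ops E 1" for l
  proof
    fix x
    have "g x x * l [Z] x = g x x * T l x"
      using covector_fmult[OF l_covector local(1) Z_Sec] local(4)[OF l_covector, of x]
      unfolding glued by metis
    then show "l [Z] x = T l x" using local(2) by simp
  qed
  then show ?thesis using that Z_Sec by blast
qed

end

section \<open>The Loday differential\<close>

locale anchored_bundle = smooth_vector_bundle E + anchored_module "Sec E" "Cinf E" \<rho>
  for E :: "('m::{t2_space,second_countable_topology}, 'e::real_inner, 'v::real_vector, 'f::real_inner) vbundle"
    and \<rho> +
  assumes anchor_fmult: "X \<in> Sec E \<Longrightarrow> f \<in> Cinf E \<Longrightarrow> g \<in> Cinf E \<Longrightarrow>
      \<rho> (fmult f X) g = (\<lambda>x. f x * \<rho> X g x)"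
    and anchor_linear_left: "X \<in> Sec E \<Longrightarrow> Y \<in> Sec E \<Longrightarrow> g \<in> Cinf E \<Longrightarrow>
      \<rho> (\<lambda>x. r *\<^sub>R X x + s *\<^sub>R Y x) g = (\<lambda>x. r * \<rho> X g x + s * \<rho> Y g x)"
begin

definition anchor_term :: "('m, 'v) cochain \<Rightarrow> ('m, 'v) cochain" where
  "anchor_term c = (\<lambda>Xs. \<rho> (hd Xs) (c (tl Xs)))"

lemma anchor_term_Cons [simp]: "anchor_term c (X # Ys) = \<rho> X (c Ys)"
  by (simp add: anchor_term_def)

lemma multilinear_anchor_term:
  assumes c_multilinear: "multilinear E p c" "\<And>Ys. Ys \<in> args E p \<Longrightarrow> c Ys \<in> Cinf E"
  shows "multilinear E (Suc p) (anchor_term c)"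
proof (rule multilinear_SucI)
  show "anchor_term c ((\<lambda>x. r *\<^sub>R X x + s *\<^sub>R Y x) # Ys)
      = (\<lambda>x. r *\<^sub>R anchor_term c (X # Ys) x + s *\<^sub>R anchor_term c (Y # Ys) x)"
    if "X \<in> Sec E" "Y \<in> Sec E" "Ys \<in> args E p" for X Y Ys r s
    using that by (simp add: anchor_linear_left c_multilinear(2))
  show "multilinear E p (\<lambda>Ys. anchor_term c (X # Ys))" if X_Sec: "X \<in> Sec E" for X
  proof (rule multilinearI)
    fix Ys i Y Z and r s :: real
    assume Ys_args: "Ys \<in> args E p" "i < p" and YZ_Sec: "Y \<in> Sec E" "Z \<in> Sec E"
    show "anchor_term c (X # Ys[i := (\<lambda>x. r *\<^sub>R Y x + s *\<^sub>R Z x)])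
        = (\<lambda>x. r *\<^sub>R anchor_term c (X # Ys[i := Y]) x + s *\<^sub>R anchor_term c (X # Ys[i := Z]) x)"
      using multilinearD[OF c_multilinear(1) Ys_args YZ_Sec]
        anchor_linear[OF X_Sec c_multilinear(2)[OF args_update[OF Ys_args(1) YZ_Sec(1)]]
            c_multilinear(2)[OF args_update[OF Ys_args(1) YZ_Sec(2)]]]
      by simp
  qed
qed

lemma \<delta>_anchor_term:
  assumes "X \<in> Sec E" "Ys \<in> args E p" "f \<in> Cinf E"
    and c_Cinf: "\<And>Ys. Ys \<in> args E p \<Longrightarrow> c Ys \<in> Cinf E"
  shows "\<delta> 0 f (anchor_term c) (X # Ys) = (\<lambda>x. 0)"
    and "i < p \<Longrightarrow> \<delta> (Suc i) f (anchor_term c) (X # Ys)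
      = (\<lambda>x. anchor_term (\<delta> i f c) (X # Ys) x + outer 1 (\<lambda>Xs. \<rho> (hd Xs) f) c (X # Ys) x)"
proof -
  show "\<delta> 0 f (anchor_term c) (X # Ys) = (\<lambda>x. 0)"
    using assms by (simp add: \<delta>_def anchor_fmult)
  assume "i < p"
  then have "c (Ys[i := fmult f (Ys ! i)]) \<in> Cinf E" by (intro c_Cinf args_fmult assms)
  then show "\<delta> (Suc i) f (anchor_term c) (X # Ys)
      = (\<lambda>x. anchor_term (\<delta> i f c) (X # Ys) x + outer 1 (\<lambda>Xs. \<rho> (hd Xs) f) c (X # Ys) x)"
    using assms
    by (simp add: \<delta>_def outer_def One_nat_def anchor_diff scalar_mult anchor_mult fun_eq_iff)
qed

lemma total_order_less_anchor_term:
  assumes "total_order_less E p n c" "\<And>Ys. Ys \<in> args E p \<Longrightarrow> c Ys \<in> Cinf E"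
  shows "total_order_less E (Suc p) (Suc n) (anchor_term c)"
  using assms
proof (induction n arbitrary: c)
  case 0
  then show ?case
    by (intro total_order_less_zero) (auto simp: anchor_zero elim!: args_SucE)
next
  case (Suc n)
  have "total_order_less E (Suc p) (Suc n) (\<delta> i f (anchor_term c))"
    if i_less: "i < Suc p" and f_Cinf: "f \<in> Cinf E" for i f
  proof (cases i)
    case 0
    then show ?thesis
      by (intro total_order_less_zero)
        (auto simp: \<delta>_anchor_term(1) f_Cinf Suc.prems elim!: args_SucE)
  next
    case (Suc j)
    then have j_less: "j < p" using i_less by simp
    have "total_order_less E (Suc p) (Suc n) (anchor_term (\<delta> j f c))"
      using Suc.prems j_less f_Cinf by (intro Suc.IH \<delta>_Cinf) auto
    moreover have "total_order_less E 1 1 (\<lambda>Xs. \<rho> (hd Xs) f)"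
      using f_Cinf by (simp add: One_nat_def) (auto simp: \<delta>_def anchor_fmult elim!: args_SucE)
    then have "total_order_less E (Suc p) (Suc n) (outer 1 (\<lambda>Xs. \<rho> (hd Xs) f) c)"
      using total_order_less_outer[OF _ Suc.prems(1), of 1 1 _ "Suc n"]
      by (simp only: plus_1_eq_Suc)
    ultimately have "total_order_less E (Suc p) (Suc n)
        (\<lambda>Xs x. anchor_term (\<delta> j f c) Xs x + outer 1 (\<lambda>Xs. \<rho> (hd Xs) f) c Xs x)"
      by (rule total_order_less_add)
    then show ?thesis
      unfolding Suc
      by (rule total_order_less_cong)
        (auto simp: \<delta>_anchor_term(2) f_Cinf j_less Suc.prems elim!: args_SucE)
  qed
  then show ?case by simp
qed

lemma multidiff_less_anchor_term:
  assumes "multidiff_less p n c" "\<And>Ys. Ys \<in> args E p \<Longrightarrow> c Ys \<in> Cinf E"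
  shows "multidiff_less (Suc p) (Suc n) (anchor_term c)"
  using assms multilinear_anchor_term total_order_less_anchor_term
  unfolding multidiff_less_def by blast

end

locale loday_structure = anchored_bundle E \<rho> + cartan_calculus "Sec E" "Cinf E" \<rho> B
  for E :: "('m::{t2_space,second_countable_topology}, 'e::real_inner, 'v::real_vector, 'f::real_inner) vbundle"
    and \<rho> B +
  assumes bracket_fmult: "X \<in> Sec E \<Longrightarrow> Y \<in> Sec E \<Longrightarrow> f \<in> Cinf E \<Longrightarrow>
      B X (fmult f Y) = (\<lambda>x. f x *\<^sub>R B X Y x + \<rho> X f x *\<^sub>R Y x)"
    and bracket_multidiff: "multidiff_less 2 2 (binary_op B)"
    and bracket_outside: "\<not> (X \<in> Sec E \<and> Y \<in> Sec E) \<Longrightarrow> B X Y = (\<lambda>x. 0)"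
begin

definition Lie_tail :: "nat \<Rightarrow> nat \<Rightarrow> ('m, 'v) cochain \<Rightarrow> ('m, 'v) cochain" where
  "Lie_tail p i c = (\<lambda>Xs x. anchor_term c Xs x - (\<Sum>j=i..<p. partial_comp j c (binary_op B) Xs x))"

lemma Lie_tail_Cons:
  assumes "length Ys = p"
  shows "Lie_tail p i c (X # Ys) y = Lie X (\<lambda>Zs. c (take i Ys @ Zs)) (drop i Ys) y"
proof -
  have "Ys[i + j := B X (Ys ! (i + j))] = take i Ys @ (drop i Ys)[j := B X (drop i Ys ! j)]"
    if "i + j < p" for j
  proof -
    have "take i Ys @ (drop i Ys)[j := B X (drop i Ys ! j)]
        = (take i Ys @ drop i Ys)[i + j := B X (Ys ! (i + j))]"
      using that assms by (simp only: list_update_append) simp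
    then show ?thesis by simp
  qed
  then have "(\<Sum>j=i..<p. partial_comp j c (binary_op B) (X # Ys) y)
      = (\<Sum>j<p - i. c (take i Ys @ (drop i Ys)[j := B X (drop i Ys ! j)]) y)"
    unfolding partial_comp_Cons sum.atLeastLessThan_shift_0[of _ i] atLeast0LessThan
    by (intro sum.cong) auto
  then show ?thesis using assms by (simp add: Lie_tail_def Lie_def)
qed

lemma differential_eq_sum_Lie_tail:
  assumes "length Xs = Suc p"
  shows "\<partial> c Xs
      = (\<lambda>y. \<Sum>i<Suc p. (- 1) ^ i *\<^sub>R Lie_tail p i c (permute_list (inv (front_cycle i)) Xs) y)"
  unfolding differential_eq_sum assms
  by (intro ext sum.cong)
    (auto simp: assms permute_list_inv_front_cycle Lie_tail_Cons simp del: lessThan_Suc)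

lemma bracket_pair_closed: "Ys \<in> args E 2 \<Longrightarrow> binary_op B Ys \<in> Sec E"
  by (auto simp: bracket_closed elim!: args_2E)

lemma multidiff_less_Lie_tail:
  assumes c_multidiff: "multidiff_less p n c" "\<And>Ys. Ys \<in> args E p \<Longrightarrow> c Ys \<in> Cinf E"
  shows "multidiff_less (Suc p) (Suc n) (Lie_tail p i c)"
proof -
  have "multidiff_less (Suc p) (Suc n) (\<lambda>Xs x. \<Sum>j=i..<p. partial_comp j c (binary_op B) Xs x)"
    using bracket_pair_closed
    by (intro multidiff_less_sum
        multidiff_less_partial_comp[OF _ c_multidiff(1) _ bracket_multidiff]) auto
  from multidiff_less_linear[OF multidiff_less_anchor_term[OF c_multidiff] this, of 1 "-1"]
  show ?thesis by (simp add: Lie_tail_def)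
qed

lemma multidiff_less_differential:
  assumes c_multidiff: "multidiff_less p n c" "\<And>Ys. Ys \<in> args E p \<Longrightarrow> c Ys \<in> Cinf E"
  shows "multidiff_less (Suc p) (Suc n) (\<partial> c)"
proof (rule multidiff_less_cong)
  show "multidiff_less (Suc p) (Suc n)
      (\<lambda>Xs y. \<Sum>i<Suc p. (- 1) ^ i *\<^sub>R Lie_tail p i c (permute_list (inv (front_cycle i)) Xs) y)"
    by (intro multidiff_less_sum multidiff_less_scale multidiff_less_permute_list permutes_inv
        front_cycle_permutes multidiff_less_Lie_tail c_multidiff) simp
qed (simp add: differential_eq_sum_Lie_tail args_length)

lemma Lie_snoc:
  "Lie X c (Xs @ [W]) x = \<rho> X (c (Xs @ [W])) x
    - (\<Sum>j<length Xs. c (Xs[j := B X (Xs ! j)] @ [W]) x) - c (Xs @ [B X W]) x"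
  unfolding Lie_def by (simp add: list_update_append nth_append)

text \<open>The terms with the derivative \<open>\<rho> X f\<close> of \<open>f\<close>, which would spoil order 0 in the last
  argument, come from the anchor and from the last bracket, and cancel.\<close>

lemma last_linear_Lie:
  assumes cochain: "last_linear c" "slotwise_additive c" "scalar_valued c" and X_Sec: "X \<in> Sec E"
  shows "last_linear (Lie X c)"
  unfolding last_linear_def
proof (intro allI impI ext)
  fix Xs Y f x assume Xs_Sec: "set Xs \<subseteq> Sec E" and Y_Sec: "Y \<in> Sec E" and f_Cinf: "f \<in> Cinf E"
  have derivative:
      "\<rho> X (c (Xs @ [fmult f Y])) x = \<rho> X f x * c (Xs @ [Y]) x + f x * \<rho> X (c (Xs @ [Y])) x"
    using last_linearD[OF cochain(1) Xs_Sec Y_Sec f_Cinf]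
      anchor_mult[OF X_Sec f_Cinf scalar_valuedD[OF cochain(3)]] Xs_Sec Y_Sec by simp
  have "B X (fmult f Y) = (\<lambda>x. fmult f (B X Y) x + fmult (\<rho> X f) Y x)"
    unfolding bracket_fmult[OF X_Sec Y_Sec f_Cinf] by (simp add: fmult_def)
  then have "c (Xs @ [B X (fmult f Y)])
      = (\<lambda>x. c (Xs @ [fmult f (B X Y)]) x + c (Xs @ [fmult (\<rho> X f) Y]) x)"
    using slotwise_additiveD[OF cochain(2) Xs_Sec, of "[]" "fmult f (B X Y)" "fmult (\<rho> X f) Y"]
      X_Sec Y_Sec f_Cinf
    by (simp add: Sec_fmult bracket_closed anchor_closed)
  then have bracket:
      "c (Xs @ [B X (fmult f Y)]) x = f x * c (Xs @ [B X Y]) x + \<rho> X f x * c (Xs @ [Y]) x"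
    using last_linearD[OF cochain(1) Xs_Sec] X_Sec Y_Sec f_Cinf
    by (simp add: bracket_closed anchor_closed)
  have "c (Xs[j := B X (Xs ! j)] @ [fmult f Y]) x = f x * c (Xs[j := B X (Xs ! j)] @ [Y]) x"
    if "j < length Xs" for j
  proof -
    have "set (Xs[j := B X (Xs ! j)]) \<subseteq> Sec E"
      using that Xs_Sec X_Sec by (intro set_update_subset bracket_closed) auto
    then show ?thesis using last_linearD[OF cochain(1) _ Y_Sec f_Cinf] by simp
  qed
  then show "Lie X c (Xs @ [fmult f Y]) x = f x * Lie X c (Xs @ [Y]) x"
    unfolding Lie_snoc derivative bracket by (simp add: sum_distrib_left algebra_simps)
qed

lemma last_linear_differential:
  assumes "last_linear c" "slotwise_additive c" "scalar_valued c"
  shows "last_linear (\<partial> c)"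
proof -
  have "\<partial> c (Xs @ [fmult f Y]) x = f x * \<partial> c (Xs @ [Y]) x"
    if "last_linear c" "slotwise_additive c" "scalar_valued c"
      and "set Xs \<subseteq> Sec E" "Y \<in> Sec E" "f \<in> Cinf E" for c Xs Y f x
    using that
  proof (induction Xs arbitrary: c)
    case Nil
    then show ?case using scalar_valuedD[of c "[]"] by (simp add: Lie_def anchor_fmult)
  next
    case (Cons X Xs)
    then have "\<partial> (\<iota> X c) (Xs @ [fmult f Y]) x = f x * \<partial> (\<iota> X c) (Xs @ [Y]) x"
      by (intro Cons.IH last_linear_contraction slotwise_additive_contraction
          scalar_valued_contraction) auto
    moreover have "Lie X c (Xs @ [fmult f Y]) x = f x * Lie X c (Xs @ [Y]) x"
      using Cons.prems last_linearD[OF last_linear_Lie, of c X Xs Y f] by simp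
    ultimately show ?case by (simp add: right_diff_distrib)
  qed
  then show ?thesis
    using assms unfolding last_linear_def[of "\<partial> c"] by (simp add: fun_eq_iff)
qed

definition loday_field :: "('m, 'v) cochain \<Rightarrow> ('m, 'v) cochain" where
  "loday_field c = (if c \<in> reduced_shuffle E
     then (\<lambda>Xs. if set Xs \<subseteq> Sec E then \<partial> c Xs else (\<lambda>x. 0)) else undefined)"

lemma loday_field_eq:
  "c \<in> reduced_shuffle E \<Longrightarrow> loday_field c Xs = (if set Xs \<subseteq> Sec E then \<partial> c Xs else (\<lambda>x. 0))"
  by (simp add: loday_field_def)

lemma loday_field_reduced:
  assumes c_reduced: "c \<in> reduced_ops E k"
  shows "loday_field c \<in> reduced_ops E (Suc k)"
proof -
  note rs = reduced_ops_subset[OF c_reduced]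
  note valued = reduced_shuffle_scalar_valued[OF rs]
  have "loday_field c Xs = (\<lambda>x. 0)" if "Xs \<notin> args E (Suc k)" for Xs
    using that differential_component[of Xs k c] component_reduced[OF c_reduced, of k]
    by (auto simp: loday_field_eq[OF rs] args_def)
  moreover have "loday_field c Xs \<in> Cinf E" if "Xs \<in> args E (Suc k)" for Xs
    using that scalar_valuedD[OF scalar_valued_differential[OF valued]]
    by (simp add: loday_field_eq[OF rs] args_def)
  moreover have last: "last_linear (loday_field c)"
    using last_linear_differential[OF reduced_last_linear[OF c_reduced]
        reduced_shuffle_slotwise_additive[OF rs] valued]
    unfolding last_linear_def by (simp add: loday_field_eq[OF rs] Sec_fmult)
  moreover have "multidiff_less (Suc k) (Suc k) (loday_field c)"
  proof -
    have "multidiff_less (Suc k) (Suc (max 1 k)) (\<partial> c)"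
      using reduced_multidiff[OF c_reduced] reduced_Cinf[OF c_reduced]
      by (intro multidiff_less_differential) (auto simp: args_def)
    then have less: "multidiff_less (Suc k) (Suc (max 1 k)) (loday_field c)"
      by (rule multidiff_less_cong) (simp add: loday_field_eq[OF rs] args_def)
    show ?thesis
    proof (cases k)
      case 0
      have "total_order_less E 1 1 (loday_field c)"
        using last_linearD[OF last, of "[]"]
        by (auto simp: One_nat_def \<delta>_def elim!: args_SucE)
      then show ?thesis using less 0 by (simp add: multidiff_less_def One_nat_def)
    next
      case (Suc j)
      then show ?thesis using less by (simp add: One_nat_def)
    qed
  qed
  ultimately show ?thesis unfolding reduced_ops_iff by (simp add: One_nat_def)
qed

lemma component_loday_field:
  assumes c_reduced: "c \<in> reduced_shuffle E"
  shows "component 0 (loday_field c) = (\<lambda>Xs x. 0)"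
    and "component (Suc p) (loday_field c) = loday_field (component p c)"
proof -
  have component: "component p c \<in> reduced_shuffle E"
    by (rule reduced_ops_subset[OF component_in_reduced_ops[OF c_reduced]])
  show "component 0 (loday_field c) = (\<lambda>Xs x. 0)"
    by (auto simp: component_def loday_field_eq[OF c_reduced] fun_eq_iff)
  show "component (Suc p) (loday_field c) = loday_field (component p c)"
    by (rule ext) (simp add: component_def[of "Suc p"] loday_field_eq c_reduced component
        differential_component)
qed

lemma loday_field_linear:
  assumes "a \<in> reduced_shuffle E" "b \<in> reduced_shuffle E"
  shows "loday_field (\<lambda>Xs x. r * a Xs x + s * b Xs x)
    = (\<lambda>Xs x. r * loday_field a Xs x + s * loday_field b Xs x)"
  using assms reduced_shuffle_linear[OF assms, of r s]
    differential_linear[OF assms[THEN reduced_shuffle_scalar_valued]]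
  by (auto simp: loday_field_eq fun_eq_iff)

lemma loday_field_zero: "loday_field (\<lambda>Xs x. 0) = (\<lambda>Xs x. 0)"
  using loday_field_linear[OF reduced_ops_subset[OF reduced_zero]
      reduced_ops_subset[OF reduced_zero],
      of 0 0] by simp

lemma loday_field_reduced_shuffle:
  assumes c_reduced: "c \<in> reduced_shuffle E"
  shows "loday_field c \<in> reduced_shuffle E"
proof -
  have "component p (loday_field c) \<in> reduced_ops E p" for p
    using component_loday_field[OF c_reduced]
      loday_field_reduced[OF component_in_reduced_ops[OF c_reduced]] reduced_zero
    by (cases p) auto
  moreover obtain N where "\<forall>p\<ge>N. component p c = (\<lambda>Xs x. 0)"
    using c_reduced unfolding reduced_shuffle_iff by blast
  then have "component p (loday_field c) = (\<lambda>Xs x. 0)" if "p \<ge> Suc N" for p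
    using that component_loday_field(2)[OF c_reduced] loday_field_zero by (cases p) auto
  ultimately show ?thesis unfolding reduced_shuffle_iff by blast
qed

lemma loday_field_derivation:
  assumes a_reduced: "a \<in> reduced_ops E p" and b_reduced: "b \<in> reduced_shuffle E"
  shows "loday_field (a \<pitchfork> b)
    = (\<lambda>Xs x. (loday_field a \<pitchfork> b) Xs x + (- 1) ^ p * (a \<pitchfork> loday_field b) Xs x)"
proof (intro ext)
  fix Xs x
  note a_rs = reduced_ops_subset[OF a_reduced]
    and ab_rs = shuffle_reduced_shuffle[OF a_reduced b_reduced]
  have "\<epsilon> a Ys y = (- 1) ^ p * a Ys y" for Ys y
    using reduced_length[OF a_reduced, of Ys]
    by (cases "length Ys = p") (simp_all add: grade_involution_def)
  then have involution: "\<epsilon> a = (\<lambda>Ys y. (- 1) ^ p * a Ys y)" by (intro ext)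
  show "loday_field (a \<pitchfork> b) Xs x = (loday_field a \<pitchfork> b) Xs x + (- 1) ^ p * (a \<pitchfork> loday_field b) Xs x"
  proof (cases "set Xs \<subseteq> Sec E")
    case True
    have "(loday_field a \<pitchfork> b) Xs = (\<partial> a \<pitchfork> b) Xs" "(a \<pitchfork> loday_field b) Xs = (a \<pitchfork> \<partial> b) Xs"
      by (rule shuffle_cong[OF _ _ True]; simp add: loday_field_eq a_rs b_reduced)+
    then show ?thesis
      using differential_shuffle[OF reduced_shuffle_scalar_valued[OF a_rs]
          reduced_shuffle_scalar_valued[OF b_reduced] True, of x] True
      by (simp add: loday_field_eq[OF ab_rs] involution shuffle_scale_left)
  next
    case False
    have "(loday_field a \<pitchfork> b) Xs x = 0" "(a \<pitchfork> loday_field b) Xs x = 0"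
      by (rule shuffle_supported[OF _ _ False];
          simp add: reduced_shuffle_outside a_rs b_reduced loday_field_reduced_shuffle)+
    then show ?thesis using False by (simp add: loday_field_eq[OF ab_rs])
  qed
qed

lemma loday_field_square:
  assumes c_reduced: "c \<in> reduced_shuffle E"
  shows "loday_field (loday_field c) = (\<lambda>Xs x. 0)"
proof (intro ext)
  fix Xs x
  show "loday_field (loday_field c) Xs x = 0"
  proof (cases "set Xs \<subseteq> Sec E")
    case True
    have "\<partial> (loday_field c) Xs = \<partial> (\<partial> c) Xs"
      by (rule differential_cong[OF _ True]) (simp add: loday_field_eq c_reduced)
    then show ?thesis
      using differential_differential[OF reduced_shuffle_scalar_valued[OF c_reduced]
          reduced_shuffle_slotwise_additive[OF c_reduced] True] True
      by (simp add: loday_field_eq loday_field_reduced_shuffle[OF c_reduced])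
  next
    case False
    then show ?thesis by (simp add: loday_field_eq loday_field_reduced_shuffle[OF c_reduced])
  qed
qed

lemma loday_field_graded_derivation: "loday_field \<in> graded_derivations E"
  unfolding graded_derivations_def
proof (intro CollectI conjI allI ballI)
  show "loday_field \<in> extensional (reduced_shuffle E)"
    by (simp add: extensional_def loday_field_def)
  show "loday_field (\<lambda>Xs x. a Xs x + b Xs x) = (\<lambda>Xs x. loday_field a Xs x + loday_field b Xs x)"
    if "a \<in> reduced_shuffle E" "b \<in> reduced_shuffle E" for a b
    using loday_field_linear[OF that, of 1 1] by simp
  show "loday_field (\<lambda>Xs x. r * a Xs x) = (\<lambda>Xs x. r * loday_field a Xs x)"
    if "a \<in> reduced_shuffle E" for a r
    using loday_field_linear[OF that that, of r 0] by simp
qed (simp_all add: loday_field_reduced loday_field_derivation)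

lemma loday_field_fn: "f \<in> Cinf E \<Longrightarrow> X \<in> Sec E \<Longrightarrow> loday_field (fn f) [X] = \<rho> X f"
  by (simp add: loday_field_eq fn_reduced_shuffle Lie_def)

lemma derived_bracket_loday_field: "derived_bracket E loday_field = B"
proof (intro ext)
  fix X Y x
  show "derived_bracket E loday_field X Y x = B X Y x"
  proof (cases "X \<in> Sec E \<and> Y \<in> Sec E")
    case True
    then have "derived_bracket E loday_field X Y = B X Y"
      by (intro derived_bracketI)
        (simp_all add: bracket_closed loday_field_fn covector_Cinf loday_field_eq reduced_ops_subset
          Lie_def contraction_def)
    then show ?thesis by simp
  next
    case False
    then show ?thesis using bracket_outside by (auto simp: derived_bracket_def)
  qed
qed

lemma loday_field_homological: "loday_field \<in> homological_fields E"
proof -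
  have "loday_field c [X1, X2, X3] = (\<lambda>x. loday_field (fn (c [X2, X3])) [X1] x
         - loday_field (fn (c [X1, X3])) [X2] x + loday_field (fn (c [X1, X2])) [X3] x
         - c [B X1 X2, X3] x - c [X2, B X1 X3] x + c [X1, B X2 X3] x)"
    if c_reduced: "c \<in> reduced_ops E 2" and X_Sec: "X1 \<in> Sec E" "X2 \<in> Sec E" "X3 \<in> Sec E"
      for c X1 X2 X3
    using X_Sec reduced_ops_subset[OF c_reduced]
    by (simp add: loday_field_fn reduced_Cinf[OF c_reduced] loday_field_eq Lie_def contraction_def
        numeral_2_eq_2 fun_eq_iff)
  then have "loday_field \<in> Der1 E"
    unfolding Der1_def by (simp add: derived_bracket_loday_field loday_field_graded_derivation)
  then show ?thesis unfolding homological_fields_def by (simp add: loday_field_square)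
qed

end

section \<open>The derived bracket\<close>

context smooth_vector_bundle
begin

lemma covector_\<delta>:
  assumes l_covector: "l \<in> reduced_ops E 1" and D_Sec: "\<And>Xs. Xs \<in> args E p \<Longrightarrow> D Xs \<in> Sec E"
    and "i < p" "f \<in> Cinf E" "Xs \<in> args E p"
  shows "l [\<delta> i f D Xs] = \<delta> i f (\<lambda>Xs. l [D Xs]) Xs"
proof -
  have "D Xs \<in> Sec E" "D (Xs[i := fmult f (Xs ! i)]) \<in> Sec E"
    using assms by (auto intro: D_Sec args_fmult)
  moreover have "\<delta> i f D Xs = (\<lambda>x. D (Xs[i := fmult f (Xs ! i)]) x - fmult f (D Xs) x)"
    by (simp add: \<delta>_def fmult_def)
  ultimately show ?thesis
    using assms(4)
    by (simp add: covector_diff[OF l_covector] Sec_fmult covector_fmult[OF l_covector])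
      (simp add: \<delta>_def)
qed

lemma total_order_less_by_covectors:
  assumes "\<And>Xs. Xs \<in> args E p \<Longrightarrow> D Xs \<in> Sec E"
    and "\<And>l. l \<in> reduced_ops E 1 \<Longrightarrow> total_order_less E p n (\<lambda>Xs. l [D Xs])"
  shows "total_order_less E p n D"
  using assms
proof (induction n arbitrary: D)
  case 0
  then show ?case by (auto intro!: Sec_eqI Sec_zero simp: covector_zero)
next
  case (Suc n)
  have "total_order_less E p n (\<delta> i f D)" if "i < p" "f \<in> Cinf E" for i f
  proof (rule Suc.IH)
    show "\<delta> i f D Xs \<in> Sec E" if "Xs \<in> args E p" for Xs
      using Suc.prems(1) \<open>i < p\<close> \<open>f \<in> Cinf E\<close> that by (rule \<delta>_Sec)
    show "total_order_less E p n (\<lambda>Xs. l [\<delta> i f D Xs])" if l_covector: "l \<in> reduced_ops E 1" for l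
    proof (rule total_order_less_cong)
      show "total_order_less E p n (\<delta> i f (\<lambda>Xs. l [D Xs]))"
        using Suc.prems(2)[OF l_covector] \<open>i < p\<close> \<open>f \<in> Cinf E\<close> by simp
    qed (simp add: covector_\<delta>[OF l_covector Suc.prems(1)] \<open>i < p\<close> \<open>f \<in> Cinf E\<close>)
  qed
  then show ?case by simp
qed

lemma multilinear_by_covectors:
  assumes D_Sec: "\<And>Xs. Xs \<in> args E p \<Longrightarrow> D Xs \<in> Sec E"
    and linear: "\<And>l. l \<in> reduced_ops E 1 \<Longrightarrow> multilinear E p (\<lambda>Xs. l [D Xs])"
  shows "multilinear E p D"
proof (rule multilinearI, rule Sec_eqI)
  fix Xs i Y Z and r s :: real
  assume Xs_args: "Xs \<in> args E p" "i < p" and YZ_Sec: "Y \<in> Sec E" "Z \<in> Sec E"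
  show Sec: "D (Xs[i := (\<lambda>x. r *\<^sub>R Y x + s *\<^sub>R Z x)]) \<in> Sec E"
    "(\<lambda>x. r *\<^sub>R D (Xs[i := Y]) x + s *\<^sub>R D (Xs[i := Z]) x) \<in> Sec E"
    using Xs_args YZ_Sec by (auto intro: D_Sec args_update Sec_linear)
  show "l [D (Xs[i := (\<lambda>x. r *\<^sub>R Y x + s *\<^sub>R Z x)])]
      = l [\<lambda>x. r *\<^sub>R D (Xs[i := Y]) x + s *\<^sub>R D (Xs[i := Z]) x]"
        if l_covector: "l \<in> reduced_ops E 1" for l
    using multilinearD[OF linear[OF l_covector] Xs_args YZ_Sec, of r s] Xs_args YZ_Sec
    by (simp add: covector_linear[OF l_covector] D_Sec args_update)
qed

lemma multidiff_less_by_covectors: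
  assumes "\<And>Xs. Xs \<in> args E p \<Longrightarrow> D Xs \<in> Sec E"
    and "\<And>l. l \<in> reduced_ops E 1 \<Longrightarrow> multidiff_less p n (\<lambda>Xs. l [D Xs])"
  shows "multidiff_less p n D"
  using assms multilinear_by_covectors[of p D] total_order_less_by_covectors[of p D n]
  unfolding multidiff_less_def by blast

end

locale homological_field = smooth_vector_bundle E
  for E :: "('m::{t2_space,second_countable_topology}, 'e::real_inner, 'v::real_vector, 'f::real_inner) vbundle" +
  fixes d :: "('m, 'v) cochain \<Rightarrow> ('m, 'v) cochain"
  assumes homological: "d \<in> homological_fields E"
begin

definition \<rho> :: "('m \<Rightarrow> 'v) \<Rightarrow> ('m \<Rightarrow> real) \<Rightarrow> 'm \<Rightarrow> real" where
  "\<rho> X f = d (fn f) [X]"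

abbreviation B :: "('m \<Rightarrow> 'v) \<Rightarrow> ('m \<Rightarrow> 'v) \<Rightarrow> 'm \<Rightarrow> 'v" where
  "B \<equiv> derived_bracket E d"

lemma graded_derivation: "d \<in> graded_derivations E"
  using homological by (simp add: homological_fields_def Der1_def)

lemma d_reduced: "c \<in> reduced_ops E k \<Longrightarrow> d c \<in> reduced_ops E (Suc k)"
  using graded_derivation by (simp add: graded_derivations_def)

lemma d_fn_covector: "f \<in> Cinf E \<Longrightarrow> d (fn f) \<in> reduced_ops E 1"
  using d_reduced[OF fn_reduced] by (simp add: One_nat_def)

lemma d_covector: "l \<in> reduced_ops E 1 \<Longrightarrow> d l \<in> reduced_ops E 2"
  using d_reduced[of l 1] by (simp add: numeral_2_eq_2 One_nat_def)

lemma d_linear: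
  assumes "a \<in> reduced_shuffle E" "b \<in> reduced_shuffle E"
  shows "d (\<lambda>Xs x. r * a Xs x + s * b Xs x) = (\<lambda>Xs x. r * d a Xs x + s * d b Xs x)"
proof -
  have add: "d (\<lambda>Xs x. a Xs x + b Xs x) = (\<lambda>Xs x. d a Xs x + d b Xs x)"
    if "a \<in> reduced_shuffle E" "b \<in> reduced_shuffle E" for a b
    using that graded_derivation unfolding graded_derivations_def by simp
  have scale: "d (\<lambda>Xs x. r * a Xs x) = (\<lambda>Xs x. r * d a Xs x)"
    if "a \<in> reduced_shuffle E" for r a
    using that graded_derivation unfolding graded_derivations_def by simp
  have "(\<lambda>Xs x. r * a Xs x) \<in> reduced_shuffle E" "(\<lambda>Xs x. s * b Xs x) \<in> reduced_shuffle E"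
    using reduced_shuffle_linear[OF assms(1,1), of r 0]
      reduced_shuffle_linear[OF assms(2,2), of s 0]
    by simp_all
  then show ?thesis using add scale assms by simp
qed

lemma d_fmult:
  assumes "f \<in> Cinf E" "b \<in> reduced_shuffle E"
  shows "d (\<lambda>Xs x. f x * b Xs x) = (\<lambda>Xs x. (d (fn f) \<pitchfork> b) Xs x + f x * d b Xs x)"
proof -
  have "fn f \<pitchfork> b = (\<lambda>Xs x. f x * b Xs x)" by (intro ext) (rule shuffle_fn_left)
  moreover have "d (fn f \<pitchfork> b) = (\<lambda>Xs x. (d (fn f) \<pitchfork> b) Xs x + (- 1) ^ 0 * (fn f \<pitchfork> d b) Xs x)"
    using graded_derivation fn_reduced[OF assms(1)] assms(2)
    unfolding graded_derivations_def by blast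
  ultimately show ?thesis by (simp add: shuffle_fn_left)
qed

lemma d_d: "c \<in> reduced_shuffle E \<Longrightarrow> d (d c) = (\<lambda>Xs x. 0)"
  using homological by (simp add: homological_fields_def)

lemma d_two_cochain:
  assumes "c \<in> reduced_ops E 2" "X \<in> Sec E" "Y \<in> Sec E" "Z \<in> Sec E"
  shows "d c [X, Y, Z] = (\<lambda>x. \<rho> X (c [Y, Z]) x - \<rho> Y (c [X, Z]) x + \<rho> Z (c [X, Y]) x
    - c [B X Y, Z] x - c [Y, B X Z] x + c [X, B Y Z] x)"
  using homological assms unfolding homological_fields_def Der1_def \<rho>_def by blast

sublocale anchored_bundle E \<rho>
proof
  fix X Y f g and r s :: real
  assume X_Sec: "X \<in> Sec E" and f_Cinf: "f \<in> Cinf E"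
  show "\<rho> X f \<in> Cinf E" unfolding \<rho>_def by (rule covector_Cinf[OF d_fn_covector[OF f_Cinf] X_Sec])
  assume g_Cinf: "g \<in> Cinf E"
  show "\<rho> X (\<lambda>x. r * f x + s * g x) = (\<lambda>x. r * \<rho> X f x + s * \<rho> X g x)"
    using d_linear[OF fn_reduced_shuffle[OF f_Cinf] fn_reduced_shuffle[OF g_Cinf]]
    by (simp add: \<rho>_def fn_linear)
  have "fn (\<lambda>x. f x * g x) = (\<lambda>Xs x. f x * (fn g :: ('m, 'v) cochain) Xs x)"
    by (auto simp: fn_def fun_eq_iff)
  then show "\<rho> X (\<lambda>x. f x * g x) = (\<lambda>x. \<rho> X f x * g x + f x * \<rho> X g x)"
    using d_fmult[OF f_Cinf fn_reduced_shuffle[OF g_Cinf]] by (simp add: \<rho>_def shuffle_one)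
  show "\<rho> (fmult f X) g = (\<lambda>x. f x * \<rho> X g x)"
    unfolding \<rho>_def by (rule covector_fmult[OF d_fn_covector[OF g_Cinf] f_Cinf X_Sec])
next
  fix X Y g and r s :: real
  assume "X \<in> Sec E" "Y \<in> Sec E" "g \<in> Cinf E"
  then show "\<rho> (\<lambda>x. r *\<^sub>R X x + s *\<^sub>R Y x) g = (\<lambda>x. r * \<rho> X g x + s * \<rho> Y g x)"
    unfolding \<rho>_def by (simp add: covector_linear[OF d_fn_covector])
qed

lemma derived_bracket_outside: "\<not> (X \<in> Sec E \<and> Y \<in> Sec E) \<Longrightarrow> B X Y = (\<lambda>x. 0)"
  unfolding derived_bracket_def by (rule if_not_P)

lemma bracket_functional_bidual:
  assumes X_Sec: "X \<in> Sec E" and Y_Sec: "Y \<in> Sec E"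
  shows "(\<lambda>l x. \<rho> X (l [Y]) x - \<rho> Y (l [X]) x - d l [X, Y] x) \<in> bidual"
  unfolding bidual_def
proof (intro CollectI conjI ballI)
  fix l assume l_covector: "l \<in> reduced_ops E 1"
  show "(\<lambda>x. \<rho> X (l [Y]) x - \<rho> Y (l [X]) x - d l [X, Y] x) \<in> Cinf E"
    using X_Sec Y_Sec
    by (intro scalar_diff anchor_closed covector_Cinf[OF l_covector]
        reduced_Cinf[OF d_covector[OF l_covector]]) auto
  show "(\<lambda>x. \<rho> X (\<lambda>x. l [Y] x + l' [Y] x) x - \<rho> Y (\<lambda>x. l [X] x + l' [X] x) x
        - d (\<lambda>Xs x. l Xs x + l' Xs x) [X, Y] x)
      = (\<lambda>x. (\<rho> X (l [Y]) x - \<rho> Y (l [X]) x - d l [X, Y] x)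
        + (\<rho> X (l' [Y]) x - \<rho> Y (l' [X]) x - d l' [X, Y] x))"
          if l'_covector: "l' \<in> reduced_ops E 1" for l'
    using d_linear[OF reduced_ops_subset[OF l_covector] reduced_ops_subset[OF l'_covector], of 1 1]
      anchor_linear[OF X_Sec covector_Cinf[OF l_covector Y_Sec]
          covector_Cinf[OF l'_covector Y_Sec], of 1 1]
      anchor_linear[OF Y_Sec covector_Cinf[OF l_covector X_Sec]
          covector_Cinf[OF l'_covector X_Sec], of 1 1]
    by (simp add: fun_eq_iff)
  show "(\<lambda>x. \<rho> X (\<lambda>x. f x * l [Y] x) x - \<rho> Y (\<lambda>x. f x * l [X] x) x
      - d (\<lambda>Xs x. f x * l Xs x) [X, Y] x)
      = (\<lambda>x. f x * (\<rho> X (l [Y]) x - \<rho> Y (l [X]) x - d l [X, Y] x))" if f_Cinf: "f \<in> Cinf E" for f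
    using d_fmult[OF f_Cinf reduced_ops_subset[OF l_covector]]
      anchor_mult[OF X_Sec f_Cinf covector_Cinf[OF l_covector Y_Sec]]
      anchor_mult[OF Y_Sec f_Cinf covector_Cinf[OF l_covector X_Sec]]
      reduced_length[OF l_covector, of "[]"]
      reduced_length[OF d_fn_covector[OF f_Cinf]]
    by (simp add: fun_eq_iff shuffle_two \<rho>_def algebra_simps One_nat_def)
qed

lemma
  assumes X_Sec: "X \<in> Sec E" and Y_Sec: "Y \<in> Sec E"
  shows derived_bracket_Sec: "B X Y \<in> Sec E"
    and covector_derived_bracket: "l \<in> reduced_ops E 1 \<Longrightarrow>
      l [B X Y] = (\<lambda>x. \<rho> X (l [Y]) x - \<rho> Y (l [X]) x - d l [X, Y] x)"
proof -
  obtain Z where Z_Sec: "Z \<in> Sec E"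
    "\<And>l. l \<in> reduced_ops E 1 \<Longrightarrow> l [Z] = (\<lambda>x. \<rho> X (l [Y]) x - \<rho> Y (l [X]) x - d l [X, Y] x)"
    by (rule Sec_reflexive[OF bracket_functional_bidual[OF X_Sec Y_Sec]]) (rule that)
  then have "B X Y = Z" using X_Sec Y_Sec by (intro derived_bracketI) (simp_all add: \<rho>_def)
  then show "B X Y \<in> Sec E"
    "l \<in> reduced_ops E 1 \<Longrightarrow> l [B X Y] = (\<lambda>x. \<rho> X (l [Y]) x - \<rho> Y (l [X]) x - d l [X, Y] x)"
    using Z_Sec by simp_all
qed

lemma d_covector_eq:
  assumes "l \<in> reduced_ops E 1" "X \<in> Sec E" "Y \<in> Sec E"
  shows "d l [X, Y] = (\<lambda>x. \<rho> X (l [Y]) x - \<rho> Y (l [X]) x - l [B X Y] x)"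
  unfolding covector_derived_bracket[OF assms(2,3,1)] by simp

lemma derived_bracket_fmult:
  assumes X_Sec: "X \<in> Sec E" and Y_Sec: "Y \<in> Sec E" and f_Cinf: "f \<in> Cinf E"
  shows "B X (fmult f Y) = (\<lambda>x. f x *\<^sub>R B X Y x + \<rho> X f x *\<^sub>R Y x)"
proof -
  have "B X (fmult f Y) = (\<lambda>x. fmult f (B X Y) x + fmult (\<rho> X f) Y x)"
  proof (rule Sec_eqI)
    fix l assume l_covector: "l \<in> reduced_ops E 1"
    have "d l [X, fmult f Y] = (\<lambda>x. f x * d l [X, Y] x)"
      using last_linearD[OF reduced_last_linear[OF d_covector[OF l_covector]], of "[X]"] X_Sec
        Y_Sec f_Cinf by simp
    then show "l [B X (fmult f Y)] = l [\<lambda>x. fmult f (B X Y) x + fmult (\<rho> X f) Y x]"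
      using l_covector X_Sec Y_Sec f_Cinf
      by (simp add: covector_derived_bracket Sec_fmult covector_add derived_bracket_Sec
          anchor_closed
          covector_fmult anchor_mult covector_Cinf anchor_fmult fun_eq_iff algebra_simps)
  qed (intro derived_bracket_Sec Sec_add Sec_fmult anchor_closed X_Sec Y_Sec f_Cinf)+
  then show ?thesis by (simp add: fmult_def)
qed

lemma derived_bracket_multidiff: "multidiff_less 2 2 (binary_op B)"
proof (rule multidiff_less_by_covectors)
  show "binary_op B Xs \<in> Sec E" if "Xs \<in> args E 2" for Xs
    using that by (auto simp: derived_bracket_Sec elim!: args_2E)
  fix l assume l_covector: "l \<in> reduced_ops E 1"
  let ?swap = "Transposition.transpose 0 (1::nat)"
  have "l Ys \<in> Cinf E" if "Ys \<in> args E 1" for Ys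
    using that by (auto simp: args_1 covector_Cinf[OF l_covector])
  then have anchor: "multidiff_less 2 2 (anchor_term l)"
    using multidiff_less_anchor_term[of 1 1 l] reduced_multidiff[OF l_covector]
    by (simp add: numeral_2_eq_2 One_nat_def)
  moreover have "?swap permutes {..<2}" by (rule permutes_swap_id) auto
  then have "multidiff_less 2 2 (\<lambda>Xs. anchor_term l (permute_list ?swap Xs))"
    using anchor by (rule multidiff_less_permute_list)
  moreover have "multidiff_less 2 2 (d l)"
    using reduced_multidiff[OF d_covector[OF l_covector]] by simp
  ultimately have less: "multidiff_less 2 2
      (\<lambda>Xs x. 1 *\<^sub>R (1 *\<^sub>R anchor_term l Xs x + (- 1) *\<^sub>R anchor_term l (permute_list ?swap Xs) x)
        + (- 1) *\<^sub>R d l Xs x)"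
    by (intro multidiff_less_linear)
  have "permute_list ?swap [X, Y] = [Y, X]" for X Y :: "'m \<Rightarrow> 'v"
    by (simp add: permute_list_def One_nat_def)
  then show "multidiff_less 2 2 (\<lambda>Xs. l [binary_op B Xs])"
    by (intro multidiff_less_cong[OF less])
      (auto simp: covector_derived_bracket[OF _ _ l_covector] elim!: args_2E)
qed

lemma anchor_derived_bracket:
  assumes X_Sec: "X \<in> Sec E" and Y_Sec: "Y \<in> Sec E" and f_Cinf: "f \<in> Cinf E"
  shows "\<rho> (B X Y) f = (\<lambda>x. \<rho> X (\<rho> Y f) x - \<rho> Y (\<rho> X f) x)"
  using covector_derived_bracket[OF X_Sec Y_Sec d_fn_covector[OF f_Cinf]]
    d_d[OF fn_reduced_shuffle[OF f_Cinf]]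
  by (simp add: \<rho>_def)

lemma derived_bracket_jacobi:
  assumes X_Sec: "X \<in> Sec E" and Y_Sec: "Y \<in> Sec E" and Z_Sec: "Z \<in> Sec E"
  shows "B X (B Y Z) = (\<lambda>x. B (B X Y) Z x + B Y (B X Z) x)"
proof (rule Sec_eqI)
  note closed = derived_bracket_Sec anchor_closed covector_Cinf
  show "B X (B Y Z) \<in> Sec E" "(\<lambda>x. B (B X Y) Z x + B Y (B X Z) x) \<in> Sec E"
    by (intro closed Sec_add X_Sec Y_Sec Z_Sec)+
  fix l assume l_covector: "l \<in> reduced_ops E 1"
  have "(\<lambda>x. \<rho> X (d l [Y, Z]) x - \<rho> Y (d l [X, Z]) x + \<rho> Z (d l [X, Y]) x
      - d l [B X Y, Z] x - d l [Y, B X Z] x + d l [X, B Y Z] x) = (\<lambda>x. 0)"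
    using d_two_cochain[OF d_covector[OF l_covector] X_Sec Y_Sec Z_Sec]
      d_d[OF reduced_ops_subset[OF l_covector]] by metis
  then show "l [B X (B Y Z)] = l [\<lambda>x. B (B X Y) Z x + B Y (B X Z) x]"
    using l_covector X_Sec Y_Sec Z_Sec
    by (simp add: d_covector_eq closed anchor_diff scalar_diff anchor_derived_bracket covector_add
        fun_eq_iff) (simp add: algebra_simps)
qed

sublocale loday_structure E \<rho> B
  by unfold_locales
    (rule derived_bracket_Sec anchor_derived_bracket derived_bracket_jacobi derived_bracket_fmult
      derived_bracket_multidiff derived_bracket_outside; assumption)+

end

section \<open>The correspondence\<close>

lemma bij_betw_quotient_kernel:
  assumes kernel: "\<And>x y. (x, y) \<in> R \<longleftrightarrow> x \<in> A \<and> y \<in> A \<and> f x = f y"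
  shows "\<exists>h. bij_betw h (A // R) (f ` A) \<and> (\<forall>x\<in>A. h (R `` {x}) = f x)"
proof -
  define h where "h K = the_elem (f ` K)" for K
  have h_class: "h (R `` {x}) = f x" if "x \<in> A" for x
  proof -
    have "f ` (R `` {x}) = {f x}" using that kernel by auto
    then show ?thesis by (simp add: h_def)
  qed
  have "inj_on h (A // R)"
    by (rule inj_onI, elim quotientE) (auto simp: h_class kernel)
  moreover have "A // R = (\<lambda>x. R `` {x}) ` A" by (auto simp: quotient_def)
  then have "h ` (A // R) = f ` A" by (simp add: image_image h_class)
  ultimately show ?thesis using h_class by (auto simp: bij_betw_def)
qed

context smooth_vector_bundle
begin

lemma loday_algebroids_iff:
  "B \<in> loday_algebroids E \<longleftrightarrow>
     (\<forall>X Y. \<not> (X \<in> Sec E \<and> Y \<in> Sec E) \<longrightarrow> B X Y = (\<lambda>x. 0)) \<and>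
     (\<forall>X\<in>Sec E. \<forall>Y\<in>Sec E. B X Y \<in> Sec E) \<and> multidiff_less 2 2 (binary_op B) \<and>
     (\<forall>X\<in>Sec E. \<forall>Y\<in>Sec E. \<forall>Z\<in>Sec E. B X (B Y Z) = (\<lambda>x. B (B X Y) Z x + B Y (B X Z) x)) \<and>
     (\<forall>X\<in>Sec E. \<forall>f\<in>Cinf E. \<exists>g\<in>Cinf E. \<forall>Y\<in>Sec E.
        B X (fmult f Y) = (\<lambda>x. f x *\<^sub>R B X Y x + g x *\<^sub>R Y x))"
proof -
  have "(\<forall>Xs\<in>args E 2. binary_op B Xs \<in> Sec E) \<longleftrightarrow> (\<forall>X\<in>Sec E. \<forall>Y\<in>Sec E. B X Y \<in> Sec E)"
    by (metis args_2E binary_op_pair pair_in_args_2)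
  moreover have "total_order_le E 2 1 (binary_op B) \<longleftrightarrow> total_order_less E 2 2 (binary_op B)"
    by (simp add: total_order_le_iff_less numeral_2_eq_2 One_nat_def)
  moreover have "\<exists>k. \<forall>i<2. order_le E 2 i k (binary_op B)" if "total_order_le E 2 1 (binary_op B)"
    using total_order_le_imp_order_le[OF that] by blast
  moreover have "(\<lambda>x. B X (fmult f Y) x - f x *\<^sub>R B X Y x) = fmult g Y \<longleftrightarrow>
      B X (fmult f Y) = (\<lambda>x. f x *\<^sub>R B X Y x + g x *\<^sub>R Y x)" for X f Y g
    unfolding fmult_def[of g] fun_eq_iff by (simp add: diff_eq_eq add.commute)
  ultimately show ?thesis
    unfolding loday_algebroids_def binary_op_def[symmetric] multidifferential_def multidiff_less_def
    by auto
qed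

end

lemma (in loday_structure) bracket_loday_algebroid: "B \<in> loday_algebroids E"
proof -
  have "\<exists>g\<in>Cinf E. \<forall>Y\<in>Sec E. B X (fmult f Y) = (\<lambda>x. f x *\<^sub>R B X Y x + g x *\<^sub>R Y x)"
    if "X \<in> Sec E" "f \<in> Cinf E" for X f
    using that bracket_fmult by (intro bexI[of _ "\<rho> X f"] anchor_closed) simp_all
  then show ?thesis
    unfolding loday_algebroids_iff
    by (intro conjI allI ballI impI bracket_outside bracket_closed bracket_multidiff jacobi)
qed

locale loday_algebroid = smooth_vector_bundle E
  for E :: "('m::{t2_space,second_countable_topology}, 'e::real_inner, 'v::real_vector, 'f::real_inner) vbundle" +
  fixes B :: "('m \<Rightarrow> 'v) \<Rightarrow> ('m \<Rightarrow> 'v) \<Rightarrow> 'm \<Rightarrow> 'v"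
  assumes loday: "B \<in> loday_algebroids E"
begin

lemma
  shows bracket_outside: "\<not> (X \<in> Sec E \<and> Y \<in> Sec E) \<Longrightarrow> B X Y = (\<lambda>x. 0)"
    and bracket_Sec: "X \<in> Sec E \<Longrightarrow> Y \<in> Sec E \<Longrightarrow> B X Y \<in> Sec E"
    and bracket_multidiff: "multidiff_less 2 2 (binary_op B)"
    and bracket_jacobi: "X \<in> Sec E \<Longrightarrow> Y \<in> Sec E \<Longrightarrow> Z \<in> Sec E \<Longrightarrow>
      B X (B Y Z) = (\<lambda>x. B (B X Y) Z x + B Y (B X Z) x)"
    and derivative_endomorphism: "X \<in> Sec E \<Longrightarrow> f \<in> Cinf E \<Longrightarrow> \<exists>g\<in>Cinf E. \<forall>Y\<in>Sec E.
      B X (fmult f Y) = (\<lambda>x. f x *\<^sub>R B X Y x + g x *\<^sub>R Y x)"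
  using loday unfolding loday_algebroids_iff by blast+

lemma bracket_linear_right:
  "X \<in> Sec E \<Longrightarrow> Y \<in> Sec E \<Longrightarrow> Z \<in> Sec E \<Longrightarrow>
    B X (\<lambda>x. r *\<^sub>R Y x + s *\<^sub>R Z x) = (\<lambda>x. r *\<^sub>R B X Y x + s *\<^sub>R B X Z x)"
  using bracket_multidiff multilinearD[OF _ pair_in_args_2, of "binary_op B" X Y 1 Y Z r s]
  by (simp add: multidiff_less_def One_nat_def)

lemma bracket_linear_left:
  "X \<in> Sec E \<Longrightarrow> Y \<in> Sec E \<Longrightarrow> Z \<in> Sec E \<Longrightarrow>
    B (\<lambda>x. r *\<^sub>R Y x + s *\<^sub>R Z x) X = (\<lambda>x. r *\<^sub>R B Y X x + s *\<^sub>R B Z X x)"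
  using bracket_multidiff multilinearD[OF _ pair_in_args_2, of "binary_op B" Y X 0 Y Z r s]
  by (simp add: multidiff_less_def)

text \<open>In rank 0 the bracket carries no information on the anchor, which has to be set to 0.\<close>

lemma zero_anchor_loday_structure:
  assumes "\<forall>w::'f. w = 0"
  shows "loday_structure E (\<lambda>X f x. 0) B"
proof unfold_locales
  show "B X (fmult f Y) = (\<lambda>x. f x *\<^sub>R B X Y x + 0 *\<^sub>R Y x)"
    if "X \<in> Sec E" "Y \<in> Sec E" "f \<in> Cinf E" for X Y f
    using Sec_rank_0[OF assms bracket_Sec] that by (simp add: Sec_fmult)
qed (simp_all add: scalar_const bracket_Sec bracket_multidiff bracket_outside, rule bracket_jacobi)

end

locale positive_rank_loday_algebroid = loday_algebroid E B
  for E :: "('m::{t2_space,second_countable_topology}, 'e::real_inner, 'v::real_vector, 'f::real_inner) vbundle"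
    and B +
  assumes positive_rank: "\<exists>w::'f. w \<noteq> 0"
begin

definition \<rho> :: "('m \<Rightarrow> 'v) \<Rightarrow> ('m \<Rightarrow> real) \<Rightarrow> 'm \<Rightarrow> real" where
  "\<rho> X f = (SOME g. g \<in> Cinf E \<and>
     (\<forall>Y\<in>Sec E. B X (fmult f Y) = (\<lambda>x. f x *\<^sub>R B X Y x + g x *\<^sub>R Y x)))"

lemma
  assumes "X \<in> Sec E" "f \<in> Cinf E"
  shows anchor_Cinf: "\<rho> X f \<in> Cinf E"
    and bracket_fmult: "Y \<in> Sec E \<Longrightarrow> B X (fmult f Y) = (\<lambda>x. f x *\<^sub>R B X Y x + \<rho> X f x *\<^sub>R Y x)"
proof -
  have "\<rho> X f \<in> Cinf E \<and>
      (\<forall>Y\<in>Sec E. B X (fmult f Y) = (\<lambda>x. f x *\<^sub>R B X Y x + \<rho> X f x *\<^sub>R Y x))"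
    unfolding \<rho>_def
    by (rule someI_ex[OF derivative_endomorphism[OF assms, unfolded Bex_def]])
  then show "\<rho> X f \<in> Cinf E"
    "Y \<in> Sec E \<Longrightarrow> B X (fmult f Y) = (\<lambda>x. f x *\<^sub>R B X Y x + \<rho> X f x *\<^sub>R Y x)" by blast+
qed

lemma scalar_eqI:
  assumes "\<And>Y x. Y \<in> Sec E \<Longrightarrow> f x *\<^sub>R Y x = g x *\<^sub>R Y x"
  shows "f = g"
proof
  fix x
  obtain w :: 'f where "w \<noteq> 0" using positive_rank by blast
  then obtain Y where "Y \<in> Sec E" "Y x \<noteq> 0" by (rule nonvanishing_section)
  then show "f x = g x" using assms[of Y x] by simp
qed

lemma anchor_linear_right:
  assumes X_Sec: "X \<in> Sec E" and f_Cinf: "f \<in> Cinf E" and g_Cinf: "g \<in> Cinf E"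
  shows "\<rho> X (\<lambda>x. r * f x + s * g x) = (\<lambda>x. r * \<rho> X f x + s * \<rho> X g x)"
proof (rule scalar_eqI)
  fix Y x assume Y_Sec: "Y \<in> Sec E"
  have "fmult (\<lambda>x. r * f x + s * g x) Y = (\<lambda>x. r *\<^sub>R fmult f Y x + s *\<^sub>R fmult g Y x)"
    by (simp add: fmult_def algebra_simps)
  then have "B X (fmult (\<lambda>x. r * f x + s * g x) Y) x = r *\<^sub>R B X (fmult f Y) x
      + s *\<^sub>R B X (fmult g Y) x"
    using bracket_linear_right[OF X_Sec Sec_fmult[OF f_Cinf Y_Sec] Sec_fmult[OF g_Cinf Y_Sec]]
    by simp
  then show "\<rho> X (\<lambda>x. r * f x + s * g x) x *\<^sub>R Y x = (r * \<rho> X f x + s * \<rho> X g x) *\<^sub>R Y x"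
    by (simp add: bracket_fmult X_Sec Y_Sec f_Cinf g_Cinf scalar_linear algebra_simps)
qed

lemma anchor_mult:
  assumes X_Sec: "X \<in> Sec E" and f_Cinf: "f \<in> Cinf E" and g_Cinf: "g \<in> Cinf E"
  shows "\<rho> X (\<lambda>x. f x * g x) = (\<lambda>x. \<rho> X f x * g x + f x * \<rho> X g x)"
proof (rule scalar_eqI)
  fix Y x assume Y_Sec: "Y \<in> Sec E"
  have "fmult (\<lambda>x. f x * g x) Y = fmult f (fmult g Y)" by (simp add: fmult_def)
  then have "B X (fmult (\<lambda>x. f x * g x) Y) x = B X (fmult f (fmult g Y)) x" by simp
  then show "\<rho> X (\<lambda>x. f x * g x) x *\<^sub>R Y x = (\<rho> X f x * g x + f x * \<rho> X g x) *\<^sub>R Y x"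
    unfolding bracket_fmult[OF X_Sec scalar_mult[OF f_Cinf g_Cinf] Y_Sec]
      bracket_fmult[OF X_Sec f_Cinf Sec_fmult[OF g_Cinf Y_Sec]]
      bracket_fmult[OF X_Sec g_Cinf Y_Sec]
    by (simp add: fmult_def algebra_simps)
qed

lemma bracket_bracket_fmult:
  assumes X_Sec: "X \<in> Sec E" and Y_Sec: "Y \<in> Sec E" and Z_Sec: "Z \<in> Sec E" and f_Cinf: "f \<in> Cinf E"
  shows "B X (B Y (fmult f Z)) x = f x *\<^sub>R B X (B Y Z) x + \<rho> X f x *\<^sub>R B Y Z x
    + \<rho> Y f x *\<^sub>R B X Z x + \<rho> X (\<rho> Y f) x *\<^sub>R Z x"
proof -
  have "B Y (fmult f Z) = (\<lambda>x. 1 *\<^sub>R fmult f (B Y Z) x + 1 *\<^sub>R fmult (\<rho> Y f) Z x)"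
    unfolding bracket_fmult[OF Y_Sec f_Cinf Z_Sec] by (simp add: fmult_def)
  then have "B X (B Y (fmult f Z)) x = B X (fmult f (B Y Z)) x + B X (fmult (\<rho> Y f) Z) x"
    using bracket_linear_right[OF X_Sec Sec_fmult[OF f_Cinf bracket_Sec[OF Y_Sec Z_Sec]]
        Sec_fmult[OF anchor_Cinf[OF Y_Sec f_Cinf] Z_Sec], of 1 1] by simp
  then show ?thesis
    by (simp add: bracket_fmult X_Sec Y_Sec Z_Sec f_Cinf bracket_Sec anchor_Cinf)
qed

lemma anchor_bracket:
  assumes X_Sec: "X \<in> Sec E" and Y_Sec: "Y \<in> Sec E" and f_Cinf: "f \<in> Cinf E"
  shows "\<rho> (B X Y) f = (\<lambda>x. \<rho> X (\<rho> Y f) x - \<rho> Y (\<rho> X f) x)"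
proof (rule scalar_eqI)
  fix Z x assume Z_Sec: "Z \<in> Sec E"
  have "B X (B Y (fmult f Z)) x = B (B X Y) (fmult f Z) x + B Y (B X (fmult f Z)) x"
    by (rule fun_cong[OF bracket_jacobi[OF X_Sec Y_Sec Sec_fmult[OF f_Cinf Z_Sec]]])
  moreover have "f x *\<^sub>R B X (B Y Z) x = f x *\<^sub>R B (B X Y) Z x + f x *\<^sub>R B Y (B X Z) x"
    by (simp only: fun_cong[OF bracket_jacobi[OF X_Sec Y_Sec Z_Sec], of x] scaleR_add_right)
  ultimately show "\<rho> (B X Y) f x *\<^sub>R Z x = (\<rho> X (\<rho> Y f) x - \<rho> Y (\<rho> X f) x) *\<^sub>R Z x"
    unfolding bracket_bracket_fmult[OF X_Sec Y_Sec Z_Sec f_Cinf]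
      bracket_bracket_fmult[OF Y_Sec X_Sec Z_Sec f_Cinf]
      bracket_fmult[OF bracket_Sec[OF X_Sec Y_Sec] f_Cinf Z_Sec]
    by (simp add: scaleR_diff_left)
qed

lemma anchor_fmult:
  assumes X_Sec: "X \<in> Sec E" and f_Cinf: "f \<in> Cinf E" and g_Cinf: "g \<in> Cinf E"
  shows "\<rho> (fmult f X) g = (\<lambda>x. f x * \<rho> X g x)"
proof (rule scalar_eqI)
  fix Y x assume Y_Sec: "Y \<in> Sec E"
  have commutator: "\<delta> 1 g (binary_op B) [Z, Y] = (\<lambda>x. \<rho> Z g x *\<^sub>R Y x)" if "Z \<in> Sec E" for Z
    using bracket_fmult[OF that g_Cinf Y_Sec] by (simp add: \<delta>_def One_nat_def)
  have "total_order_less E 2 (Suc (Suc 0)) (binary_op B)"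
    using bracket_multidiff by (simp add: multidiff_less_def numeral_2_eq_2)
  then have "\<delta> 0 f (\<delta> 1 g (binary_op B)) [X, Y] = (\<lambda>x. 0)"
    using pair_in_args_2[OF X_Sec Y_Sec] f_Cinf g_Cinf by (simp add: One_nat_def)
  then have "\<delta> 1 g (binary_op B) [fmult f X, Y] x = f x *\<^sub>R \<delta> 1 g (binary_op B) [X, Y] x"
    by (simp add: \<delta>_def[of 0] fun_eq_iff)
  then show "\<rho> (fmult f X) g x *\<^sub>R Y x = (f x * \<rho> X g x) *\<^sub>R Y x"
    by (simp add: commutator Sec_fmult X_Sec f_Cinf)
qed

lemma anchor_linear_left:
  assumes X_Sec: "X \<in> Sec E" and Y_Sec: "Y \<in> Sec E" and g_Cinf: "g \<in> Cinf E"
  shows "\<rho> (\<lambda>x. r *\<^sub>R X x + s *\<^sub>R Y x) g = (\<lambda>x. r * \<rho> X g x + s * \<rho> Y g x)"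
proof (rule scalar_eqI)
  fix Z x assume Z_Sec: "Z \<in> Sec E"
  show "\<rho> (\<lambda>x. r *\<^sub>R X x + s *\<^sub>R Y x) g x *\<^sub>R Z x = (r * \<rho> X g x + s * \<rho> Y g x) *\<^sub>R Z x"
    using fun_cong[OF bracket_linear_left[OF Sec_fmult[OF g_Cinf Z_Sec] X_Sec Y_Sec, of r s], of x]
      fun_cong[OF bracket_linear_left[OF Z_Sec X_Sec Y_Sec, of r s], of x]
    by (simp add: bracket_fmult Sec_linear X_Sec Y_Sec Z_Sec g_Cinf algebra_simps)
qed

lemma anchor_loday_structure: "loday_structure E \<rho> B"
  by unfold_locales
    (rule anchor_Cinf anchor_linear_right anchor_mult anchor_fmult anchor_linear_left bracket_Sec
      anchor_bracket bracket_jacobi bracket_fmult bracket_multidiff bracket_outside; assumption)+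

end

context smooth_vector_bundle
begin

lemma loday_structure_exists:
  assumes "B \<in> loday_algebroids E"
  obtains \<rho> where "loday_structure E \<rho> B"
proof -
  interpret loday_algebroid E B by unfold_locales (rule assms)
  show ?thesis
  proof (cases "\<forall>w::'f. w = 0")
    case True
    then show ?thesis using that zero_anchor_loday_structure by blast
  next
    case False
    then interpret positive_rank_loday_algebroid E B by unfold_locales blast
    show ?thesis using that anchor_loday_structure by blast
  qed
qed

lemma derived_bracket_image: "derived_bracket E ` homological_fields E = loday_algebroids E"
proof
  show "derived_bracket E ` homological_fields E \<subseteq> loday_algebroids E"
  proof
    fix B assume "B \<in> derived_bracket E ` homological_fields E"
    then obtain d where d_homological: "d \<in> homological_fields E" "B = derived_bracket E d" by blast
    interpret homological_field E d by unfold_locales (rule d_homological(1))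
    show "B \<in> loday_algebroids E" using bracket_loday_algebroid d_homological(2) by simp
  qed
  show "loday_algebroids E \<subseteq> derived_bracket E ` homological_fields E"
  proof
    fix B assume "B \<in> loday_algebroids E"
    then obtain \<rho> where "loday_structure E \<rho> B" by (rule loday_structure_exists)
    then interpret loday_structure E \<rho> B .
    show "B \<in> derived_bracket E ` homological_fields E"
      using imageI[OF loday_field_homological, of "derived_bracket E"]
      by (simp add: derived_bracket_loday_field)
  qed
qed

lemma derived_bracket_cong:
  assumes agree: "\<And>c. c \<in> reduced_ops E 0 \<union> reduced_ops E 1 \<Longrightarrow> d c = d' c"
  shows "derived_bracket E d = derived_bracket E d'"
proof (intro ext)
  fix X Y x
  have "(\<lambda>x. d (fn (l [Y])) [X] x - d (fn (l [X])) [Y] x - d l [X, Y] x)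
      = (\<lambda>x. d' (fn (l [Y])) [X] x - d' (fn (l [X])) [Y] x - d' l [X, Y] x)"
    if "X \<in> Sec E" "Y \<in> Sec E" "l \<in> reduced_ops E 1" for l
    using agree[of l] agree[of "fn (l [Y])"] agree[of "fn (l [X])"] that
    by (simp add: fn_reduced covector_Cinf)
  then show "derived_bracket E d X Y x = derived_bracket E d' X Y x"
    unfolding derived_bracket_def by (simp cong: conj_cong)
qed

lemma derived_bracket_determines_anchor:
  assumes d_homological: "d \<in> homological_fields E" and d'_homological: "d' \<in> homological_fields E"
    and same_bracket: "derived_bracket E d = derived_bracket E d'"
    and f_Cinf: "f \<in> Cinf E" and X_Sec: "X \<in> Sec E"
  shows "d (fn f) [X] = d' (fn f) [X]"
proof -
  interpret d: homological_field E d by unfold_locales (rule d_homological)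
  interpret d': homological_field E d' by unfold_locales (rule d'_homological)
  show ?thesis
  proof (cases "\<forall>w::'f. w = 0")
    case True
    show ?thesis
      unfolding Sec_rank_0[OF True X_Sec]
      using d.d_fn_covector[OF f_Cinf] d'.d_fn_covector[OF f_Cinf]
      by (simp add: covector_zero)
  next
    case False
    show ?thesis
    proof
      fix x
      obtain Y where Y_Sec: "Y \<in> Sec E" "Y x \<noteq> 0" using False nonvanishing_section by blast
      have "d.\<rho> X f x *\<^sub>R Y x = d'.\<rho> X f x *\<^sub>R Y x"
        using fun_cong[OF d.bracket_fmult[OF X_Sec Y_Sec(1) f_Cinf], of x]
          fun_cong[OF d'.bracket_fmult[OF X_Sec Y_Sec(1) f_Cinf], of x] by (auto simp: same_bracket)
      then show "d (fn f) [X] x = d' (fn f) [X] x" using Y_Sec(2) by (simp add: d.\<rho>_def d'.\<rho>_def)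
    qed
  qed
qed

lemma derived_bracket_inject:
  assumes d_homological: "d \<in> homological_fields E" and d'_homological: "d' \<in> homological_fields E"
    and same_bracket: "derived_bracket E d = derived_bracket E d'"
    and c_generator: "c \<in> reduced_ops E 0 \<union> reduced_ops E 1"
  shows "d c = d' c"
proof -
  interpret d: homological_field E d by unfold_locales (rule d_homological)
  interpret d': homological_field E d' by unfold_locales (rule d'_homological)
  note anchor = derived_bracket_determines_anchor[OF d_homological d'_homological same_bracket]
  from c_generator show ?thesis
  proof
    assume "c \<in> reduced_ops E 0"
    then obtain f where f_Cinf: "c = fn f" "f \<in> Cinf E" using reduced_0_eq_fn by blast
    show ?thesis
    proof
      fix Xs
      show "d c Xs = d' c Xs"
        using anchor[OF f_Cinf(2)] covector_outside[OF d.d_fn_covector[OF f_Cinf(2)]]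
          covector_outside[OF d'.d_fn_covector[OF f_Cinf(2)]]
        by (cases "Xs \<in> args E 1") (auto simp: f_Cinf(1) args_1)
    qed
  next
    assume c_covector: "c \<in> reduced_ops E 1"
    show ?thesis
    proof
      fix Xs
      show "d c Xs = d' c Xs"
      proof (cases "Xs \<in> args E 2")
        case True
        then obtain X Y where "Xs = [X, Y]" "X \<in> Sec E" "Y \<in> Sec E" by (rule args_2E)
        then show ?thesis
          by (simp add: d.d_covector_eq d'.d_covector_eq c_covector d.\<rho>_def d'.\<rho>_def anchor
              same_bracket covector_Cinf)
      next
        case False
        then show ?thesis
          using reduced_outside[OF d.d_covector[OF c_covector]]
            reduced_outside[OF d'.d_covector[OF c_covector]] by simp
      qed
    qed
  qed
qed

lemma field_equiv_iff:
  "(d, d') \<in> field_equiv E \<longleftrightarrow> d \<in> homological_fields E \<and> d' \<in> homological_fields E \<and>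
    derived_bracket E d = derived_bracket E d'"
  unfolding field_equiv_def using derived_bracket_cong derived_bracket_inject by blast

end

theorem theorem8p6:
  fixes E :: "('m::{t2_space,second_countable_topology}, 'e::real_inner, 'v::real_vector, 'f::real_inner) vbundle"
  assumes "vector_bundle E"
  shows "\<exists>\<Theta>. bij_betw \<Theta> (homological_fields E // field_equiv E) (loday_algebroids E) \<and>
             (\<forall>d\<in>homological_fields E. \<Theta> (field_equiv E `` {d}) = derived_bracket E d)"
proof -
  interpret smooth_vector_bundle E by unfold_locales (rule assms)
  show ?thesis
    using bij_betw_quotient_kernel[of "field_equiv E", OF field_equiv_iff]
    unfolding derived_bracket_image .
qed

end
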